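(* Let $(M,K)$ be a Cartan space of constant curvature $c$, i.e. $R_{kij}=c(g_{jk}p_i-g_{ik}p_j)$ on $T^{*}M_0$, where $R_{kij}$ is defined by $[\delta_i,\delta_j]=R_{kij}\dot\partial^k$. Let $\beta>0$ be a real constant, $\tau=\frac12K^2$, and, where $1-2c\beta^2\tau>0$, let $G=G_{ij}dx^idx^j+G^{ij}\delta p_i\delta p_j$ with $$G_{ij}=\frac1\beta g_{ij}-c\beta\,p_ip_j,\qquad G^{ij}=\beta g^{ij}+\frac{c\beta^3}{1-2c\beta^2\tau}p^ip^j,$$ and $J(\delta_i)=G_{ik}\dot\partial^k$, $J(\dot\partial^i)=-G^{ik}\delta_k$. Then: (i) if $c<0$: $(T^{*}M_0,G,J)$ is a locally symmetric Kähler manifold if and only if $(M,K)$ is a Riemannian space; (ii) if $c>0$: $(T^{*}_\beta M_0,G,J)$ is a locally symmetric Kähler manifold if and only if $(M,K)$ is a Riemannian space, where $T^{*}_\beta M_0=\{(x,p)\in T^{*}M_0: 2\tau<\frac1{c\beta^2}\}$ is the tube around the zero section.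
   Context: $M$ is a smooth $n$-dimensional manifold, $T^{*}M_0$ is its cotangent bundle with the zero section removed, $(x^i,p_i)$ are the induced local coordinates, $\partial_i=\partial/\partial x^i$, $\dot\partial^i=\partial/\partial p_i$; the summation convention is used. A Cartan space $(M,K)$ is a manifold $M$ with a function $K:T^{*}M\to[0,\infty)$ that is $C^\infty$ on $T^{*}M_0$, satisfies $K(x,\lambda p)=\lambda K(x,p)$ for $\lambda>0$, and for which $g^{ij}(x,p)=\frac12\dot\partial^i\dot\partial^jK^2$ is positive definite on $T^{*}M_0$. Let $(g_{ij})=(g^{ij})^{-1}$ and $p^i=g^{ij}p_j=\frac12\dot\partial^iK^2$, so $K^2=g^{ij}p_ip_j$. $(M,K)$ is a Riemannian space if $C^{ijk}=-\frac14\dot\partial^i\dot\partial^j\dot\partial^kK^2$ vanishes identically on $T^{*}M_0$. Nonlinear connection: with $\gamma^i_{jk}=\frac12g^{is}(\partial_kg_{js}+\partial_jg_{sk}-\partial_sg_{jk})$, $\gamma^\circ_{jk}=\gamma^i_{jk}p_i$ and $\gamma^\circ_{j\circ}=\gamma^i_{jk}p_ip^k$, put $N_{ij}=\gamma^\circ_{ij}-\frac12\gamma^\circ_{h\circ}\dot\partial^hg_{ij}$ (symmetric in $i,j$). Then $\delta_i=\partial_i+N_{ij}\dot\partial^j$ and $\dot\partial^i$ form a local frame of $T(T^{*}M_0)$ with dual coframe $dx^i$, $\delta p_i=dp_i-N_{ji}dx^j$. The relation $[\delta_i,\delta_j]=R_{kij}\dot\partial^k$ means $R_{kij}=\delta_iN_{jk}-\delta_jN_{ik}$.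 Kähler means: integrable $J$, $J$-Hermitian metric $G$, closed 2-form $G(X,JY)$. Locally symmetric means that the curvature tensor of the Levi-Civita connection $\nabla$ of $G$ is parallel with respect to $\nabla$. *)

theory Defs
  imports "HOL-Analysis.Analysis"
begin

section \<open>Smooth maps between open subsets of Euclidean spaces\<close>

text \<open>These notions are meant for an open set \<open>S\<close>.\<close>

primrec Ck_on :: "nat \<Rightarrow> 'a::euclidean_space set \<Rightarrow> ('a \<Rightarrow> 'b::real_normed_vector) \<Rightarrow> bool" where
  "Ck_on 0 S f \<longleftrightarrow> continuous_on S f"
| "Ck_on (Suc k) S f \<longleftrightarrow> (\<forall>x\<in>S. f differentiable (at x)) \<and>
     (\<forall>v. Ck_on k S (\<lambda>x. frechet_derivative f (at x) v))"

definition smooth_on :: "'a::euclidean_space set \<Rightarrow> ('a \<Rightarrow> 'b::real_normed_vector) \<Rightarrow> bool" where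
  "smooth_on S f \<longleftrightarrow> (\<forall>k. Ck_on k S f)"


section \<open>Riemannian and almost complex geometry in a coordinate domain\<close>

text \<open>
  \<open>W\<close> is an open subset of a Euclidean space \<open>'e\<close>, the image of a chart. Each tangent space is
  \<open>'e\<close>; a vector field is a function \<open>'e \<Rightarrow> 'e\<close>, a metric is \<open>G z u v\<close> (point, two vectors),
  an endomorphism field is \<open>J z u\<close>.
\<close>

definition lie_bracket :: "('e::euclidean_space \<Rightarrow> 'e) \<Rightarrow> ('e \<Rightarrow> 'e) \<Rightarrow> 'e \<Rightarrow> 'e" where
  "lie_bracket X Y z =
     frechet_derivative Y (at z) (X z) - frechet_derivative X (at z) (Y z)"

definition riemannian_metric_on ::
    "'e::euclidean_space set \<Rightarrow> ('e \<Rightarrow> 'e \<Rightarrow> 'e \<Rightarrow> real) \<Rightarrow> bool" where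
  "riemannian_metric_on W G \<longleftrightarrow>
     (\<forall>z\<in>W. bilinear (G z) \<and> (\<forall>u v. G z u v = G z v u) \<and> (\<forall>u. u \<noteq> 0 \<longrightarrow> G z u u > 0)) \<and>
     (\<forall>u v. smooth_on W (\<lambda>z. G z u v))"

definition almost_complex_on :: "'e::euclidean_space set \<Rightarrow> ('e \<Rightarrow> 'e \<Rightarrow> 'e) \<Rightarrow> bool" where
  "almost_complex_on W J \<longleftrightarrow>
     (\<forall>z\<in>W. linear (J z) \<and> (\<forall>u. J z (J z u) = - u)) \<and>
     (\<forall>u. smooth_on W (\<lambda>z. J z u))"

definition nijenhuis ::
    "('e::euclidean_space \<Rightarrow> 'e \<Rightarrow> 'e) \<Rightarrow> ('e \<Rightarrow> 'e) \<Rightarrow> ('e \<Rightarrow> 'e) \<Rightarrow> 'e \<Rightarrow> 'e" where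
  "nijenhuis J X Y z =
     lie_bracket (\<lambda>y. J y (X y)) (\<lambda>y. J y (Y y)) z
     - J z (lie_bracket (\<lambda>y. J y (X y)) Y z)
     - J z (lie_bracket X (\<lambda>y. J y (Y y)) z)
     - lie_bracket X Y z"

text \<open>Integrability of \<open>J\<close> is the vanishing of its Nijenhuis tensor.\<close>

definition integrable_structure_on :: "'e::euclidean_space set \<Rightarrow> ('e \<Rightarrow> 'e \<Rightarrow> 'e) \<Rightarrow> bool" where
  "integrable_structure_on W J \<longleftrightarrow>
     (\<forall>X Y. smooth_on W X \<and> smooth_on W Y \<longrightarrow> (\<forall>z\<in>W. nijenhuis J X Y z = 0))"

text \<open>
  The summands below are the exterior derivative of \<open>\<omega>\<close> evaluated on constant vector fields,
  whose Lie brackets vanish.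
\<close>

definition closed_two_form_on ::
    "'e::euclidean_space set \<Rightarrow> ('e \<Rightarrow> 'e \<Rightarrow> 'e \<Rightarrow> real) \<Rightarrow> bool" where
  "closed_two_form_on W \<omega> \<longleftrightarrow>
     (\<forall>z\<in>W. \<forall>u v w.
        frechet_derivative (\<lambda>y. \<omega> y v w) (at z) u
      + frechet_derivative (\<lambda>y. \<omega> y w u) (at z) v
      + frechet_derivative (\<lambda>y. \<omega> y u v) (at z) w = 0)"

definition kaehler_on ::
    "'e::euclidean_space set \<Rightarrow> ('e \<Rightarrow> 'e \<Rightarrow> 'e \<Rightarrow> real) \<Rightarrow> ('e \<Rightarrow> 'e \<Rightarrow> 'e) \<Rightarrow> bool" where
  "kaehler_on W G J \<longleftrightarrow>
     riemannian_metric_on W G \<and> almost_complex_on W J \<and> integrable_structure_on W J \<and>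
     (\<forall>z\<in>W. \<forall>u v. G z (J z u) (J z v) = G z u v) \<and>
     closed_two_form_on W (\<lambda>z u v. G z u (J z v))"

text \<open>
  The Christoffel map \<open>\<Gamma>\<^sub>z(u,v)\<close> of the Levi-Civita connection, determined by the Koszul formula
  for constant vector fields; it is unique since \<open>G z\<close> is nondegenerate.
\<close>

definition christoffel :: "('e::euclidean_space \<Rightarrow> 'e \<Rightarrow> 'e \<Rightarrow> real) \<Rightarrow> 'e \<Rightarrow> 'e \<Rightarrow> 'e \<Rightarrow> 'e" where
  "christoffel G z u v = (THE x. \<forall>w.
     2 * G z x w = frechet_derivative (\<lambda>y. G y v w) (at z) u
                 + frechet_derivative (\<lambda>y. G y u w) (at z) v
                 - frechet_derivative (\<lambda>y. G y u v) (at z) w)"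

definition levi_civita ::
    "('e::euclidean_space \<Rightarrow> 'e \<Rightarrow> 'e \<Rightarrow> real) \<Rightarrow> ('e \<Rightarrow> 'e) \<Rightarrow> ('e \<Rightarrow> 'e) \<Rightarrow> 'e \<Rightarrow> 'e" where
  "levi_civita G X Y z = frechet_derivative Y (at z) (X z) + christoffel G z (X z) (Y z)"

definition curvature ::
    "('e::euclidean_space \<Rightarrow> 'e \<Rightarrow> 'e \<Rightarrow> real) \<Rightarrow> ('e \<Rightarrow> 'e) \<Rightarrow> ('e \<Rightarrow> 'e) \<Rightarrow> ('e \<Rightarrow> 'e) \<Rightarrow> 'e \<Rightarrow> 'e"
  where
  "curvature G X Y Z z =
     levi_civita G X (levi_civita G Y Z) z - levi_civita G Y (levi_civita G X Z) z
     - levi_civita G (lie_bracket X Y) Z z"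

definition nabla_curvature ::
    "('e::euclidean_space \<Rightarrow> 'e \<Rightarrow> 'e \<Rightarrow> real) \<Rightarrow>
     ('e \<Rightarrow> 'e) \<Rightarrow> ('e \<Rightarrow> 'e) \<Rightarrow> ('e \<Rightarrow> 'e) \<Rightarrow> ('e \<Rightarrow> 'e) \<Rightarrow> 'e \<Rightarrow> 'e" where
  "nabla_curvature G V X Y Z z =
     levi_civita G V (curvature G X Y Z) z
     - curvature G (levi_civita G V X) Y Z z
     - curvature G X (levi_civita G V Y) Z z
     - curvature G X Y (levi_civita G V Z) z"

definition locally_symmetric_on ::
    "'e::euclidean_space set \<Rightarrow> ('e \<Rightarrow> 'e \<Rightarrow> 'e \<Rightarrow> real) \<Rightarrow> bool" where
  "locally_symmetric_on W G \<longleftrightarrow>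
     (\<forall>V X Y Z. smooth_on W V \<and> smooth_on W X \<and> smooth_on W Y \<and> smooth_on W Z \<longrightarrow>
        (\<forall>z\<in>W. nabla_curvature G V X Y Z z = 0))"


section \<open>Smooth manifolds and their cotangent bundles\<close>

text \<open>A chart is a domain together with a coordinate map, whose values off the domain are junk.\<close>

type_synonym ('m, 'n) chart = "'m set \<times> ('m \<Rightarrow> real^'n)"

definition transition :: "('m, 'n::finite) chart \<Rightarrow> ('m, 'n) chart \<Rightarrow> real^'n \<Rightarrow> real^'n" where
  "transition \<kappa> \<kappa>' = snd \<kappa>' \<circ> inv_into (fst \<kappa>) (snd \<kappa>)"

definition smooth_manifold :: "'m topology \<Rightarrow> ('m, 'n::finite) chart set \<Rightarrow> bool" where
  "smooth_manifold M A \<longleftrightarrow>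
     Hausdorff_space M \<and> second_countable M \<and>
     (\<Union>\<kappa>\<in>A. fst \<kappa>) = topspace M \<and>
     (\<forall>\<kappa>\<in>A. openin M (fst \<kappa>) \<and> open (snd \<kappa> ` fst \<kappa>) \<and>
        homeomorphic_map (subtopology M (fst \<kappa>)) (top_of_set (snd \<kappa> ` fst \<kappa>)) (snd \<kappa>)) \<and>
     (\<forall>\<kappa>\<in>A. \<forall>\<kappa>'\<in>A. smooth_on (snd \<kappa> ` (fst \<kappa> \<inter> fst \<kappa>')) (transition \<kappa> \<kappa>'))"

text \<open>
  A covector at \<open>x\<close> is the family of its component vectors \<open>(p\<^sub>i)\<close> in all charts around \<open>x\<close>,
  subject to \<open>p\<^sub>i = (\<partial>x'\<^sup>j/\<partial>x\<^sup>i) p'\<^sub>j\<close>. The value 0 at the remaining charts makes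
  the representation unique, so the zero covector is \<open>\<lambda>_. 0\<close> and scaling is pointwise.
\<close>

type_synonym ('m, 'n) covector = "('m, 'n) chart \<Rightarrow> real^'n"

definition cotangent_space ::
    "('m, 'n::finite) chart set \<Rightarrow> 'm \<Rightarrow> ('m, 'n) covector set" where
  "cotangent_space A x = {\<omega>.
     (\<forall>\<kappa>\<in>A. \<forall>\<kappa>'\<in>A. x \<in> fst \<kappa> \<and> x \<in> fst \<kappa>' \<longrightarrow>
        (\<forall>i. \<omega> \<kappa> $ i = (\<Sum>j\<in>UNIV.
           frechet_derivative (transition \<kappa> \<kappa>') (at (snd \<kappa> x)) (axis i 1) $ j * \<omega> \<kappa>' $ j))) \<and>
     (\<forall>\<kappa>. \<not> (\<kappa> \<in> A \<and> x \<in> fst \<kappa>) \<longrightarrow> \<omega> \<kappa> = 0)}"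

definition cotangent_bundle ::
    "'m topology \<Rightarrow> ('m, 'n::finite) chart set \<Rightarrow> ('m \<times> ('m, 'n) covector) set" where
  "cotangent_bundle M A = {(x, \<omega>). x \<in> topspace M \<and> \<omega> \<in> cotangent_space A x}"

definition slit_cotangent_bundle ::
    "'m topology \<Rightarrow> ('m, 'n::finite) chart set \<Rightarrow> ('m \<times> ('m, 'n) covector) set" where
  "slit_cotangent_bundle M A = {(x, \<omega>) \<in> cotangent_bundle M A. \<omega> \<noteq> (\<lambda>_. 0)}"

text \<open>
  The part of a subset \<open>S\<close> of the cotangent bundle lying over a chart, the induced coordinates
  \<open>(x\<^sup>i, p\<^sub>i)\<close> there, and functions and sets written in these coordinates.
\<close>

definition over_chart ::
    "('m \<times> ('m, 'n::finite) covector) set \<Rightarrow> ('m, 'n) chart \<Rightarrow> ('m \<times> ('m, 'n) covector) set" where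
  "over_chart S \<kappa> = {(x, \<omega>) \<in> S. x \<in> fst \<kappa>}"

type_synonym 'n phase = "(real^'n) \<times> (real^'n)"

definition induced_chart ::
    "('m, 'n::finite) chart \<Rightarrow> 'm \<times> ('m, 'n) covector \<Rightarrow> 'n phase" where
  "induced_chart \<kappa> = (\<lambda>(x, \<omega>). (snd \<kappa> x, \<omega> \<kappa>))"

definition coord_domain ::
    "('m \<times> ('m, 'n::finite) covector) set \<Rightarrow> ('m, 'n) chart \<Rightarrow> 'n phase set" where
  "coord_domain S \<kappa> = induced_chart \<kappa> ` over_chart S \<kappa>"

definition coord_fun ::
    "'m topology \<Rightarrow> ('m, 'n::finite) chart set \<Rightarrow> ('m \<times> ('m, 'n) covector \<Rightarrow> real) \<Rightarrow>
     ('m, 'n) chart \<Rightarrow> 'n phase \<Rightarrow> real" where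
  "coord_fun M A K \<kappa> = K \<circ> inv_into (over_chart (cotangent_bundle M A) \<kappa>) (induced_chart \<kappa>)"


section \<open>Local formulas of Cartan geometry\<close>

text \<open>
  Throughout, \<open>L\<close> is the fundamental function in induced coordinates, \<open>z = (x, p)\<close>,
  \<open>dx i\<close> is \<open>\<partial>/\<partial>x\<^sup>i\<close> and \<open>dp i\<close> is \<open>\<partial>/\<partial>p\<^sub>i\<close>.
\<close>

definition dx :: "'n::finite \<Rightarrow> ('n phase \<Rightarrow> real) \<Rightarrow> 'n phase \<Rightarrow> real" where
  "dx i F z = frechet_derivative F (at z) (axis i 1, 0)"

definition dp :: "'n::finite \<Rightarrow> ('n phase \<Rightarrow> real) \<Rightarrow> 'n phase \<Rightarrow> real" where
  "dp i F z = frechet_derivative F (at z) (0, axis i 1)"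

definition g_up :: "('n::finite phase \<Rightarrow> real) \<Rightarrow> 'n phase \<Rightarrow> real^'n^'n" where
  "g_up L z = (\<chi> i j. 1/2 * dp i (dp j (\<lambda>w. (L w)\<^sup>2)) z)"

definition g_low :: "('n::finite phase \<Rightarrow> real) \<Rightarrow> 'n phase \<Rightarrow> real^'n^'n" where
  "g_low L z = matrix_inv (g_up L z)"

definition p_up :: "('n::finite phase \<Rightarrow> real) \<Rightarrow> 'n \<Rightarrow> 'n phase \<Rightarrow> real" where
  "p_up L i z = (\<Sum>j\<in>UNIV. g_up L z $ i $ j * snd z $ j)"

definition tau :: "('n::finite phase \<Rightarrow> real) \<Rightarrow> 'n phase \<Rightarrow> real" where
  "tau L z = 1/2 * (L z)\<^sup>2"

definition cartan_tensor ::
    "('n::finite phase \<Rightarrow> real) \<Rightarrow> 'n \<Rightarrow> 'n \<Rightarrow> 'n \<Rightarrow> 'n phase \<Rightarrow> real" where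
  "cartan_tensor L i j k z = - (1/4) * dp i (dp j (dp k (\<lambda>w. (L w)\<^sup>2))) z"

text \<open>\<open>gam L i j k\<close> is \<open>\<gamma>\<^sup>i\<^sub>j\<^sub>k\<close>, \<open>gam_o L j k\<close> is \<open>\<gamma>\<^sup>\<circ>\<^sub>j\<^sub>k\<close>, \<open>gam_oo L j\<close> is \<open>\<gamma>\<^sup>\<circ>\<^sub>j\<^sub>\<circ>\<close>.\<close>

definition gam :: "('n::finite phase \<Rightarrow> real) \<Rightarrow> 'n \<Rightarrow> 'n \<Rightarrow> 'n \<Rightarrow> 'n phase \<Rightarrow> real" where
  "gam L i j k z = 1/2 * (\<Sum>s\<in>UNIV. g_up L z $ i $ s *
     (dx k (\<lambda>w. g_low L w $ j $ s) z + dx j (\<lambda>w. g_low L w $ s $ k) z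
      - dx s (\<lambda>w. g_low L w $ j $ k) z))"

definition gam_o :: "('n::finite phase \<Rightarrow> real) \<Rightarrow> 'n \<Rightarrow> 'n \<Rightarrow> 'n phase \<Rightarrow> real" where
  "gam_o L j k z = (\<Sum>i\<in>UNIV. gam L i j k z * snd z $ i)"

definition gam_oo :: "('n::finite phase \<Rightarrow> real) \<Rightarrow> 'n \<Rightarrow> 'n phase \<Rightarrow> real" where
  "gam_oo L j z = (\<Sum>k\<in>UNIV. gam_o L j k z * p_up L k z)"

definition nonlin :: "('n::finite phase \<Rightarrow> real) \<Rightarrow> 'n \<Rightarrow> 'n \<Rightarrow> 'n phase \<Rightarrow> real" where
  "nonlin L i j z = gam_o L i j z
     - 1/2 * (\<Sum>h\<in>UNIV. gam_oo L h z * dp h (\<lambda>w. g_low L w $ i $ j) z)"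

text \<open>\<open>delta\<close> is \<open>\<delta>\<^sub>i\<close> as a derivation, \<open>delta_vec\<close> the same vector in coordinates.\<close>

definition delta :: "('n::finite phase \<Rightarrow> real) \<Rightarrow> 'n \<Rightarrow> ('n phase \<Rightarrow> real) \<Rightarrow> 'n phase \<Rightarrow> real" where
  "delta L i F z = dx i F z + (\<Sum>j\<in>UNIV. nonlin L i j z * dp j F z)"

definition delta_vec :: "('n::finite phase \<Rightarrow> real) \<Rightarrow> 'n \<Rightarrow> 'n phase \<Rightarrow> 'n phase" where
  "delta_vec L i z = (axis i 1, \<chi> j. nonlin L i j z)"

text \<open>The component \<open>R\<^sub>k\<^sub>i\<^sub>j\<close> of the bracket \<open>[\<delta>\<^sub>i, \<delta>\<^sub>j]\<close>.\<close>

definition R_curv :: "('n::finite phase \<Rightarrow> real) \<Rightarrow> 'n \<Rightarrow> 'n \<Rightarrow> 'n \<Rightarrow> 'n phase \<Rightarrow> real" where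
  "R_curv L k i j z = delta L i (nonlin L j k) z - delta L j (nonlin L i k) z"

text \<open>The coframe form \<open>\<delta>p\<^sub>i = dp\<^sub>i - N\<^sub>j\<^sub>i dx\<^sup>j\<close> applied to the vector \<open>v\<close>.\<close>

definition delta_p :: "('n::finite phase \<Rightarrow> real) \<Rightarrow> 'n \<Rightarrow> 'n phase \<Rightarrow> 'n phase \<Rightarrow> real" where
  "delta_p L i z v = snd v $ i - (\<Sum>j\<in>UNIV. nonlin L j i z * fst v $ j)"

definition GG_low ::
    "real \<Rightarrow> real \<Rightarrow> ('n::finite phase \<Rightarrow> real) \<Rightarrow> 'n \<Rightarrow> 'n \<Rightarrow> 'n phase \<Rightarrow> real" where
  "GG_low c \<beta> L i j z = 1 / \<beta> * g_low L z $ i $ j - c * \<beta> * snd z $ i * snd z $ j"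

definition GG_up ::
    "real \<Rightarrow> real \<Rightarrow> ('n::finite phase \<Rightarrow> real) \<Rightarrow> 'n \<Rightarrow> 'n \<Rightarrow> 'n phase \<Rightarrow> real" where
  "GG_up c \<beta> L i j z = \<beta> * g_up L z $ i $ j
     + c * \<beta> ^ 3 / (1 - 2 * c * \<beta>\<^sup>2 * tau L z) * p_up L i z * p_up L j z"

definition GG ::
    "real \<Rightarrow> real \<Rightarrow> ('n::finite phase \<Rightarrow> real) \<Rightarrow> 'n phase \<Rightarrow> 'n phase \<Rightarrow> 'n phase \<Rightarrow> real" where
  "GG c \<beta> L z u v =
     (\<Sum>i\<in>UNIV. \<Sum>j\<in>UNIV. GG_low c \<beta> L i j z * fst u $ i * fst v $ j)
   + (\<Sum>i\<in>UNIV. \<Sum>j\<in>UNIV. GG_up c \<beta> L i j z * delta_p L i z u * delta_p L j z v)"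

text \<open>
  Linear extension of \<open>J \<delta>\<^sub>i = G\<^sub>i\<^sub>k \<partial>/\<partial>p\<^sub>k\<close>, \<open>J (\<partial>/\<partial>p\<^sub>i) = - G\<^sup>i\<^sup>k \<delta>\<^sub>k\<close>, using
  \<open>v = dx\<^sup>i(v) \<delta>\<^sub>i + \<delta>p\<^sub>i(v) \<partial>/\<partial>p\<^sub>i\<close>.
\<close>

definition JJ ::
    "real \<Rightarrow> real \<Rightarrow> ('n::finite phase \<Rightarrow> real) \<Rightarrow> 'n phase \<Rightarrow> 'n phase \<Rightarrow> 'n phase" where
  "JJ c \<beta> L z v =
     (\<Sum>i\<in>UNIV. fst v $ i *\<^sub>R (\<Sum>k\<in>UNIV. GG_low c \<beta> L i k z *\<^sub>R (0, axis k 1)))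
   - (\<Sum>i\<in>UNIV. delta_p L i z v *\<^sub>R (\<Sum>k\<in>UNIV. GG_up c \<beta> L i k z *\<^sub>R delta_vec L k z))"


section \<open>Cartan spaces\<close>

definition cartan_space ::
    "'m topology \<Rightarrow> ('m, 'n::finite) chart set \<Rightarrow> ('m \<times> ('m, 'n) covector \<Rightarrow> real) \<Rightarrow> bool" where
  "cartan_space M A K \<longleftrightarrow>
     smooth_manifold M A \<and>
     (\<forall>(x, \<omega>) \<in> cotangent_bundle M A. K (x, \<omega>) \<ge> 0 \<and>
        (\<forall>t>0. K (x, \<lambda>\<kappa>. t *\<^sub>R \<omega> \<kappa>) = t * K (x, \<omega>))) \<and>
     (\<forall>\<kappa>\<in>A. smooth_on (coord_domain (slit_cotangent_bundle M A) \<kappa>) (coord_fun M A K \<kappa>)) \<and>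
     (\<forall>\<kappa>\<in>A. \<forall>z \<in> coord_domain (slit_cotangent_bundle M A) \<kappa>. \<forall>\<xi>. \<xi> \<noteq> 0 \<longrightarrow>
        (\<Sum>i\<in>UNIV. \<Sum>j\<in>UNIV. g_up (coord_fun M A K \<kappa>) z $ i $ j * \<xi> $ i * \<xi> $ j) > 0)"

definition constant_curvature ::
    "'m topology \<Rightarrow> ('m, 'n::finite) chart set \<Rightarrow> ('m \<times> ('m, 'n) covector \<Rightarrow> real) \<Rightarrow>
     real \<Rightarrow> bool" where
  "constant_curvature M A K c \<longleftrightarrow>
     (\<forall>\<kappa>\<in>A. \<forall>z \<in> coord_domain (slit_cotangent_bundle M A) \<kappa>. \<forall>i j k.
        R_curv (coord_fun M A K \<kappa>) k i j z =
        c * (g_low (coord_fun M A K \<kappa>) z $ j $ k * snd z $ i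
             - g_low (coord_fun M A K \<kappa>) z $ i $ k * snd z $ j))"

definition riemannian_space ::
    "'m topology \<Rightarrow> ('m, 'n::finite) chart set \<Rightarrow> ('m \<times> ('m, 'n) covector \<Rightarrow> real) \<Rightarrow> bool" where
  "riemannian_space M A K \<longleftrightarrow>
     (\<forall>\<kappa>\<in>A. \<forall>z \<in> coord_domain (slit_cotangent_bundle M A) \<kappa>. \<forall>i j k.
        cartan_tensor (coord_fun M A K \<kappa>) i j k z = 0)"

definition tube ::
    "'m topology \<Rightarrow> ('m, 'n::finite) chart set \<Rightarrow> ('m \<times> ('m, 'n) covector \<Rightarrow> real) \<Rightarrow>
     real \<Rightarrow> real \<Rightarrow> ('m \<times> ('m, 'n) covector) set" where
  "tube M A K c \<beta> = {q \<in> slit_cotangent_bundle M A. 2 * (1/2 * (K q)\<^sup>2) < 1 / (c * \<beta>\<^sup>2)}"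

text \<open>
  For an open subset \<open>S\<close> of the cotangent bundle and tensor fields given by their coordinate
  expressions \<open>G \<kappa>\<close>, \<open>J \<kappa>\<close> in the induced charts. The conditions being tensorial, they are imposed
  in every induced chart.
\<close>

definition locally_symmetric_kaehler ::
    "('m, 'n::finite) chart set \<Rightarrow> ('m \<times> ('m, 'n) covector) set \<Rightarrow>
     (('m, 'n) chart \<Rightarrow> 'n phase \<Rightarrow> 'n phase \<Rightarrow> 'n phase \<Rightarrow> real) \<Rightarrow>
     (('m, 'n) chart \<Rightarrow> 'n phase \<Rightarrow> 'n phase \<Rightarrow> 'n phase) \<Rightarrow> bool" where
  "locally_symmetric_kaehler A S G J \<longleftrightarrow>
     (\<forall>\<kappa>\<in>A. kaehler_on (coord_domain S \<kappa>) (G \<kappa>) (J \<kappa>) \<and>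
             locally_symmetric_on (coord_domain S \<kappa>) (G \<kappa>))"

end

theory Submission
  imports Defs
begin

text \<open>
  If \<open>(M, K)\<close> is Riemannian, the Levi-Civita connection of \<open>G\<close> in the frame \<open>(\<delta>\<^sub>i, \<partial>/\<partial>p\<^sub>i)\<close> is explicit: with
  \<open>k = c \<beta>\<close> and the Liouville form \<open>\<theta> = p\<^sub>i dx\<^sup>i\<close> it makes \<open>J\<close> parallel and turns the reflection \<open>S\<close> in the
  horizontal distribution into \<open>J S\<close> at the rate \<open>2 k \<theta>\<close>. The curvature is a universal expression in
  \<open>G\<close>, \<open>J\<close> and the circle of reflections spanned by \<open>S\<close> and \<open>J S\<close> (that of a complex quadric), hence parallel.

  Conversely, the Liouville field \<open>\<xi> = p\<^sub>i \<partial>/\<partial>p\<^sub>i\<close> is a gradient, so \<open>\<nabla>\<xi>\<close> is half the Lie derivative of \<open>G\<close>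
  along \<open>\<xi>\<close>, which the homogeneity of \<open>K\<close> makes explicit and free of the Cartan tensor. For \<open>u, w, b\<close> orthogonal
  to \<open>p\<close> the component \<open>G(R(u\<^sup>h, b\<^sup>v)\<xi>, w\<^sup>h)\<close> is a multiple of \<open>C(u, w, b)\<close> and thus homogeneous of degree \<open>-1\<close>
  in \<open>p\<close>, whereas \<open>\<nabla>R = 0\<close> makes its radial derivative a positive multiple of it. Therefore \<open>C = 0\<close>.
\<close>

section \<open>Calculus of smooth maps\<close>

text \<open>Both signs of c are one case: put \<open>disc\<close> = 1 - c \<beta>^2 K^2 and work on
  {disc > 0}, which is the whole slit bundle for c < 0 and the tube for c > 0. In the tube case
  local symmetry gives C = 0 only inside the tube; every ray enters the tube, and homogeneity of C
  carries the vanishing outwards. The curvature is parallel because differentiation rotates the pair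
  (S, J S), and S and J S enter the curvature only through a sum that this rotation leaves
  unchanged. In the converse, at the point considered, frame fields whose coefficients are
  orthogonal to p are parallel along \<xi>, whereas \<nabla>_\<xi> \<xi> = \<xi> / disc. So
  \<nabla>R = 0 demands the radial rate 1/disc > 0 of a quantity whose rate is -1 by homogeneity.
  The restriction to vectors orthogonal to p loses nothing, since p annihilates C. The obstacle that
  shapes the text is the distance between index formulas in charts and these tensorial arguments:
  matrices become operators on the coordinate space, and each direction is proved in an abstract
  locale that keeps only the identities it needs.\<close>

abbreviation dd :: "('a::real_normed_vector \<Rightarrow> 'b::real_normed_vector) \<Rightarrow> 'a \<Rightarrow> 'a \<Rightarrow> 'b" where
  "dd f z \<equiv> frechet_derivative f (at z)"

lemma dd_works: "f differentiable (at z) \<Longrightarrow> (f has_derivative dd f z) (at z)"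
  by (rule frechet_derivative_works[THEN iffD1])

lemma dd_eqI: "(f has_derivative f') (at z) \<Longrightarrow> dd f z = f'"
  using frechet_derivative_at by metis

lemma dd_cong_open:
  assumes "open S" "z \<in> S" "\<And>x. x \<in> S \<Longrightarrow> f x = g x"
  shows "dd f z = dd g z"
proof -
  have "(f has_derivative f') (at z) \<longleftrightarrow> (g has_derivative f') (at z)" for f'
  proof
    show "(g has_derivative f') (at z)" if "(f has_derivative f') (at z)"
      using that assms by (rule has_derivative_transform_within_open)
    show "(f has_derivative f') (at z)" if "(g has_derivative f') (at z)"
      using that assms(1,2) by (rule has_derivative_transform_within_open) (simp add: assms(3))
  qed
  then show ?thesis unfolding frechet_derivative_def by simp
qed

lemma differentiable_cong_open:
  assumes "open S" "z \<in> S" "\<And>x. x \<in> S \<Longrightarrow> f x = g x" "f differentiable (at z)"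
  shows "g differentiable (at z)"
proof -
  obtain f' where "(f has_derivative f') (at z)"
    using assms(4) dd_works by blast
  then have "(g has_derivative f') (at z)"
    using assms(1-3) by (rule has_derivative_transform_within_open)
  then show ?thesis by (rule differentiableI)
qed

lemma dd_add:
  "f differentiable (at z) \<Longrightarrow> g differentiable (at z) \<Longrightarrow>
    dd (\<lambda>x. f x + g x) z h = dd f z h + dd g z h"
  using fun_cong[OF dd_eqI[OF has_derivative_add[OF dd_works[of f z] dd_works[of g z]]], of h] by simp

lemma dd_diff:
  "f differentiable (at z) \<Longrightarrow> g differentiable (at z) \<Longrightarrow>
    dd (\<lambda>x. f x - g x) z h = dd f z h - dd g z h"
  using fun_cong[OF dd_eqI[OF has_derivative_diff[OF dd_works[of f z] dd_works[of g z]]], of h] by simp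

lemma dd_minus: "f differentiable (at z) \<Longrightarrow> dd (\<lambda>x. - f x) z h = - dd f z h"
  using fun_cong[OF dd_eqI[OF has_derivative_minus[OF dd_works[of f z]]], of h] by simp

lemma dd_bilinear:
  assumes "bounded_bilinear P" "f differentiable (at z)" "g differentiable (at z)"
  shows "dd (\<lambda>x. P (f x) (g x)) z h = P (f z) (dd g z h) + P (dd f z h) (g z)"
  using fun_cong[OF dd_eqI[OF bounded_bilinear.FDERIV[OF assms(1) dd_works[OF assms(2)] dd_works[OF assms(3)]]], of h] by simp

lemmas dd_mult = dd_bilinear[OF bounded_bilinear_mult]
lemmas dd_inner = dd_bilinear[OF bounded_bilinear_inner]
lemmas dd_scaleR = dd_bilinear[OF bounded_bilinear_scaleR]

lemma dd_bounded_linear: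
  assumes "bounded_linear F" "f differentiable (at z)"
  shows "dd (\<lambda>x. F (f x)) z h = F (dd f z h)"
  using fun_cong[OF dd_eqI[OF bounded_linear.has_derivative[OF assms(1) dd_works[OF assms(2)]]], of h] by simp

lemma dd_self: "bounded_linear F \<Longrightarrow> dd F z = F"
  by (intro dd_eqI) (rule bounded_linear_imp_has_derivative)

lemma dd_sum:
  assumes "\<And>i. i \<in> I \<Longrightarrow> f i differentiable (at z)"
  shows "dd (\<lambda>x. \<Sum>i\<in>I. f i x) z h = (\<Sum>i\<in>I. dd (f i) z h)"
proof -
  have "((\<lambda>x. \<Sum>i\<in>I. f i x) has_derivative (\<lambda>h. \<Sum>i\<in>I. dd (f i) z h)) (at z)"
    by (intro has_derivative_sum dd_works assms)
  from fun_cong[OF dd_eqI[OF this], of h] show ?thesis by simp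
qed

lemma dd_Pair:
  assumes "f differentiable (at z)" "g differentiable (at z)"
  shows "dd (\<lambda>x. (f x, g x)) z h = (dd f z h, dd g z h)"
  using fun_cong[OF dd_eqI[OF has_derivative_Pair[OF dd_works[OF assms(1)] dd_works[OF assms(2)]]], of h]
  by simp

lemma dd_linear: "f differentiable (at z) \<Longrightarrow> linear (dd f z)"
  by (rule linear_frechet_derivative)

lemma differentiable_bounded_linear:
  "bounded_linear F \<Longrightarrow> f differentiable (at z) \<Longrightarrow> (\<lambda>x. F (f x)) differentiable (at z)"
  by (rule differentiableI[OF bounded_linear.has_derivative[OF _ dd_works]])

lemma differentiable_bilinear:
  assumes "bounded_bilinear P" "f differentiable (at z)" "g differentiable (at z)"
  shows "(\<lambda>x. P (f x) (g x)) differentiable (at z)"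
  by (rule differentiableI[OF bounded_bilinear.FDERIV[OF assms(1) dd_works[OF assms(2)] dd_works[OF assms(3)]]])

section \<open>Closure of C^k and smooth maps under algebraic operations\<close>

lemma Ck_on_differentiable: "Ck_on (Suc k) S f \<Longrightarrow> x \<in> S \<Longrightarrow> f differentiable (at x)"
  by simp

lemma Ck_on_Suc_imp: "Ck_on (Suc k) S f \<Longrightarrow> Ck_on k S f"
proof (induction k arbitrary: f)
  case 0
  then show ?case
    by (simp add: continuous_at_imp_continuous_on differentiable_imp_continuous_within)
next
  case (Suc k)
  have "Ck_on k S (\<lambda>x. dd f x v)" for v
    by (rule Suc.IH) (use Suc.prems in simp)
  with Suc.prems show ?case unfolding Ck_on.simps by blast
qed

lemma Ck_on_cong:
  assumes "open S" "\<And>x. x \<in> S \<Longrightarrow> f x = g x" "Ck_on k S f"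
  shows "Ck_on k S g"
  using assms
proof (induction k arbitrary: f g)
  case 0
  then show ?case using continuous_on_cong[of S S f g] unfolding Ck_on.simps by blast
next
  case (Suc k)
  have 1: "g differentiable (at x)" if "x \<in> S" for x
    using differentiable_cong_open[OF Suc.prems(1) that Suc.prems(2)] Suc.prems(3) that by auto
  have 2: "dd f x v = dd g x v" if "x \<in> S" for x v
    using dd_cong_open[OF Suc.prems(1) that Suc.prems(2)] by simp
  have "Ck_on k S (\<lambda>x. dd g x v)" for v
    by (rule Suc.IH[OF Suc.prems(1) 2]) (use Suc.prems(3) in auto)
  with 1 show ?case unfolding Ck_on.simps by blast
qed

lemma Ck_on_subset: "Ck_on k S f \<Longrightarrow> T \<subseteq> S \<Longrightarrow> Ck_on k T f"
proof (induction k arbitrary: f)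
  case 0
  then show ?case using continuous_on_subset unfolding Ck_on.simps by blast
next
  case (Suc k)
  have "Ck_on k T (\<lambda>x. dd f x v)" for v
    by (rule Suc.IH) (use Suc.prems in auto)
  with Suc.prems show ?case unfolding Ck_on.simps by blast
qed

lemma Ck_on_const: "Ck_on k S (\<lambda>x. c)"
proof (induction k arbitrary: c)
  case (Suc k) then show ?case by (simp add: frechet_derivative_const)
qed simp

lemma Ck_on_bounded_linear:
  assumes "open S" "bounded_linear F" "Ck_on k S f"
  shows "Ck_on k S (\<lambda>x. F (f x))"
  using assms(3)
proof (induction k arbitrary: f)
  case 0
  then show ?case
    using assms(2) by (simp add: bounded_linear.continuous_on)
next
  case (Suc k)
  have "Ck_on k S (\<lambda>x. dd (\<lambda>x. F (f x)) x v)" for v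
    by (rule Ck_on_cong[OF assms(1) _ Suc.IH[of "\<lambda>x. dd f x v"]])
      (use Suc.prems in \<open>auto simp: dd_bounded_linear[OF assms(2)]\<close>)
  moreover have "(\<lambda>x. F (f x)) differentiable (at x)" if "x \<in> S" for x
    using Suc.prems that by (intro differentiable_bounded_linear[OF assms(2)]) auto
  ultimately show ?case by simp
qed

lemma Ck_on_add:
  assumes "open S" "Ck_on k S f" "Ck_on k S g"
  shows "Ck_on k S (\<lambda>x. f x + g x)"
  using assms(2,3)
proof (induction k arbitrary: f g)
  case 0
  then show ?case by (simp add: continuous_on_add)
next
  case (Suc k)
  have "Ck_on k S (\<lambda>x. dd (\<lambda>x. f x + g x) x v)" for v
    by (rule Ck_on_cong[OF assms(1) _ Suc.IH[of "\<lambda>x. dd f x v" "\<lambda>x. dd g x v"]])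
      (use Suc.prems in \<open>auto simp: dd_add\<close>)
  then show ?case using Suc.prems by simp
qed

lemma Ck_on_bilinear:
  assumes "open S" "bounded_bilinear P" "Ck_on k S f" "Ck_on k S g"
  shows "Ck_on k S (\<lambda>x. P (f x) (g x))"
  using assms(3,4)
proof (induction k arbitrary: f g)
  case 0
  then show ?case using assms(2) by (simp add: bounded_bilinear.continuous_on)
next
  case (Suc k)
  note fg = Ck_on_Suc_imp[OF Suc.prems(1)] Ck_on_Suc_imp[OF Suc.prems(2)]
  have "Ck_on k S (\<lambda>x. dd (\<lambda>x. P (f x) (g x)) x v)" for v
    by (rule Ck_on_cong[OF assms(1) _ Ck_on_add[OF assms(1)
            Suc.IH[of f "\<lambda>x. dd g x v"] Suc.IH[of "\<lambda>x. dd f x v" g]]])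
      (use Suc.prems fg in \<open>auto simp: dd_bilinear[OF assms(2)]\<close>)
  moreover have "(\<lambda>x. P (f x) (g x)) differentiable (at x)" if "x \<in> S" for x
    using Suc.prems that by (intro differentiable_bilinear[OF assms(2)]) auto
  ultimately show ?case by simp
qed

lemma Ck_on_ident: "Ck_on k S (\<lambda>x. x)"
  by (cases k) (simp_all add: Ck_on_const)

text \<open>The derivative of 1/f is a product of 1/f, 1/f and f', so the induction on k feeds on
  itself.\<close>

lemma Ck_on_inverse:
  fixes f :: "'a::euclidean_space \<Rightarrow> real"
  assumes "open S" "\<And>x. x \<in> S \<Longrightarrow> f x \<noteq> 0" "Ck_on k S f"
  shows "Ck_on k S (\<lambda>x. inverse (f x))"
  using assms(3)
proof (induction k)
  case 0
  then show ?case using assms(2) by (auto intro!: continuous_intros)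
next
  case (Suc k)
  have inv: "Ck_on k S (\<lambda>x. inverse (f x))"
    by (rule Suc.IH[OF Ck_on_Suc_imp[OF Suc.prems]])
  have der: "((\<lambda>x. inverse (f x)) has_derivative
      (\<lambda>h. - (inverse (f x) * dd f x h * inverse (f x)))) (at x)" if "x \<in> S" for x
    using Suc.prems that assms(2) by (intro Deriv.has_derivative_inverse dd_works) auto
  have eq: "(- 1) * (inverse (f x) * dd f x v * inverse (f x)) = dd (\<lambda>x. inverse (f x)) x v"
    if "x \<in> S" for x v
    using dd_eqI[OF der[OF that]] by simp
  have "Ck_on k S (\<lambda>x. (- 1) * (inverse (f x) * dd f x v * inverse (f x)))" for v
    using Suc.prems inv
    by (intro Ck_on_bilinear[OF assms(1) bounded_bilinear_mult] Ck_on_const) auto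
  then have "Ck_on k S (\<lambda>x. dd (\<lambda>x. inverse (f x)) x v)" for v
    by (rule Ck_on_cong[OF assms(1), rotated]) (rule eq)
  moreover have "(\<lambda>x. inverse (f x)) differentiable (at x)" if "x \<in> S" for x
    by (rule differentiableI[OF der[OF that]])
  ultimately show ?case by simp
qed

lemma smooth_on_differentiable: "smooth_on S f \<Longrightarrow> x \<in> S \<Longrightarrow> f differentiable (at x)"
  unfolding smooth_on_def using Ck_on_differentiable by blast

lemma smooth_on_deriv: "smooth_on S f \<Longrightarrow> smooth_on S (\<lambda>x. dd f x v)"
  unfolding smooth_on_def by (metis Ck_on.simps(2))

lemma smooth_on_subset: "smooth_on S f \<Longrightarrow> T \<subseteq> S \<Longrightarrow> smooth_on T f"
  unfolding smooth_on_def using Ck_on_subset by blast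

lemma smooth_on_cong:
  "open S \<Longrightarrow> (\<And>x. x \<in> S \<Longrightarrow> f x = g x) \<Longrightarrow> smooth_on S f \<Longrightarrow> smooth_on S g"
  unfolding smooth_on_def using Ck_on_cong by metis

lemma smooth_on_continuous: "smooth_on S f \<Longrightarrow> continuous_on S f"
  unfolding smooth_on_def by (metis Ck_on.simps(1))

lemma smooth_on_const: "smooth_on S (\<lambda>x. c)"
  unfolding smooth_on_def using Ck_on_const by blast

lemma smooth_on_ident: "smooth_on S (\<lambda>x. x)"
  unfolding smooth_on_def using Ck_on_ident by blast

lemma smooth_on_bounded_linear:
  "open S \<Longrightarrow> bounded_linear F \<Longrightarrow> smooth_on S f \<Longrightarrow> smooth_on S (\<lambda>x. F (f x))"
  unfolding smooth_on_def using Ck_on_bounded_linear by blast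

lemma smooth_on_add:
  "open S \<Longrightarrow> smooth_on S f \<Longrightarrow> smooth_on S g \<Longrightarrow> smooth_on S (\<lambda>x. f x + g x)"
  unfolding smooth_on_def using Ck_on_add by blast

lemma smooth_on_bilinear:
  "open S \<Longrightarrow> bounded_bilinear P \<Longrightarrow> smooth_on S f \<Longrightarrow> smooth_on S g \<Longrightarrow>
    smooth_on S (\<lambda>x. P (f x) (g x))"
  unfolding smooth_on_def using Ck_on_bilinear by blast

lemma smooth_on_inverse:
  fixes f :: "'a::euclidean_space \<Rightarrow> real"
  shows "open S \<Longrightarrow> (\<And>x. x \<in> S \<Longrightarrow> f x \<noteq> 0) \<Longrightarrow> smooth_on S f \<Longrightarrow>
    smooth_on S (\<lambda>x. inverse (f x))"
  unfolding smooth_on_def using Ck_on_inverse by blast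

lemma smooth_on_mult:
  fixes f g :: "'a::euclidean_space \<Rightarrow> real"
  shows "open S \<Longrightarrow> smooth_on S f \<Longrightarrow> smooth_on S g \<Longrightarrow> smooth_on S (\<lambda>x. f x * g x)"
  by (rule smooth_on_bilinear[OF _ bounded_bilinear_mult])

lemma smooth_on_scaleR:
  "open S \<Longrightarrow> smooth_on S f \<Longrightarrow> smooth_on S g \<Longrightarrow> smooth_on S (\<lambda>x. f x *\<^sub>R g x)"
  by (rule smooth_on_bilinear[OF _ bounded_bilinear_scaleR])

lemma smooth_on_inner:
  "open S \<Longrightarrow> smooth_on S f \<Longrightarrow> smooth_on S g \<Longrightarrow> smooth_on S (\<lambda>x. f x \<bullet> g x)"
  by (rule smooth_on_bilinear[OF _ bounded_bilinear_inner])

lemma smooth_on_minus: "open S \<Longrightarrow> smooth_on S f \<Longrightarrow> smooth_on S (\<lambda>x. - f x)"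
  by (rule smooth_on_bounded_linear[OF _ bounded_linear_minus[OF bounded_linear_ident]])

lemma smooth_on_diff:
  "open S \<Longrightarrow> smooth_on S f \<Longrightarrow> smooth_on S g \<Longrightarrow> smooth_on S (\<lambda>x. f x - g x)"
  using smooth_on_add[of S f "\<lambda>x. - g x"] smooth_on_minus[of S g] by simp

lemma smooth_on_sum:
  assumes "open S" "\<And>i. i \<in> I \<Longrightarrow> smooth_on S (f i)"
  shows "smooth_on S (\<lambda>x. \<Sum>i\<in>I. f i x)"
  using assms(2)
proof (induction I rule: infinite_finite_induct)
  case (insert i I)
  then show ?case using smooth_on_add[OF assms(1), of "f i"] by simp
qed (simp_all add: smooth_on_const)

lemma smooth_on_prod:
  fixes f :: "'i \<Rightarrow> 'a::euclidean_space \<Rightarrow> real"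
  assumes "open S" "\<And>i. i \<in> I \<Longrightarrow> smooth_on S (f i)"
  shows "smooth_on S (\<lambda>x. \<Prod>i\<in>I. f i x)"
  using assms(2)
proof (induction I rule: infinite_finite_induct)
  case (insert i I)
  then show ?case using smooth_on_mult[OF assms(1), of "f i"] by simp
qed (simp_all add: smooth_on_const)

lemma smooth_on_power:
  fixes f :: "'a::euclidean_space \<Rightarrow> real"
  shows "open S \<Longrightarrow> smooth_on S f \<Longrightarrow> smooth_on S (\<lambda>x. f x ^ n)"
  by (induction n) (auto intro: smooth_on_mult smooth_on_const)

lemma smooth_on_divide:
  fixes f g :: "'a::euclidean_space \<Rightarrow> real"
  shows "open S \<Longrightarrow> (\<And>x. x \<in> S \<Longrightarrow> g x \<noteq> 0) \<Longrightarrow> smooth_on S f \<Longrightarrow> smooth_on S g \<Longrightarrow>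
    smooth_on S (\<lambda>x. f x / g x)"
  unfolding divide_inverse by (intro smooth_on_mult smooth_on_inverse)

lemma smooth_on_fst: "open S \<Longrightarrow> smooth_on S f \<Longrightarrow> smooth_on S (\<lambda>x. fst (f x))"
  by (rule smooth_on_bounded_linear[OF _ bounded_linear_fst])

lemma smooth_on_snd: "open S \<Longrightarrow> smooth_on S f \<Longrightarrow> smooth_on S (\<lambda>x. snd (f x))"
  by (rule smooth_on_bounded_linear[OF _ bounded_linear_snd])

lemma smooth_on_Pair:
  assumes "open S" "smooth_on S f" "smooth_on S g"
  shows "smooth_on S (\<lambda>x. (f x, g x))"
proof -
  have "smooth_on S (\<lambda>x. (f x, 0) + (0, g x))"
    using assms by (intro smooth_on_add smooth_on_bounded_linear[of S "\<lambda>y. (y, 0)" f]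
       smooth_on_bounded_linear[of S "\<lambda>y. (0, y)" g])
      (auto intro!: bounded_linear_Pair bounded_linear_ident bounded_linear_zero)
  then show ?thesis by simp
qed

lemma smooth_on_nth: "open S \<Longrightarrow> smooth_on S f \<Longrightarrow> smooth_on S (\<lambda>x. f x $ i)"
  by (rule smooth_on_bounded_linear[OF _ bounded_linear_vec_nth])

lemma smooth_on_vec:
  fixes f :: "'n::finite \<Rightarrow> 'a::euclidean_space \<Rightarrow> 'b::euclidean_space"
  assumes "open S" "\<And>i. smooth_on S (f i)"
  shows "smooth_on S (\<lambda>x. \<chi> i. f i x)"
proof -
  \<comment> \<open>The vector is rebuilt as a finite sum of scalar functions times constant
    vectors, for which closure rules are at hand.\<close>
  have *: "(\<Sum>b\<in>Basis. \<Sum>i\<in>UNIV. (f i x \<bullet> b) *\<^sub>R axis i b) = (\<chi> i. f i x)" for x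
  proof (subst vec_eq_iff, intro allI)
    fix j
    have "(\<Sum>b\<in>Basis. \<Sum>i\<in>UNIV. (f i x \<bullet> b) *\<^sub>R axis i b) $ j
        = (\<Sum>b\<in>Basis. \<Sum>i\<in>UNIV. if i = j then (f i x \<bullet> b) *\<^sub>R b else 0)"
      by (simp add: axis_def if_distrib[of "\<lambda>x. _ *\<^sub>R x"] eq_commute[of j] cong: if_cong)
    also have "\<dots> = (\<Sum>b\<in>Basis. (f j x \<bullet> b) *\<^sub>R b)"
      by simp
    also have "\<dots> = f j x"
      by (rule euclidean_representation)
    finally show "(\<Sum>b\<in>Basis. \<Sum>i\<in>UNIV. (f i x \<bullet> b) *\<^sub>R axis i b) $ j = (\<chi> i. f i x) $ j"
      by simp
  qed
  have "smooth_on S (\<lambda>x. \<Sum>b\<in>Basis. \<Sum>i\<in>UNIV. (f i x \<bullet> b) *\<^sub>R axis i b)"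
    using assms by (intro smooth_on_sum smooth_on_scaleR smooth_on_inner smooth_on_const)
  then show ?thesis by (simp add: *)
qed

lemmas smooth_intros = smooth_on_add smooth_on_diff smooth_on_minus smooth_on_mult
  smooth_on_scaleR smooth_on_inner smooth_on_sum smooth_on_prod smooth_on_power
  smooth_on_fst smooth_on_snd smooth_on_Pair smooth_on_nth smooth_on_vec smooth_on_const
  smooth_on_ident smooth_on_deriv

section \<open>Symmetry of second derivatives\<close>

text \<open>Mean value theorem applied twice to the second difference of \<open>f\<close>.\<close>

lemma second_difference:
  fixes f :: "'a::euclidean_space \<Rightarrow> real"
  assumes "smooth_on S f" "ball z r \<subseteq> S" "h > 0" "h * (norm u + norm v) < r"
  shows "\<exists>x. norm (x - z) \<le> h * (norm u + norm v) \<and>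
    f (z + h *\<^sub>R u + h *\<^sub>R v) - f (z + h *\<^sub>R u) - f (z + h *\<^sub>R v) + f z
      = h * h * dd (\<lambda>y. dd f y u) x v"
proof -
  have bound: "norm (s *\<^sub>R u + t *\<^sub>R v) \<le> h * (norm u + norm v)"
    if "0 \<le> s" "s \<le> h" "0 \<le> t" "t \<le> h" for s t
  proof -
    have "norm (s *\<^sub>R u + t *\<^sub>R v) \<le> s * norm u + t * norm v"
      using norm_triangle_ineq[of "s *\<^sub>R u" "t *\<^sub>R v"] that by simp
    also have "\<dots> \<le> h * norm u + h * norm v"
      using that by (intro add_mono mult_right_mono) auto
    finally show ?thesis by (simp add: algebra_simps)
  qed
  have inS: "z + s *\<^sub>R u + t *\<^sub>R v \<in> S" if "0 \<le> s" "s \<le> h" "0 \<le> t" "t \<le> h" for s t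
  proof -
    have "z - (z + s *\<^sub>R u + t *\<^sub>R v) = - (s *\<^sub>R u + t *\<^sub>R v)"
      by simp
    then have "dist z (z + s *\<^sub>R u + t *\<^sub>R v) = norm (s *\<^sub>R u + t *\<^sub>R v)"
      unfolding dist_norm by (simp only: norm_minus_cancel)
    then show ?thesis using bound[OF that] assms by auto
  qed
  have line: "((\<lambda>s. F (w + s *\<^sub>R e)) has_real_derivative dd F (w + s *\<^sub>R e) e) (at s)"
    if "F differentiable (at (w + s *\<^sub>R e))" for F :: "'a \<Rightarrow> real" and w e s
  proof -
    have "((\<lambda>s. F (w + s *\<^sub>R e)) has_derivative (\<lambda>t. dd F (w + s *\<^sub>R e) (t *\<^sub>R e))) (at s)"
      by (rule has_derivative_compose[where g = F and f = "\<lambda>s. w + s *\<^sub>R e", OF _ dd_works[OF that]])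
        (auto intro!: derivative_eq_intros)
    moreover have "dd F (w + s *\<^sub>R e) (t *\<^sub>R e) = t * dd F (w + s *\<^sub>R e) e" for t
      using linear_cmul[OF dd_linear[OF that]] by simp
    ultimately show ?thesis
      by (simp add: has_field_derivative_def mult.commute[of _ "dd F (w + s *\<^sub>R e) e"])
  qed
  have dif: "f differentiable (at (z + s *\<^sub>R u + t *\<^sub>R v))"
    "(\<lambda>y. dd f y u) differentiable (at (z + s *\<^sub>R u + t *\<^sub>R v))"
    if "0 \<le> s" "s \<le> h" "0 \<le> t" "t \<le> h" for s t
    using smooth_on_differentiable[OF assms(1) inS[OF that]]
      smooth_on_differentiable[OF smooth_on_deriv[OF assms(1)] inS[OF that]] by auto
  define g where "g s = f (z + h *\<^sub>R v + s *\<^sub>R u) - f (z + s *\<^sub>R u)" for s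
  have g': "(g has_real_derivative dd f (z + h *\<^sub>R v + s *\<^sub>R u) u - dd f (z + s *\<^sub>R u) u) (at s)"
    if "0 \<le> s" "s \<le> h" for s
    unfolding g_def using dif(1)[of s h] dif(1)[of s 0] that assms(3)
    by (intro DERIV_diff line) (auto simp: algebra_simps)
  obtain s where s: "0 < s" "s < h"
    "g h - g 0 = (h - 0) * (dd f (z + h *\<^sub>R v + s *\<^sub>R u) u - dd f (z + s *\<^sub>R u) u)"
    using MVT2[OF assms(3) g'] by auto
  define k where "k t = dd f (z + s *\<^sub>R u + t *\<^sub>R v) u" for t
  have k': "(k has_real_derivative dd (\<lambda>y. dd f y u) (z + s *\<^sub>R u + t *\<^sub>R v) v) (at t)"
    if "0 \<le> t" "t \<le> h" for t
    unfolding k_def using dif(2)[of s t] that s by (intro line) auto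
  obtain t where t: "0 < t" "t < h"
    "k h - k 0 = (h - 0) * dd (\<lambda>y. dd f y u) (z + s *\<^sub>R u + t *\<^sub>R v) v"
    using MVT2[OF assms(3) k'] by auto
  have "g h - g 0 = h * (k h - k 0)"
    using s(3) by (simp add: k_def algebra_simps)
  then have "g h - g 0 = h * h * dd (\<lambda>y. dd f y u) (z + s *\<^sub>R u + t *\<^sub>R v) v"
    using t(3) by simp
  moreover have "g h - g 0 = f (z + h *\<^sub>R u + h *\<^sub>R v) - f (z + h *\<^sub>R u) - f (z + h *\<^sub>R v) + f z"
    by (simp add: g_def algebra_simps)
  moreover have "norm (z + s *\<^sub>R u + t *\<^sub>R v - z) \<le> h * (norm u + norm v)"
    using bound[of s t] s t by (simp add: algebra_simps)
  ultimately show ?thesis by metis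
qed

text \<open>Schwarz's theorem: the second difference of \<open>f\<close> is symmetric in
  \<open>u\<close> and \<open>v\<close>, and by \<open>second_difference\<close> it equals either
  mixed derivative at some nearby point, up to the same factor. Continuity of both mixed derivatives
  at \<open>z\<close> does the rest.\<close>

lemma dd_commute_real:
  fixes f :: "'a::euclidean_space \<Rightarrow> real"
  assumes "open S" "smooth_on S f" "z \<in> S"
  shows "dd (\<lambda>y. dd f y u) z v = dd (\<lambda>y. dd f y v) z u"
proof -
  define p where "p = (\<lambda>x. dd (\<lambda>y. dd f y u) x v)"
  define q where "q = (\<lambda>x. dd (\<lambda>y. dd f y v) x u)"
  have "continuous_on S p" "continuous_on S q"
    unfolding p_def q_def using assms by (auto intro!: smooth_on_continuous smooth_on_deriv)
  then have "isCont p z" "isCont q z"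
    using assms continuous_on_eq_continuous_at by blast+
  then have pq: "p \<midarrow>z\<rightarrow> p z" "q \<midarrow>z\<rightarrow> q z"
    by (simp_all add: isCont_def)
  obtain r where r: "r > 0" "ball z r \<subseteq> S"
    using assms open_contains_ball by blast
  have "\<bar>p z - q z\<bar> \<le> e" if "e > 0" for e :: real
  proof -
    have near: "\<exists>d>0. \<forall>x. norm (x - z) < d \<longrightarrow> \<bar>p x - p z\<bar> < e / 2"
      if p: "p \<midarrow>z\<rightarrow> p z" for p :: "'a \<Rightarrow> real"
    proof -
      obtain d where "d > 0" "\<forall>x. x \<noteq> z \<and> norm (x - z) < d \<longrightarrow> norm (p x - p z) < e / 2"
        using LIM_D[OF p, of "e / 2"] \<open>e > 0\<close> by auto
      moreover have "\<bar>p x - p z\<bar> < e / 2" if "x = z" for x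
        using that \<open>e > 0\<close> by simp
      ultimately show ?thesis by (metis real_norm_def)
    qed
    obtain d1 where d1: "d1 > 0" "\<And>x. norm (x - z) < d1 \<Longrightarrow> \<bar>p x - p z\<bar> < e / 2"
      using near[OF pq(1)] by blast
    obtain d2 where d2: "d2 > 0" "\<And>x. norm (x - z) < d2 \<Longrightarrow> \<bar>q x - q z\<bar> < e / 2"
      using near[OF pq(2)] by blast
    define d where "d = min r (min d1 d2)"
    \<comment> \<open>This makes the side length \<open>h * (norm u + norm v)\<close> at most
      \<open>d / 2\<close>; the summand 1 avoids division by zero when \<open>u\<close> and
      \<open>v\<close> both vanish.\<close>
    define h where "h = d / (2 * (norm u + norm v + 1))"
    have d0: "d > 0" using r d1 d2 by (simp add: d_def)
    have n0: "norm u + norm v + 1 > 0" using norm_ge_zero[of u] norm_ge_zero[of v] by linarith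
    have h0: "h > 0" unfolding h_def using d0 n0 by simp
    have "h * (norm u + norm v) \<le> h * (norm u + norm v + 1)" using h0 by (simp add: algebra_simps)
    also have "\<dots> = d / 2" using n0 unfolding h_def by (simp add: divide_simps del: distrib_left_numeral)
    finally have hd: "h * (norm u + norm v) < d" using d0 by simp
    then have hr: "h * (norm u + norm v) < r" "h * (norm v + norm u) < r"
      by (auto simp: d_def add.commute)
    obtain x where x: "norm (x - z) \<le> h * (norm u + norm v)"
      "f (z + h *\<^sub>R u + h *\<^sub>R v) - f (z + h *\<^sub>R u) - f (z + h *\<^sub>R v) + f z = h * h * p x"
      using second_difference[OF assms(2) r(2) h0 hr(1)] unfolding p_def by blast
    obtain y where y: "norm (y - z) \<le> h * (norm v + norm u)"
      "f (z + h *\<^sub>R v + h *\<^sub>R u) - f (z + h *\<^sub>R v) - f (z + h *\<^sub>R u) + f z = h * h * q y"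
      using second_difference[OF assms(2) r(2) h0 hr(2)] unfolding q_def by blast
    have vu: "z + h *\<^sub>R v + h *\<^sub>R u = z + h *\<^sub>R u + h *\<^sub>R v" by (simp add: algebra_simps)
    have "h * h * p x = h * h * q y" using x(2) y(2)[unfolded vu] by linarith
    with h0 have "p x = q y" by simp
    moreover have "\<bar>p x - p z\<bar> < e / 2" using d1(2) x(1) hd by (simp add: d_def)
    moreover have "\<bar>q y - q z\<bar> < e / 2" using d2(2) y(1) hd by (simp add: d_def add.commute)
    ultimately show ?thesis by linarith
  qed
  then have "\<bar>p z - q z\<bar> \<le> 0"
    by (rule field_le_epsilon[where y = 0, simplified])
  then have "p z = q z" by simp
  then show ?thesis by (simp add: p_def q_def)
qed

lemma dd_commute:
  fixes f :: "'a::euclidean_space \<Rightarrow> 'b::euclidean_space"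
  assumes "open S" "smooth_on S f" "z \<in> S"
  shows "dd (\<lambda>y. dd f y u) z v = dd (\<lambda>y. dd f y v) z u"
proof (rule euclidean_eqI)
  fix b :: 'b
  have bl: "bounded_linear (\<lambda>x::'b. x \<bullet> b)" by (rule bounded_linear_inner_left)
  have s: "smooth_on S (\<lambda>x. f x \<bullet> b)"
    by (rule smooth_on_bounded_linear[OF assms(1) bl assms(2)])
  have *: "dd (\<lambda>y. dd f y u) z v \<bullet> b = dd (\<lambda>y. dd (\<lambda>x. f x \<bullet> b) y u) z v" for u v
  proof -
    have "dd (\<lambda>y. dd f y u) z v \<bullet> b = dd (\<lambda>y. dd f y u \<bullet> b) z v"
      by (rule dd_bounded_linear[OF bl, symmetric])
        (rule smooth_on_differentiable[OF smooth_on_deriv[OF assms(2)] assms(3)])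
    also have "\<dots> = dd (\<lambda>y. dd (\<lambda>x. f x \<bullet> b) y u) z v"
      using assms by (intro fun_cong[OF dd_cong_open[of S]] dd_bounded_linear[OF bl, symmetric])
         (auto intro: smooth_on_differentiable)
    finally show ?thesis .
  qed
  show "dd (\<lambda>y. dd f y u) z v \<bullet> b = dd (\<lambda>y. dd f y v) z u \<bullet> b"
    unfolding * by (rule dd_commute_real[OF assms(1) s assms(3)])
qed

section \<open>Smooth fields of linear and bilinear maps, with smoothness tested on fixed
  vectors\<close>

definition smooth_family ::
    "'a::euclidean_space set \<Rightarrow> ('a \<Rightarrow> 'c::euclidean_space \<Rightarrow> 'b::euclidean_space) \<Rightarrow> bool" where
  "smooth_family S B \<longleftrightarrow> (\<forall>z\<in>S. linear (B z)) \<and> (\<forall>v. smooth_on S (\<lambda>z. B z v))"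

lemma smooth_family_linear: "smooth_family S B \<Longrightarrow> z \<in> S \<Longrightarrow> linear (B z)"
  by (simp add: smooth_family_def)

lemma smooth_family_smooth: "smooth_family S B \<Longrightarrow> smooth_on S (\<lambda>z. B z v)"
  by (simp add: smooth_family_def)

lemma linear_expand_basis:
  assumes "linear (F :: 'c::euclidean_space \<Rightarrow> 'b::real_vector)"
  shows "F v = (\<Sum>b\<in>Basis. (v \<bullet> b) *\<^sub>R F b)"
proof -
  have "F v = F (\<Sum>b\<in>Basis. (v \<bullet> b) *\<^sub>R b)" by (simp add: euclidean_representation)
  then show ?thesis by (simp add: linear_sum[OF assms] linear_cmul[OF assms])
qed

lemma smooth_family_apply:
  assumes "open S" "smooth_family S B" "smooth_on S Y"
  shows "smooth_on S (\<lambda>z. B z (Y z))"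
proof -
  have "smooth_on S (\<lambda>z. \<Sum>b\<in>Basis. (Y z \<bullet> b) *\<^sub>R B z b)"
    using assms by (auto intro!: smooth_intros simp: smooth_family_def)
  then show ?thesis
  proof (rule smooth_on_cong[OF assms(1), rotated])
    fix z assume "z \<in> S"
    then show "(\<Sum>b\<in>Basis. (Y z \<bullet> b) *\<^sub>R B z b) = B z (Y z)"
      using assms(2) linear_expand_basis[of "B z" "Y z"] by (simp add: smooth_family_def)
  qed
qed

text \<open>Leibniz rule for a linear map applied to a vector, both varying: expanding
  \<open>Y\<close> in the standard basis reduces it to the rule for scalar multiples. In the first
  summand \<open>Y z\<close> is frozen.\<close>

lemma dd_family:
  assumes "open S" "smooth_family S B" "Y differentiable (at z)" "z \<in> S"
  shows "dd (\<lambda>y. B y (Y y)) z h = dd (\<lambda>y. B y (Y z)) z h + B z (dd Y z h)"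
    and "(\<lambda>y. B y (Y y)) differentiable (at z)"
proof -
  have lin: "linear (B y)" if "y \<in> S" for y using assms(2) that by (simp add: smooth_family_def)
  have difB: "(\<lambda>y. B y b) differentiable (at z)" for b
    using assms by (auto simp: smooth_family_def intro: smooth_on_differentiable)
  have difi: "(\<lambda>y. Y y \<bullet> b) differentiable (at z)" for b
    using assms(3) by (intro differentiable_bounded_linear[OF bounded_linear_inner_left])
  have eq: "(\<Sum>b\<in>Basis. (X y \<bullet> b) *\<^sub>R B y b) = B y (X y)" if "y \<in> S" for y X
    using linear_expand_basis[OF lin[OF that], of "X y"] by simp
  have s: "(\<lambda>y. (Y y \<bullet> b) *\<^sub>R B y b) differentiable (at z)" for b
    by (intro differentiable_bilinear[OF bounded_bilinear_scaleR] difi difB)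
  have "(\<lambda>y. \<Sum>b\<in>Basis. (Y y \<bullet> b) *\<^sub>R B y b) differentiable (at z)"
    using s by (intro differentiable_sum) auto
  then show "(\<lambda>y. B y (Y y)) differentiable (at z)"
    by (rule differentiable_cong_open[OF assms(1,4) eq, rotated]) auto
  have "dd (\<lambda>y. B y (Y y)) z h = dd (\<lambda>y. \<Sum>b\<in>Basis. (Y y \<bullet> b) *\<^sub>R B y b) z h"
    by (rule fun_cong[OF dd_cong_open[OF assms(1,4)]]) (simp add: eq)
  also have "\<dots> = (\<Sum>b\<in>Basis. (Y z \<bullet> b) *\<^sub>R dd (\<lambda>y. B y b) z h)
      + (\<Sum>b\<in>Basis. (dd Y z h \<bullet> b) *\<^sub>R B z b)"
    by (simp add: dd_sum s dd_scaleR difB difi sum.distrib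
        dd_bounded_linear[OF bounded_linear_inner_left assms(3)])
  also have "(\<Sum>b\<in>Basis. (dd Y z h \<bullet> b) *\<^sub>R B z b) = B z (dd Y z h)"
    using linear_expand_basis[OF lin[OF assms(4)]] by metis
  also have "(\<Sum>b\<in>Basis. (Y z \<bullet> b) *\<^sub>R dd (\<lambda>y. B y b) z h)
      = dd (\<lambda>y. \<Sum>b\<in>Basis. (Y z \<bullet> b) *\<^sub>R B y b) z h"
  proof -
    have "(\<lambda>y. (Y z \<bullet> b) *\<^sub>R B y b) differentiable (at z)" for b
      by (intro differentiable_bilinear[OF bounded_bilinear_scaleR] difB) simp
    then show ?thesis by (simp add: dd_sum dd_scaleR difB)
  qed
  also have "\<dots> = dd (\<lambda>y. B y (Y z)) z h"
    by (rule fun_cong[OF dd_cong_open[OF assms(1,4)]]) (use eq[of _ "\<lambda>_. Y z"] in simp)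
  finally show "dd (\<lambda>y. B y (Y y)) z h = dd (\<lambda>y. B y (Y z)) z h + B z (dd Y z h)" .
qed

lemma smooth_family_dd: "smooth_on S Y \<Longrightarrow> smooth_family S (dd Y)"
  by (simp add: smooth_family_def smooth_on_deriv dd_linear smooth_on_differentiable)

definition smooth_bifamily ::
    "'a::euclidean_space set \<Rightarrow>
     ('a \<Rightarrow> 'c::euclidean_space \<Rightarrow> 'd::euclidean_space \<Rightarrow> 'b::euclidean_space) \<Rightarrow> bool" where
  "smooth_bifamily S B \<longleftrightarrow> (\<forall>z\<in>S. bilinear (B z)) \<and> (\<forall>u v. smooth_on S (\<lambda>z. B z u v))"

lemma smooth_bifamily_left:
  assumes "open S" "smooth_bifamily S B" "smooth_on S Y"
  shows "smooth_family S (\<lambda>z u. B z u (Y z))"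
  unfolding smooth_family_def
proof (intro conjI ballI allI)
  show "linear (\<lambda>u. B z u (Y z))" if "z \<in> S" for z
    using assms(2) that unfolding smooth_bifamily_def bilinear_def by blast
  have "smooth_family S (\<lambda>z v. B z u v)" for u
    using assms(2) unfolding smooth_family_def smooth_bifamily_def bilinear_def by blast
  from smooth_family_apply[OF assms(1) this assms(3)]
  show "smooth_on S (\<lambda>z. B z u (Y z))" for u .
qed

lemma smooth_bifamily_right:
  assumes "open S" "smooth_bifamily S B" "smooth_on S X"
  shows "smooth_family S (\<lambda>z v. B z (X z) v)"
  unfolding smooth_family_def
proof (intro conjI ballI allI)
  show "linear (\<lambda>v. B z (X z) v)" if "z \<in> S" for z
    using assms(2) that unfolding smooth_bifamily_def bilinear_def by blast
  have "smooth_family S (\<lambda>z u. B z u v)" for v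
    using assms(2) unfolding smooth_family_def smooth_bifamily_def bilinear_def by blast
  from smooth_family_apply[OF assms(1) this assms(3)]
  show "smooth_on S (\<lambda>z. B z (X z) v)" for v .
qed

lemma smooth_bifamily_apply:
  assumes "open S" "smooth_bifamily S B" "smooth_on S X" "smooth_on S Y"
  shows "smooth_on S (\<lambda>z. B z (X z) (Y z))"
  using smooth_family_apply[OF assms(1) smooth_bifamily_right[OF assms(1-3)] assms(4)] .

lemma dd_bifamily:
  assumes "open S" "smooth_bifamily S B" "smooth_on S X" "smooth_on S Y" "z \<in> S"
  shows "dd (\<lambda>y. B y (X y) (Y y)) z h =
    dd (\<lambda>y. B y (X z) (Y z)) z h + B z (dd X z h) (Y z) + B z (X z) (dd Y z h)"
  using dd_family(1)[OF assms(1) smooth_bifamily_right[OF assms(1-3)]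
      smooth_on_differentiable[OF assms(4,5)] assms(5), of h]
    dd_family(1)[OF assms(1) smooth_bifamily_left[OF assms(1,2) smooth_on_const[of S "Y z"]]
      smooth_on_differentiable[OF assms(3,5)] assms(5), of h]
  by simp

lemma smooth_family_deriv:
  assumes "open S" "smooth_family S B"
  shows "smooth_family S (\<lambda>z v. dd (\<lambda>y. B y v) z h)"
  unfolding smooth_family_def
proof (intro conjI ballI allI)
  fix z assume z: "z \<in> S"
  have dif: "(\<lambda>y. B y b) differentiable (at z)" for b
    using assms z by (auto simp: smooth_family_def intro: smooth_on_differentiable)
  have lin: "linear (B y)" if "y \<in> S" for y using assms(2) that by (simp add: smooth_family_def)
  show "linear (\<lambda>v. dd (\<lambda>y. B y v) z h)"
  proof (rule linearI)
    fix v w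
    have "dd (\<lambda>y. B y (v + w)) z h = dd (\<lambda>y. B y v + B y w) z h"
      by (rule fun_cong[OF dd_cong_open[OF assms(1) z]]) (simp add: lin linear_add)
    then show "dd (\<lambda>y. B y (v + w)) z h = dd (\<lambda>y. B y v) z h + dd (\<lambda>y. B y w) z h"
      by (simp add: dd_add dif)
  next
    fix c v
    have "dd (\<lambda>y. B y (c *\<^sub>R v)) z h = dd (\<lambda>y. c *\<^sub>R B y v) z h"
      by (rule fun_cong[OF dd_cong_open[OF assms(1) z]]) (simp add: lin linear_cmul)
    then show "dd (\<lambda>y. B y (c *\<^sub>R v)) z h = c *\<^sub>R dd (\<lambda>y. B y v) z h"
      by (simp add: dd_scaleR dif)
  qed
next
  fix v show "smooth_on S (\<lambda>z. dd (\<lambda>y. B y v) z h)"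
    using assms by (simp add: smooth_family_def smooth_on_deriv)
qed

section \<open>The Levi-Civita connection in a coordinate domain\<close>

text \<open>\<open>Gi\<close> is the inverse metric, with covectors identified with vectors through
  the standard inner product. It is a parameter, so that smoothness of the Christoffel map follows
  by applying it to smooth data and no matrix has to be inverted here.\<close>

locale riemannian_domain =
  fixes W :: "'e::euclidean_space set" and G :: "'e \<Rightarrow> 'e \<Rightarrow> 'e \<Rightarrow> real" and Gi :: "'e \<Rightarrow> 'e \<Rightarrow> 'e"
  assumes open_W: "open W" and metric: "riemannian_metric_on W G"
    and Gi: "smooth_family W Gi" and G_Gi: "z \<in> W \<Longrightarrow> G z (Gi z \<zeta>) w = \<zeta> \<bullet> w"
begin

lemma G_bifamily: "smooth_bifamily W G"
  using metric by (simp add: smooth_bifamily_def riemannian_metric_on_def)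

lemma G_sym: "z \<in> W \<Longrightarrow> G z u v = G z v u"
  using metric by (simp add: riemannian_metric_on_def)

lemma G_lin:
  assumes "z \<in> W"
  shows "G z (u + v) w = G z u w + G z v w" "G z w (u + v) = G z w u + G z w v"
    "G z (u - v) w = G z u w - G z v w" "G z w (u - v) = G z w u - G z w v"
    "G z (- u) w = - G z u w" "G z w (- u) = - G z w u"
    "G z (c *\<^sub>R u) w = c * G z u w" "G z w (c *\<^sub>R u) = c * G z w u"
    "G z 0 w = 0" "G z w 0 = 0"
  using assms metric unfolding riemannian_metric_on_def
  by (simp_all add: bilinear_ladd bilinear_radd bilinear_lsub bilinear_rsub bilinear_lneg
      bilinear_rneg bilinear_lmul bilinear_rmul bilinear_lzero bilinear_rzero)

lemma G_nondegenerate: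
  assumes "z \<in> W" "\<And>w. G z u w = G z v w"
  shows "u = v"
proof (rule ccontr)
  assume "u \<noteq> v"
  then have "G z (u - v) (u - v) > 0"
    using metric assms(1) by (simp add: riemannian_metric_on_def)
  then show False by (simp add: G_lin(3) assms)
qed

lemma G_smooth: "smooth_on W (\<lambda>z. G z u v)"
  using metric by (simp add: riemannian_metric_on_def)

definition koszul :: "'e \<Rightarrow> 'e \<Rightarrow> 'e \<Rightarrow> 'e \<Rightarrow> real" where
  "koszul z u v w =
    dd (\<lambda>y. G y v w) z u + dd (\<lambda>y. G y u w) z v - dd (\<lambda>y. G y u v) z w"

abbreviation "\<Gamma> \<equiv> christoffel G"

lemma dG_linear:
  assumes "z \<in> W"
  shows "linear (\<lambda>v. dd (\<lambda>y. G y v w) z u)" "linear (\<lambda>w. dd (\<lambda>y. G y v w) z u)"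
    "linear (dd (\<lambda>y. G y v w) z)"
proof -
  show "linear (\<lambda>v. dd (\<lambda>y. G y v w) z u)"
    by (rule smooth_family_linear[OF smooth_family_deriv[OF open_W
            smooth_bifamily_left[OF open_W G_bifamily smooth_on_const]] assms])
  show "linear (\<lambda>w. dd (\<lambda>y. G y v w) z u)"
    by (rule smooth_family_linear[OF smooth_family_deriv[OF open_W
            smooth_bifamily_right[OF open_W G_bifamily smooth_on_const]] assms])
  show "linear (dd (\<lambda>y. G y v w) z)"
    by (rule dd_linear[OF smooth_on_differentiable[OF G_smooth assms]])
qed

lemma koszul_linear:
  assumes "z \<in> W"
  shows "linear (koszul z u v)"
  unfolding koszul_def
  by (intro linear_compose_sub linear_compose_add dG_linear assms)

text \<open>Resolves the definite description: the Koszul expression is linear in \<open>w\<close>,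
  hence a covector, and \<open>Gi\<close> raises its index; nondegeneracy gives uniqueness.\<close>

lemma christoffel_eq:
  assumes z: "z \<in> W"
  shows "\<Gamma> z u v = Gi z (\<Sum>b\<in>Basis. (1/2 * koszul z u v b) *\<^sub>R b)" (is "_ = ?x")
    and "2 * G z (\<Gamma> z u v) w = koszul z u v w"
proof -
  have x: "2 * G z ?x w = koszul z u v w" for w
  proof -
    have "2 * G z ?x w = (\<Sum>b\<in>Basis. koszul z u v b * (b \<bullet> w))"
      by (simp add: G_Gi[OF z] inner_sum_left sum_distrib_left)
    also have "\<dots> = koszul z u v w"
      using linear_expand_basis[OF koszul_linear[OF z], of u v w]
      by (simp add: inner_commute mult.commute)
    finally show ?thesis .
  qed
  have "\<Gamma> z u v = ?x"
    unfolding christoffel_def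
  proof (rule the_equality)
    show "\<forall>w. 2 * G z ?x w = dd (\<lambda>y. G y v w) z u + dd (\<lambda>y. G y u w) z v - dd (\<lambda>y. G y u v) z w"
      using x by (simp add: koszul_def)
    show "y = ?x" if "\<forall>w. 2 * G z y w = dd (\<lambda>y. G y v w) z u + dd (\<lambda>y. G y u w) z v
        - dd (\<lambda>y. G y u v) z w" for y
    proof (rule G_nondegenerate[OF z])
      show "G z y w = G z ?x w" for w
        using that[rule_format, of w] x[of w, unfolded koszul_def[of _ _ _ w]] by linarith
    qed
  qed
  then show "\<Gamma> z u v = ?x" "2 * G z (\<Gamma> z u v) w = koszul z u v w"
    using x by simp_all
qed

lemma koszul_sym: "z \<in> W \<Longrightarrow> koszul z u v w = koszul z v u w"
proof -
  assume z: "z \<in> W"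
  have "dd (\<lambda>y. G y u v) z w = dd (\<lambda>y. G y v u) z w"
    by (rule fun_cong[OF dd_cong_open[OF open_W z]]) (rule G_sym)
  then show ?thesis by (simp add: koszul_def)
qed

lemma christoffel_sym: "z \<in> W \<Longrightarrow> \<Gamma> z u v = \<Gamma> z v u"
  by (simp add: christoffel_eq(1) koszul_sym)

lemma christoffel_linear: "z \<in> W \<Longrightarrow> linear (\<Gamma> z u)"
proof -
  assume z: "z \<in> W"
  have lin: "linear (\<lambda>v. koszul z u v w)" for w
    unfolding koszul_def
    by (intro linear_compose_sub linear_compose_add dG_linear z)
  show ?thesis
  proof (rule linearI; rule G_nondegenerate[OF z])
    fix v v' w
    show "G z (\<Gamma> z u (v + v')) w = G z (\<Gamma> z u v + \<Gamma> z u v') w"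
      using christoffel_eq(2)[OF z, of u "v + v'" w] christoffel_eq(2)[OF z, of u v w]
        christoffel_eq(2)[OF z, of u v' w] linear_add[OF lin[of w], of v v'] by (simp add: G_lin z)
  next
    fix c v w
    show "G z (\<Gamma> z u (c *\<^sub>R v)) w = G z (c *\<^sub>R \<Gamma> z u v) w"
      using christoffel_eq(2)[OF z, of u "c *\<^sub>R v" w] christoffel_eq(2)[OF z, of u v w]
        linear_cmul[OF lin[of w], of c v] by (simp add: G_lin z) (metis mult.left_commute mult_cancel_left zero_neq_numeral)
  qed
qed

lemma christoffel_bifamily: "smooth_bifamily W \<Gamma>"
  unfolding smooth_bifamily_def
proof (intro conjI ballI allI)
  fix z assume z: "z \<in> W"
  have "linear (\<lambda>u. \<Gamma> z u v)" for v
    by (subst christoffel_sym[OF z]) (rule christoffel_linear[OF z])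
  then show "bilinear (\<Gamma> z)"
    unfolding bilinear_def using christoffel_linear[OF z] by blast
next
  fix u v
  have "smooth_on W (\<lambda>z. \<Sum>b\<in>Basis. (1/2 * koszul z u v b) *\<^sub>R b)"
    unfolding koszul_def by (intro smooth_intros open_W G_smooth)
  from smooth_family_apply[OF open_W Gi this]
  show "smooth_on W (\<lambda>z. \<Gamma> z u v)"
    by (rule smooth_on_cong[OF open_W, rotated]) (simp add: christoffel_eq(1))
qed

lemma christoffel_metric:
  assumes z: "z \<in> W"
  shows "dd (\<lambda>y. G y v w) z u = G z (\<Gamma> z u v) w + G z v (\<Gamma> z u w)"
proof -
  have "dd (\<lambda>y. G y w v) z u = dd (\<lambda>y. G y v w) z u"
    by (rule fun_cong[OF dd_cong_open[OF open_W z]]) (rule G_sym)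
  then show ?thesis
    using christoffel_eq(2)[OF z, of u v w] christoffel_eq(2)[OF z, of u w v]
    by (simp add: koszul_def G_sym[OF z, of v])
qed

lemma christoffel_lin:
  assumes "z \<in> W"
  shows "\<Gamma> z (u + v) w = \<Gamma> z u w + \<Gamma> z v w" "\<Gamma> z w (u + v) = \<Gamma> z w u + \<Gamma> z w v"
    "\<Gamma> z (u - v) w = \<Gamma> z u w - \<Gamma> z v w" "\<Gamma> z w (u - v) = \<Gamma> z w u - \<Gamma> z w v"
    "\<Gamma> z (c *\<^sub>R u) w = c *\<^sub>R \<Gamma> z u w" "\<Gamma> z w (c *\<^sub>R u) = c *\<^sub>R \<Gamma> z w u"
  using assms christoffel_bifamily unfolding smooth_bifamily_def
  by (simp_all add: bilinear_ladd bilinear_radd bilinear_lsub bilinear_rsub bilinear_lneg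
      bilinear_rneg bilinear_lmul bilinear_rmul bilinear_lzero bilinear_rzero)

abbreviation "nabla \<equiv> levi_civita G"

lemma nabla_smooth:
  assumes "smooth_on W X" "smooth_on W Y"
  shows "smooth_on W (nabla X Y)"
proof -
  have "smooth_on W (\<lambda>z. dd Y z (X z) + \<Gamma> z (X z) (Y z))"
    by (rule smooth_on_add[OF open_W
          smooth_family_apply[OF open_W smooth_family_dd[OF assms(2)] assms(1)]
          smooth_bifamily_apply[OF open_W christoffel_bifamily assms]])
  then show ?thesis by (simp add: levi_civita_def[abs_def])
qed

text \<open>Tensorial in the direction, local in the differentiated field. This is what allows
  arbitrary fields to be traded for constant or frame fields at a point.\<close>

lemma nabla_cong:
  assumes "z \<in> W" "X z = X' z" "\<And>y. y \<in> W \<Longrightarrow> Y y = Y' y"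
  shows "nabla X Y z = nabla X' Y' z"
  using dd_cong_open[OF open_W assms(1,3)] assms by (simp add: levi_civita_def)

lemma nabla_right:
  assumes "z \<in> W" "smooth_on W Y" "smooth_on W Y'"
  shows "nabla X (\<lambda>y. Y y + Y' y) z = nabla X Y z + nabla X Y' z"
    "nabla X (\<lambda>y. Y y - Y' y) z = nabla X Y z - nabla X Y' z"
  using assms christoffel_linear[OF assms(1), of "X z"]
  by (simp_all add: levi_civita_def dd_add dd_diff smooth_on_differentiable linear_add linear_diff)

lemma nabla_scaleR:
  assumes "z \<in> W" "smooth_on W Y" "smooth_on W f"
  shows "nabla X (\<lambda>y. f y *\<^sub>R Y y) z = dd f z (X z) *\<^sub>R Y z + f z *\<^sub>R nabla X Y z"
  using assms christoffel_linear[OF assms(1), of "X z"]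
  by (simp add: levi_civita_def dd_scaleR smooth_on_differentiable linear_cmul algebra_simps)

lemma nabla_torsion: "z \<in> W \<Longrightarrow> nabla X Y z - nabla Y X z = lie_bracket X Y z"
  by (simp add: levi_civita_def lie_bracket_def christoffel_sym[of z "Y z"])

lemma nabla_metric:
  assumes "z \<in> W" "smooth_on W Y" "smooth_on W Z"
  shows "dd (\<lambda>y. G y (Y y) (Z y)) z (X z) = G z (nabla X Y z) (Z z) + G z (Y z) (nabla X Z z)"
  using dd_bifamily[OF open_W G_bifamily assms(2,3,1), of "X z"] assms(1)
  by (simp add: levi_civita_def christoffel_metric G_lin)

text \<open>The Koszul formula with bracket terms, needed because the adapted frames below do not
  commute. It follows from three instances of metric compatibility and vanishing torsion.\<close>

lemma nabla_koszul:
  assumes z: "z \<in> W" and s: "smooth_on W X" "smooth_on W Y" "smooth_on W Z"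
  shows "2 * G z (nabla X Y z) (Z z) =
    dd (\<lambda>y. G y (Y y) (Z y)) z (X z) + dd (\<lambda>y. G y (X y) (Z y)) z (Y z)
    - dd (\<lambda>y. G y (X y) (Y y)) z (Z z) + G z (lie_bracket X Y z) (Z z)
    - G z (lie_bracket X Z z) (Y z) - G z (lie_bracket Y Z z) (X z)"
  using nabla_metric[OF z s(2,3), of X] nabla_metric[OF z s(1,3), of Y]
    nabla_metric[OF z s(1,2), of Z]
  by (simp add: nabla_torsion[OF z, symmetric] G_lin z G_sym[OF z, of "X z"] G_sym[OF z, of "Y z"])

text \<open>The coordinate expression of the curvature tensor. It sees only the values of its
  arguments at the point, which turns statements on fields into algebra.\<close>

definition Rm :: "'e \<Rightarrow> 'e \<Rightarrow> 'e \<Rightarrow> 'e \<Rightarrow> 'e" where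
  "Rm z u v w = dd (\<lambda>y. \<Gamma> y v w) z u - dd (\<lambda>y. \<Gamma> y u w) z v
     + \<Gamma> z u (\<Gamma> z v w) - \<Gamma> z v (\<Gamma> z u w)"

lemma nabla_nabla:
  assumes z: "z \<in> W" and s: "smooth_on W X" "smooth_on W Y" "smooth_on W Z"
  shows "nabla X (nabla Y Z) z =
    dd (\<lambda>y. dd Z y (Y z)) z (X z) + dd Z z (dd Y z (X z))
    + dd (\<lambda>y. \<Gamma> y (Y z) (Z z)) z (X z) + \<Gamma> z (dd Y z (X z)) (Z z) + \<Gamma> z (Y z) (dd Z z (X z))
    + \<Gamma> z (X z) (dd Z z (Y z)) + \<Gamma> z (X z) (\<Gamma> z (Y z) (Z z))"
proof -
  have 1: "smooth_on W (\<lambda>y. dd Z y (Y y))"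
    by (intro smooth_family_apply[OF open_W smooth_family_dd] s)
  have 2: "smooth_on W (\<lambda>y. \<Gamma> y (Y y) (Z y))"
    by (intro smooth_bifamily_apply[OF open_W christoffel_bifamily] s)
  show ?thesis
    unfolding levi_civita_def[of _ X] levi_civita_def[of _ Y, abs_def]
    using dd_family(1)[OF open_W smooth_family_dd[OF s(3)] smooth_on_differentiable[OF s(2) z] z, of "X z"]
      dd_bifamily[OF open_W christoffel_bifamily s(2,3) z, of "X z"]
      smooth_on_differentiable[OF 1 z] smooth_on_differentiable[OF 2 z]
      linear_add[OF christoffel_linear[OF z, of "X z"]]
    by (simp add: dd_add algebra_simps)
qed

text \<open>The second derivatives of \<open>Z\<close> cancel by their symmetry, and the first
  derivatives of \<open>X\<close> and \<open>Y\<close> are absorbed by the bracket term.\<close>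

lemma curvature_eq_Rm:
  assumes z: "z \<in> W" and s: "smooth_on W X" "smooth_on W Y" "smooth_on W Z"
  shows "curvature G X Y Z z = Rm z (X z) (Y z) (Z z)"
proof -
  have "linear (dd Z z)" by (rule dd_linear[OF smooth_on_differentiable[OF s(3) z]])
  then show ?thesis
    unfolding curvature_def nabla_nabla[OF z s] nabla_nabla[OF z s(2,1,3)] Rm_def
      levi_civita_def[of _ "lie_bracket X Y"] lie_bracket_def
    using dd_commute[OF open_W s(3) z, of "Y z" "X z"]
    by (simp add: linear_diff christoffel_lin[OF z] algebra_simps)
qed

lemma Rm_family:
  "smooth_family W (\<lambda>z u. Rm z u v w)" "smooth_family W (\<lambda>z v. Rm z u v w)"
  "smooth_family W (\<lambda>z w. Rm z u v w)"
proof -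
  note c = smooth_on_const
  have L: "smooth_family W (\<lambda>z u. \<Gamma> z u v)" and R: "smooth_family W (\<lambda>z v. \<Gamma> z u v)" for u v
    using smooth_bifamily_left[OF open_W christoffel_bifamily c]
      smooth_bifamily_right[OF open_W christoffel_bifamily c] by blast+
  have S: "smooth_on W (\<lambda>z. \<Gamma> z u v)" for u v
    using christoffel_bifamily by (simp add: smooth_bifamily_def)
  have SS: "smooth_on W (\<lambda>z. \<Gamma> z u (\<Gamma> z v w))" for u v w
    by (rule smooth_family_apply[OF open_W R S])
  have sm: "smooth_on W (\<lambda>z. Rm z u v w)" for u v w
    unfolding Rm_def by (intro smooth_intros open_W S SS)
  note lin = dd_linear[OF smooth_on_differentiable[OF S]]
    smooth_family_linear[OF smooth_family_deriv[OF open_W L]]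
    smooth_family_linear[OF smooth_family_deriv[OF open_W R]]
  have "linear (\<lambda>u. Rm z u v w)" "linear (\<lambda>v. Rm z u v w)" "linear (\<lambda>w. Rm z u v w)"
    if z: "z \<in> W" for z u v w
    unfolding Rm_def
    by (rule linearI; simp add: lin[OF z, THEN linear_add] lin[OF z, THEN linear_cmul]
        christoffel_lin[OF z] algebra_simps)+
  then show "smooth_family W (\<lambda>z u. Rm z u v w)" "smooth_family W (\<lambda>z v. Rm z u v w)"
    "smooth_family W (\<lambda>z w. Rm z u v w)"
    using sm unfolding smooth_family_def by blast+
qed

lemma curvature_smooth:
  assumes "smooth_on W X" "smooth_on W Y" "smooth_on W Z"
  shows "smooth_on W (curvature G X Y Z)"
proof -
  have b: "smooth_on W (lie_bracket X Y)"
  proof -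
    have "smooth_on W (\<lambda>z. dd Y z (X z) - dd X z (Y z))"
      by (intro smooth_on_diff open_W smooth_family_apply[OF open_W smooth_family_dd] assms)
    then show ?thesis by (simp add: lie_bracket_def[abs_def])
  qed
  have "smooth_on W (\<lambda>z. nabla X (nabla Y Z) z - nabla Y (nabla X Z) z - nabla (lie_bracket X Y) Z z)"
    by (intro smooth_on_diff open_W nabla_smooth assms b)
  then show ?thesis by (simp add: curvature_def[abs_def])
qed

end

section \<open>Metrics of Lagrangian type on a product\<close>

text \<open>
  On a domain of \<open>'a \<times> 'a\<close>, \<open>Fr z\<close> maps \<open>(u, a)\<close> to the tangent vector with horizontal
  part \<open>u\<^sup>i \<delta>\<^sub>i\<close> and vertical part \<open>a\<^sub>i \<partial>/\<partial>p\<^sub>i\<close>; \<open>GL\<close> and \<open>GU\<close> are the mutually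
  inverse horizontal and vertical blocks of the metric.
\<close>

locale lagrangian_domain =
  fixes W :: "('a::euclidean_space \<times> 'a) set"
    and N GL GU :: "'a \<times> 'a \<Rightarrow> 'a \<Rightarrow> 'a"
  assumes W_open: "open W"
    and N_family: "smooth_family W N"
    and GL_family: "smooth_family W GL"
    and GU_family: "smooth_family W GU"
    and N_sym: "z \<in> W \<Longrightarrow> N z u \<bullet> v = u \<bullet> N z v"
    and GL_sym: "z \<in> W \<Longrightarrow> GL z u \<bullet> v = u \<bullet> GL z v"
    and GU_sym: "z \<in> W \<Longrightarrow> GU z u \<bullet> v = u \<bullet> GU z v"
    and GL_GU: "z \<in> W \<Longrightarrow> GL z (GU z a) = a"
    and GU_GL: "z \<in> W \<Longrightarrow> GU z (GL z a) = a"
    and GL_pos: "z \<in> W \<Longrightarrow> u \<noteq> 0 \<Longrightarrow> GL z u \<bullet> u > 0"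
begin

definition Fr :: "'a \<times> 'a \<Rightarrow> 'a \<times> 'a \<Rightarrow> 'a \<times> 'a" where
  "Fr z x = (fst x, N z (fst x) + snd x)"

definition Fi :: "'a \<times> 'a \<Rightarrow> 'a \<times> 'a \<Rightarrow> 'a \<times> 'a" where
  "Fi z X = (fst X, snd X - N z (fst X))"

definition Gm :: "'a \<times> 'a \<Rightarrow> 'a \<times> 'a \<Rightarrow> 'a \<times> 'a \<Rightarrow> real" where
  "Gm z X Y = GL z (fst X) \<bullet> fst Y + GU z (snd X - N z (fst X)) \<bullet> (snd Y - N z (fst Y))"

text \<open>The covector \<open>\<zeta>\<close> has the components
  \<open>fst \<zeta> + N z (snd \<zeta>)\<close> on the horizontal frame and
  \<open>snd \<zeta>\<close> on the vertical one; each is raised with the inverse of its own metric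
  block.\<close>

definition Gi :: "'a \<times> 'a \<Rightarrow> 'a \<times> 'a \<Rightarrow> 'a \<times> 'a" where
  "Gi z \<zeta> = Fr z (GU z (fst \<zeta> + N z (snd \<zeta>)), GL z (snd \<zeta>))"

definition J0 :: "'a \<times> 'a \<Rightarrow> 'a \<times> 'a \<Rightarrow> 'a \<times> 'a" where
  "J0 z x = (- GU z (snd x), GL z (fst x))"

definition Jm :: "'a \<times> 'a \<Rightarrow> 'a \<times> 'a \<Rightarrow> 'a \<times> 'a" where
  "Jm z X = Fr z (J0 z (Fi z X))"

lemma op_lin:
  assumes "z \<in> W"
  shows "N z (u + v) = N z u + N z v" "N z (u - v) = N z u - N z v" "N z (- u) = - N z u"
    "N z (c *\<^sub>R u) = c *\<^sub>R N z u" "N z 0 = 0"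
    "GL z (u + v) = GL z u + GL z v" "GL z (u - v) = GL z u - GL z v" "GL z (- u) = - GL z u"
    "GL z (c *\<^sub>R u) = c *\<^sub>R GL z u" "GL z 0 = 0"
    "GU z (u + v) = GU z u + GU z v" "GU z (u - v) = GU z u - GU z v" "GU z (- u) = - GU z u"
    "GU z (c *\<^sub>R u) = c *\<^sub>R GU z u" "GU z 0 = 0"
  using smooth_family_linear[OF N_family assms] smooth_family_linear[OF GL_family assms]
    smooth_family_linear[OF GU_family assms]
  by (simp_all add: linear_add linear_diff linear_neg linear_cmul linear_0)

lemma Fr_Fi [simp]: "Fr z (Fi z X) = X" and Fi_Fr [simp]: "Fi z (Fr z x) = x"
  by (simp_all add: Fr_def Fi_def)

lemma fst_Fr [simp]: "fst (Fr z x) = fst x" and fst_Fi [simp]: "fst (Fi z x) = fst x"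
  by (simp_all add: Fr_def Fi_def)

lemma Fr_lin:
  assumes "z \<in> W"
  shows "Fr z (x + y) = Fr z x + Fr z y" "Fr z (x - y) = Fr z x - Fr z y"
    "Fr z (- x) = - Fr z x" "Fr z (c *\<^sub>R x) = c *\<^sub>R Fr z x"
  using assms by (simp_all add: Fr_def op_lin prod_eq_iff algebra_simps)

lemma Gm_Fr: "Gm z (Fr z x) (Fr z y) = GL z (fst x) \<bullet> fst y + GU z (snd x) \<bullet> snd y"
  by (simp add: Gm_def Fr_def)

lemma Jm_Fr [simp]: "Jm z (Fr z x) = Fr z (J0 z x)"
  by (simp add: Jm_def)

lemma smooth_N: "smooth_on W X \<Longrightarrow> smooth_on W (\<lambda>z. N z (X z))"
  and smooth_GL: "smooth_on W X \<Longrightarrow> smooth_on W (\<lambda>z. GL z (X z))"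
  and smooth_GU: "smooth_on W X \<Longrightarrow> smooth_on W (\<lambda>z. GU z (X z))"
  using smooth_family_apply[OF W_open N_family] smooth_family_apply[OF W_open GL_family]
    smooth_family_apply[OF W_open GU_family] by blast+

lemma Fr_family: "smooth_family W Fr"
  unfolding smooth_family_def
proof (intro conjI ballI allI)
  show "linear (Fr z)" if "z \<in> W" for z
    by (rule linearI) (simp_all add: Fr_lin that)
  show "smooth_on W (\<lambda>z. Fr z x)" for x
    unfolding Fr_def by (intro smooth_on_Pair smooth_on_add smooth_N smooth_on_const W_open)
qed

lemma smooth_Fr: "smooth_on W s \<Longrightarrow> smooth_on W (\<lambda>z. Fr z (s z))"
  by (rule smooth_family_apply[OF W_open Fr_family])

lemma smooth_Fi: "smooth_on W X \<Longrightarrow> smooth_on W (\<lambda>z. Fi z (X z))"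
  unfolding Fi_def
  by (intro smooth_on_Pair smooth_on_diff smooth_N smooth_on_fst smooth_on_snd W_open)

lemma J0_family: "smooth_family W J0"
  unfolding smooth_family_def
proof (intro conjI ballI allI)
  show "linear (J0 z)" if "z \<in> W" for z
    by (rule linearI) (simp_all add: J0_def op_lin that)
  show "smooth_on W (\<lambda>z. J0 z x)" for x
    unfolding J0_def by (intro smooth_on_Pair smooth_on_minus smooth_GL smooth_GU smooth_on_const W_open)
qed

lemma smooth_Jm: "smooth_on W X \<Longrightarrow> smooth_on W (\<lambda>z. Jm z (X z))"
  unfolding Jm_def by (intro smooth_Fr smooth_family_apply[OF W_open J0_family] smooth_Fi)

lemma GU_pos: "z \<in> W \<Longrightarrow> a \<noteq> 0 \<Longrightarrow> GU z a \<bullet> a > 0"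
  using GL_pos[of z "GU z a"] GL_GU[of z a] op_lin(10)[of z] inner_commute by metis

lemma Gm_riemannian: "riemannian_metric_on W Gm"
  unfolding riemannian_metric_on_def
proof (intro conjI ballI allI impI)
  fix z u v assume z: "z \<in> W"
  show "bilinear (Gm z)"
    unfolding bilinear_def
    by (intro conjI allI; rule linearI;
        simp add: Gm_def op_lin z inner_add_left inner_add_right inner_diff_left inner_diff_right algebra_simps)
  show "Gm z u v = Gm z v u"
    unfolding Gm_def GL_sym[OF z, of "fst u"] GU_sym[OF z, of "snd u - N z (fst u)"]
    by (simp add: inner_commute)
next
  fix z and u :: "'a \<times> 'a" assume z: "z \<in> W" and u: "u \<noteq> 0"
  obtain x where x: "u = Fr z x" by (metis Fr_Fi)
  have nn: "GL z w \<bullet> w \<ge> 0" "GU z w \<bullet> w \<ge> 0" for w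
    using GL_pos[OF z, of w] GU_pos[OF z, of w] by (cases "w = 0"; force)+
  have "x \<noteq> 0" using u x by (auto simp: Fr_def op_lin z zero_prod_def)
  then have "fst x \<noteq> 0 \<or> snd x \<noteq> 0" by (simp add: prod_eq_iff)
  then show "Gm z u u > 0"
    unfolding x Gm_Fr using nn GL_pos[OF z] GU_pos[OF z] by (metis add_pos_nonneg add_nonneg_pos)
next
  fix u v show "smooth_on W (\<lambda>z. Gm z u v)"
    unfolding Gm_def
    by (intro smooth_on_add smooth_on_inner smooth_on_diff smooth_GL smooth_GU smooth_N
        smooth_on_const W_open)
qed

lemma Gi_family: "smooth_family W Gi"
  unfolding smooth_family_def
proof (intro conjI ballI allI)
  show "linear (Gi z)" if "z \<in> W" for z
    by (rule linearI) (simp_all add: Gi_def Fr_def op_lin that algebra_simps)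
  show "smooth_on W (\<lambda>z. Gi z \<zeta>)" for \<zeta>
    unfolding Gi_def
    by (intro smooth_Fr smooth_on_Pair smooth_on_add smooth_GL smooth_GU smooth_N smooth_on_const W_open)
qed

sublocale riemannian_domain W Gm Gi
proof
  fix z \<zeta> w assume z: "z \<in> W"
  obtain y where w: "w = Fr z y" by (metis Fr_Fi)
  show "Gm z (Gi z \<zeta>) w = \<zeta> \<bullet> w"
    unfolding Gi_def w Gm_Fr
    by (simp add: Fr_def GL_GU GU_GL z inner_add_left inner_add_right inner_prod_def N_sym)
qed (rule W_open Gm_riemannian Gi_family)+

lemma Jm_Jm: "z \<in> W \<Longrightarrow> Jm z (Jm z X) = - X"
proof -
  assume z: "z \<in> W"
  have "Jm z (Jm z (Fr z (Fi z X))) = - Fr z (Fi z X)"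
    unfolding Jm_Fr by (simp add: J0_def op_lin GL_GU GU_GL z Fr_def prod_eq_iff)
  then show ?thesis by simp
qed

lemma inner_GL_GU:
  assumes "z \<in> W"
  shows "GL z u \<bullet> GU z a = u \<bullet> a" "GU z a \<bullet> GL z u = a \<bullet> u"
  using assms by (simp_all add: GL_sym GU_sym GL_GU GU_GL)

lemma Jm_family: "smooth_family W Jm"
  unfolding smooth_family_def
proof (intro conjI ballI allI)
  show "linear (Jm z)" if "z \<in> W" for z
    by (rule linearI) (simp_all add: Jm_def J0_def Fi_def Fr_def op_lin that algebra_simps)
  show "smooth_on W (\<lambda>z. Jm z x)" for x by (rule smooth_Jm[OF smooth_on_const])
qed

lemma Gm_Jm: "z \<in> W \<Longrightarrow> Gm z (Jm z X) (Jm z Y) = Gm z X Y"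
proof -
  assume z: "z \<in> W"
  obtain x y where X: "X = Fr z x" and Y: "Y = Fr z y" by (metis Fr_Fi)
  show ?thesis unfolding X Y Jm_Fr Gm_Fr
    using GL_sym[OF z, of "fst x" "fst y"] GU_sym[OF z, of "snd x" "snd y"]
    by (simp add: J0_def op_lin z GL_GU GU_GL)
qed

lemma Gm_Jm_right: "z \<in> W \<Longrightarrow> Gm z X (Jm z Y) = - Gm z (Jm z X) Y"
  using Gm_Jm[of z X "Jm z Y"] by (simp add: Jm_Jm G_lin)

text \<open>The fundamental form is the canonical symplectic form dp_i \<and> dx^i: the metric
  blocks cancel against those in J, and \<open>N\<close> drops out by its symmetry. Having constant
  coefficients, it is closed.\<close>

lemma Gm_Jm_canonical:
  assumes z: "z \<in> W"
  shows "Gm z X (Jm z Y) = snd X \<bullet> fst Y - fst X \<bullet> snd Y"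
proof -
  have "Gm z X (Jm z Y) = Gm z (Fr z (Fi z X)) (Fr z (J0 z (Fi z Y)))"
    by (simp add: Jm_def)
  also have "\<dots> = (snd X - N z (fst X)) \<bullet> fst Y - fst X \<bullet> (snd Y - N z (fst Y))"
    unfolding Gm_Fr
    by (simp add: J0_def Fi_def inner_GL_GU z)
  also have "\<dots> = snd X \<bullet> fst Y - fst X \<bullet> snd Y"
    by (simp add: inner_diff_left inner_diff_right N_sym[OF z])
  finally show ?thesis .
qed

lemma closed_fundamental_form: "closed_two_form_on W (\<lambda>z u v. Gm z u (Jm z v))"
  unfolding closed_two_form_on_def
proof (intro ballI allI)
  fix z u v w assume z: "z \<in> W"
  have "dd (\<lambda>y. Gm y v (Jm y w)) z h = 0" for v w h
    using fun_cong[OF dd_cong_open[OF W_open z], of "\<lambda>y. Gm y v (Jm y w)"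
        "\<lambda>y. snd v \<bullet> fst w - fst v \<bullet> snd w" h] Gm_Jm_canonical by simp
  then show "dd (\<lambda>y. Gm y v (Jm y w)) z u + dd (\<lambda>y. Gm y w (Jm y u)) z v
      + dd (\<lambda>y. Gm y u (Jm y v)) z w = 0" by simp
qed

text \<open>Frame fields with constant coefficients have constant base components, so their brackets
  are vertical.\<close>

lemma bracket_Fr:
  assumes "z \<in> W"
  shows "lie_bracket (\<lambda>z. Fr z x) (\<lambda>z. Fr z y) z =
    (0, dd (\<lambda>q. N q (fst y)) z (Fr z x) - dd (\<lambda>q. N q (fst x)) z (Fr z y))"
proof -
  have "dd (\<lambda>q. Fr q y) z h = (0, dd (\<lambda>q. N q (fst y)) z h)" for y h
  proof -
    have d: "(\<lambda>q. N q (fst y)) differentiable (at z)"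
      by (rule smooth_on_differentiable[OF smooth_N[OF smooth_on_const] assms])
    then show ?thesis unfolding Fr_def by (simp add: dd_Pair dd_add)
  qed
  then show ?thesis by (simp add: lie_bracket_def)
qed

lemma dd_GU:
  assumes z: "z \<in> W"
  shows "dd (\<lambda>q. GU q b) z h = - GU z (dd (\<lambda>q. GL q (GU z b)) z h)"
proof -
  have "dd (\<lambda>q. GL q (GU q b)) z h = dd (\<lambda>q. b) z h"
    by (rule fun_cong[OF dd_cong_open[OF W_open z]]) (rule GL_GU)
  moreover have "dd (\<lambda>q. GL q (GU q b)) z h = dd (\<lambda>q. GL q (GU z b)) z h + GL z (dd (\<lambda>q. GU q b) z h)"
    by (rule dd_family(1)[OF W_open GL_family _ z])
      (rule smooth_on_differentiable[OF smooth_GU[OF smooth_on_const] z])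
  ultimately have "GL z (dd (\<lambda>q. GU q b) z h) = - dd (\<lambda>q. GL q (GU z b)) z h"
    by (simp add: eq_neg_iff_add_eq_0 add.commute)
  then show ?thesis using GU_GL[OF z, of "dd (\<lambda>q. GU q b) z h"] by (simp add: op_lin z)
qed

lemma dd_Gm_Fr:
  assumes z: "z \<in> W"
  shows "dd (\<lambda>q. Gm q (Fr q x) (Fr q y)) z h =
    dd (\<lambda>q. GL q (fst x)) z h \<bullet> fst y + dd (\<lambda>q. GU q (snd x)) z h \<bullet> snd y"
proof -
  have d: "(\<lambda>q. GL q (fst x)) differentiable (at z)" "(\<lambda>q. GU q (snd x)) differentiable (at z)"
    using smooth_on_differentiable[OF smooth_GL[OF smooth_on_const] z]
      smooth_on_differentiable[OF smooth_GU[OF smooth_on_const] z] by blast+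
  then have "(\<lambda>q. GL q (fst x) \<bullet> fst y) differentiable (at z)"
    "(\<lambda>q. GU q (snd x) \<bullet> snd y) differentiable (at z)"
    by (intro differentiable_bilinear[OF bounded_bilinear_inner]; simp)+
  then show ?thesis unfolding Gm_Fr by (simp add: dd_add dd_inner d)
qed

lemma eq_Fr_I:
  assumes "z \<in> W" "\<And>y. Gm z X (Fr z y) = Gm z X' (Fr z y)"
  shows "X = X'"
  by (rule G_nondegenerate[OF assms(1)]) (metis Fr_Fi assms(2))

end

section \<open>The locally symmetric case\<close>

text \<open>
  \<open>A z u w\<close> is the Christoffel map of a Riemannian metric on the base, independent of the fibre
  coordinate, and \<open>B z u\<close> is the adjoint of \<open>A z u\<close>.
\<close>

locale symmetric_domain = lagrangian_domain +
  fixes A B :: "'a \<times> 'a \<Rightarrow> 'a \<Rightarrow> 'a \<Rightarrow> 'a" and k :: real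
  assumes A_bifamily: "smooth_bifamily W A" and B_bifamily: "smooth_bifamily W B"
    and A_sym: "z \<in> W \<Longrightarrow> A z u v = A z v u"
    and B_adj: "z \<in> W \<Longrightarrow> B z u b \<bullet> w = b \<bullet> A z u w"
    and N_B: "z \<in> W \<Longrightarrow> N z u = B z u (snd z)"
    and dA_vert: "z \<in> W \<Longrightarrow> dd (\<lambda>q. A q u v) z (0, a) = 0"
    \<comment> \<open>Compatibility of \<open>A\<close> with the base metric g, restated for
      \<open>GL\<close> = g / \<beta> - k p p. The part \<open>N z (fst x)\<close> of the fibre
      motion is absorbed by the \<open>A\<close> and \<open>B\<close> terms, so only the vertical
      part \<open>snd x\<close> shows up behind k.\<close>
    and dGL: "z \<in> W \<Longrightarrow> dd (\<lambda>q. GL q w) z (Fr z x) =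
      B z (fst x) (GL z w) + GL z (A z (fst x) w)
      - k *\<^sub>R ((snd x \<bullet> w) *\<^sub>R snd z + (snd z \<bullet> w) *\<^sub>R snd x)"
    \<comment> \<open>Constant curvature c of g with g eliminated: k = c \<beta> gives c g = k
      \<open>GL\<close> + k^2 p p. For fixed \<open>u\<close>, \<open>v\<close>, \<open>w\<close>
      the right-hand side is therefore independent of p although each summand is not.\<close>
    and base_curvature: "z \<in> W \<Longrightarrow>
      dd (\<lambda>q. A q v w) z (u, 0) - dd (\<lambda>q. A q u w) z (v, 0) + A z u (A z v w) - A z v (A z u w) =
      k *\<^sub>R ((GL z v \<bullet> w) *\<^sub>R u - (GL z u \<bullet> w) *\<^sub>R v)
      + (k\<^sup>2 * (snd z \<bullet> w)) *\<^sub>R ((snd z \<bullet> v) *\<^sub>R u - (snd z \<bullet> u) *\<^sub>R v)"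
begin

lemma AB_lin:
  assumes "z \<in> W"
  shows "A z (u + v) w = A z u w + A z v w" "A z w (u + v) = A z w u + A z w v"
    "A z (u - v) w = A z u w - A z v w" "A z w (u - v) = A z w u - A z w v"
    "A z (c *\<^sub>R u) w = c *\<^sub>R A z u w" "A z w (c *\<^sub>R u) = c *\<^sub>R A z w u"
    "A z (- u) w = - A z u w" "A z w (- u) = - A z w u" "A z 0 w = 0" "A z w 0 = 0"
    "B z (u + v) w = B z u w + B z v w" "B z w (u + v) = B z w u + B z w v"
    "B z (u - v) w = B z u w - B z v w" "B z w (u - v) = B z w u - B z w v"
    "B z (c *\<^sub>R u) w = c *\<^sub>R B z u w" "B z w (c *\<^sub>R u) = c *\<^sub>R B z w u"
    "B z (- u) w = - B z u w" "B z w (- u) = - B z w u" "B z 0 w = 0" "B z w 0 = 0"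
  using assms A_bifamily B_bifamily unfolding smooth_bifamily_def
  by (simp_all add: bilinear_ladd bilinear_radd bilinear_lsub bilinear_rsub bilinear_lneg
      bilinear_rneg bilinear_lmul bilinear_rmul bilinear_lzero bilinear_rzero)

lemma smooth_A: "smooth_on W X \<Longrightarrow> smooth_on W Y \<Longrightarrow> smooth_on W (\<lambda>z. A z (X z) (Y z))"
  and smooth_B: "smooth_on W X \<Longrightarrow> smooth_on W Y \<Longrightarrow> smooth_on W (\<lambda>z. B z (X z) (Y z))"
  using smooth_bifamily_apply[OF W_open A_bifamily] smooth_bifamily_apply[OF W_open B_bifamily]
  by blast+

lemmas differentiable_A = smooth_on_differentiable[OF smooth_A[OF smooth_on_const smooth_on_const]]
lemmas differentiable_B = smooth_on_differentiable[OF smooth_B[OF smooth_on_const smooth_on_const]]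

lemma dA_horizontal:
  assumes z: "z \<in> W"
  shows "dd (\<lambda>q. A q u v) z h = dd (\<lambda>q. A q u v) z (fst h, 0)"
proof -
  have "h = (fst h, 0) + (0, snd h)" by simp
  then have "dd (\<lambda>q. A q u v) z h = dd (\<lambda>q. A q u v) z (fst h, 0) + dd (\<lambda>q. A q u v) z (0, snd h)"
    using linear_add[OF dd_linear[OF differentiable_A[OF z]]] by metis
  then show ?thesis by (simp add: dA_vert[OF z])
qed

lemma dB_adj:
  assumes z: "z \<in> W"
  shows "dd (\<lambda>q. B q u b) z h \<bullet> w = b \<bullet> dd (\<lambda>q. A q u w) z h"
proof -
  have "dd (\<lambda>q. B q u b \<bullet> w) z h = dd (\<lambda>q. b \<bullet> A q u w) z h"
    by (rule fun_cong[OF dd_cong_open[OF W_open z]]) (rule B_adj)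
  then show ?thesis
    by (simp add: dd_inner differentiable_A differentiable_B z)
qed

lemma dN:
  assumes z: "z \<in> W"
  shows "dd (\<lambda>q. N q u) z h = dd (\<lambda>q. B q u (snd z)) z h + B z u (snd h)"
proof -
  have f: "smooth_family W (\<lambda>z b. B z u b)"
    using smooth_bifamily_right[OF W_open B_bifamily smooth_on_const] .
  have "dd (\<lambda>q. N q u) z h = dd (\<lambda>q. B q u (snd q)) z h"
    by (rule fun_cong[OF dd_cong_open[OF W_open z]]) (rule N_B)
  also have "\<dots> = dd (\<lambda>q. B q u (snd z)) z h + B z u (dd snd z h)"
    by (rule dd_family(1)[OF W_open f _ z])
      (simp add: bounded_linear_imp_differentiable bounded_linear_snd)
  finally show ?thesis by (simp add: dd_self[OF bounded_linear_snd])
qed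

lemma N_inner: "z \<in> W \<Longrightarrow> N z u \<bullet> w = snd z \<bullet> A z u w"
  by (simp add: N_B B_adj)

text \<open>The Levi-Civita connection form in the adapted frame, \<open>x\<close> being the
  direction and \<open>s\<close> the components of the differentiated field. \<open>A\<close> and
  \<open>- B\<close> are the base connection on vectors and covectors; the k terms stem from the
  rank one part of \<open>GL\<close> and from the curvature of \<open>N\<close>. That this ansatz is
  right is verified by \<open>frame_metric\<close> and \<open>frame_torsion\<close>, which
  characterise the connection.\<close>

definition \<omega> :: "'a \<times> 'a \<Rightarrow> 'a \<times> 'a \<Rightarrow> 'a \<times> 'a \<Rightarrow> 'a \<times> 'a" where
  "\<omega> z x s =
    (A z (fst x) (fst s) - (k * (snd z \<bullet> fst s)) *\<^sub>R GU z (snd x) - (k * (snd z \<bullet> fst x)) *\<^sub>R GU z (snd s),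
     (k * (snd z \<bullet> fst x)) *\<^sub>R GL z (fst s) - B z (fst x) (snd s) + (k * (GU z (snd x) \<bullet> snd s)) *\<^sub>R snd z)"

text \<open>\<open>B z u\<close> is the transpose of \<open>A z u\<close>, so this is
  \<open>base_curvature\<close> acting on covectors.\<close>

lemma base_curvature_B:
  assumes z: "z \<in> W"
  shows "dd (\<lambda>q. B q v b) z (u, 0) - dd (\<lambda>q. B q u b) z (v, 0) + B z v (B z u b) - B z u (B z v b) =
    k *\<^sub>R ((b \<bullet> u) *\<^sub>R GL z v - (b \<bullet> v) *\<^sub>R GL z u)
    + k\<^sup>2 *\<^sub>R (((snd z \<bullet> v) * (b \<bullet> u) - (snd z \<bullet> u) * (b \<bullet> v)) *\<^sub>R snd z)"
proof (rule vector_eq_rdot[THEN iffD1], rule allI)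
  fix w
  have "(dd (\<lambda>q. B q v b) z (u, 0) - dd (\<lambda>q. B q u b) z (v, 0) + B z v (B z u b) - B z u (B z v b)) \<bullet> w
    = b \<bullet> (dd (\<lambda>q. A q v w) z (u, 0) - dd (\<lambda>q. A q u w) z (v, 0) + A z u (A z v w) - A z v (A z u w))"
    by (simp add: inner_diff_left inner_diff_right inner_add_left inner_add_right dB_adj B_adj z)
  also have "\<dots> = (k *\<^sub>R ((b \<bullet> u) *\<^sub>R GL z v - (b \<bullet> v) *\<^sub>R GL z u)
    + k\<^sup>2 *\<^sub>R (((snd z \<bullet> v) * (b \<bullet> u) - (snd z \<bullet> u) * (b \<bullet> v)) *\<^sub>R snd z)) \<bullet> w"
    unfolding base_curvature[OF z]
    by (simp add: inner_diff_left inner_diff_right inner_add_left inner_add_right algebra_simps)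
  finally show "(dd (\<lambda>q. B q v b) z (u, 0) - dd (\<lambda>q. B q u b) z (v, 0) + B z v (B z u b) - B z u (B z v b)) \<bullet> w
    = (k *\<^sub>R ((b \<bullet> u) *\<^sub>R GL z v - (b \<bullet> v) *\<^sub>R GL z u)
    + k\<^sup>2 *\<^sub>R (((snd z \<bullet> v) * (b \<bullet> u) - (snd z \<bullet> u) * (b \<bullet> v)) *\<^sub>R snd z)) \<bullet> w" .
qed

lemma dB_horizontal:
  assumes z: "z \<in> W"
  shows "dd (\<lambda>q. B q u b) z h = dd (\<lambda>q. B q u b) z (fst h, 0)"
  by (rule vector_eq_rdot[THEN iffD1]) (simp add: dB_adj z dA_horizontal[OF z, of _ _ h])

text \<open>Contracting the base curvature with b = p kills its k^2 term by antisymmetry; what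
  remains is the curvature of \<open>N\<close>, together with the vertical derivatives of
  \<open>N\<close>.\<close>

lemma bracket_frame:
  assumes z: "z \<in> W"
  shows "lie_bracket (\<lambda>z. Fr z x) (\<lambda>z. Fr z y) z =
    (0, k *\<^sub>R ((snd z \<bullet> fst x) *\<^sub>R GL z (fst y) - (snd z \<bullet> fst y) *\<^sub>R GL z (fst x))
       + B z (fst y) (snd x) - B z (fst x) (snd y))"
  using base_curvature_B[OF z, of "fst y" "snd z" "fst x"]
  unfolding bracket_Fr[OF z] dN[OF z] dB_horizontal[OF z, of _ _ "Fr z _"]
  by (simp add: Fr_def N_B z AB_lin algebra_simps)

lemma dd_GU_frame:
  assumes z: "z \<in> W"
  shows "dd (\<lambda>q. GU q b) z (Fr z x) =
    k *\<^sub>R ((snd x \<bullet> GU z b) *\<^sub>R GU z (snd z) + (snd z \<bullet> GU z b) *\<^sub>R GU z (snd x))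
    - GU z (B z (fst x) b) - A z (fst x) (GU z b)"
  unfolding dd_GU[OF z] dGL[OF z] by (simp add: op_lin z GL_GU GU_GL algebra_simps)

lemma frame_metric:
  assumes z: "z \<in> W"
  shows "dd (\<lambda>q. Gm q (Fr q y) (Fr q v)) z (Fr z x) =
    Gm z (Fr z (\<omega> z x y)) (Fr z v) + Gm z (Fr z y) (Fr z (\<omega> z x v))"
proof -
  have s: "GL z (fst y) \<bullet> A z (fst x) (fst v) = B z (fst x) (GL z (fst y)) \<bullet> fst v"
    "GL z (fst y) \<bullet> GU z (snd x) = fst y \<bullet> snd x"
    "GL z (fst y) \<bullet> GU z (snd v) = fst y \<bullet> snd v"
    "GU z (snd y) \<bullet> B z (fst x) (snd v) = A z (fst x) (GU z (snd y)) \<bullet> snd v"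
    "GU z (snd y) \<bullet> GL z (fst v) = snd y \<bullet> fst v"
    using B_adj[OF z, of "fst x" "GL z (fst y)" "fst v"]
      B_adj[OF z, of "fst x" "snd v" "GU z (snd y)"]
    by (simp_all add: inner_GL_GU z inner_commute)
  note s = s GU_sym[OF z, of "snd x" "snd v"] GU_sym[OF z, of "snd y" "snd v"]
    GU_sym[OF z, of "snd x" "snd y"] GU_sym[OF z, of "snd z" "snd v"] GU_sym[OF z, of "snd z" "snd y"]
  have c: "fst v \<bullet> snd x = snd x \<bullet> fst v" "fst y \<bullet> snd x = snd x \<bullet> fst y" "fst y \<bullet> snd v = snd v \<bullet> fst y"
    "GU z (snd y) \<bullet> snd z = snd z \<bullet> GU z (snd y)"
    by (simp_all add: inner_commute)
  show ?thesis
    unfolding dd_Gm_Fr[OF z]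
    unfolding dGL[OF z] dd_GU_frame[OF z] Gm_Fr \<omega>_def
    by (simp add: op_lin z inner_diff_left inner_diff_right inner_add_left inner_add_right s c
        inner_GL_GU GL_GU GU_GL algebra_simps)
qed

lemma frame_torsion:
  assumes z: "z \<in> W"
  shows "Fr z (\<omega> z x y) - Fr z (\<omega> z y x) = lie_bracket (\<lambda>z. Fr z x) (\<lambda>z. Fr z y) z"
  unfolding bracket_frame[OF z] \<omega>_def Fr_lin[OF z, symmetric]
  by (simp add: Fr_def op_lin z A_sym[OF z, of "fst y"] GU_sym[OF z, of "snd y"]
      inner_commute[of "snd y"] algebra_simps)

text \<open>The Koszul formula is solved by any expression that is metric and torsion free, and
  \<open>\<omega>\<close> is both.\<close>

lemma nabla_frame:
  assumes z: "z \<in> W"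
  shows "nabla (\<lambda>z. Fr z x) (\<lambda>z. Fr z y) z = Fr z (\<omega> z x y)"
proof (rule eq_Fr_I[OF z])
  fix v
  note sm = smooth_Fr[OF smooth_on_const]
  have "2 * Gm z (nabla (\<lambda>z. Fr z x) (\<lambda>z. Fr z y) z) (Fr z v) =
    2 * Gm z (Fr z (\<omega> z x y)) (Fr z v)"
    unfolding nabla_koszul[OF z sm sm sm] frame_metric[OF z] frame_torsion[OF z, symmetric]
    using G_sym[OF z, of "Fr z x" "Fr z (\<omega> z _ _)"] G_sym[OF z, of "Fr z y" "Fr z (\<omega> z _ _)"]
      G_sym[OF z, of "Fr z v" "Fr z (\<omega> z _ _)"]
    by (simp add: G_lin z)
  then show "Gm z (nabla (\<lambda>z. Fr z x) (\<lambda>z. Fr z y) z) (Fr z v) = Gm z (Fr z (\<omega> z x y)) (Fr z v)"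
    by simp
qed

lemma nabla_section:
  assumes z: "z \<in> W" and s: "smooth_on W s"
  shows "nabla X (\<lambda>q. Fr q (s q)) z = Fr z (dd s z (X z) + \<omega> z (Fi z (X z)) (s z))"
proof -
  have "nabla X (\<lambda>q. Fr q (s q)) z = nabla X (\<lambda>q. Fr q (s z)) z + Fr z (dd s z (X z))"
    using dd_family(1)[OF W_open Fr_family smooth_on_differentiable[OF s z] z, of "X z"]
    by (simp add: levi_civita_def)
  also have "nabla X (\<lambda>q. Fr q (s z)) z = nabla (\<lambda>q. Fr q (Fi z (X z))) (\<lambda>q. Fr q (s z)) z"
    by (rule nabla_cong[OF z]) simp_all
  finally show ?thesis by (simp add: nabla_frame[OF z] Fr_lin[OF z] add.commute)
qed

lemma dd_J0:
  assumes z: "z \<in> W"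
  shows "dd (\<lambda>q. J0 q x) z h = (- dd (\<lambda>q. GU q (snd x)) z h, dd (\<lambda>q. GL q (fst x)) z h)"
proof -
  have "(\<lambda>q. GL q (fst x)) differentiable (at z)" "(\<lambda>q. GU q (snd x)) differentiable (at z)"
    using smooth_on_differentiable[OF smooth_GL[OF smooth_on_const] z]
      smooth_on_differentiable[OF smooth_GU[OF smooth_on_const] z] by blast+
  then show ?thesis unfolding J0_def by (simp add: dd_Pair dd_minus)
qed

lemma J0_parallel:
  assumes z: "z \<in> W"
  shows "dd (\<lambda>q. J0 q s) z (Fr z x) + \<omega> z x (J0 z s) = J0 z (\<omega> z x s)"
proof -
  have "GU z (snd x) \<bullet> GL z (fst s) = snd x \<bullet> fst s" "snd x \<bullet> GU z (snd s) = GU z (snd x) \<bullet> snd s"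
    "snd z \<bullet> GU z (snd s) = GU z (snd z) \<bullet> snd s"
    using inner_GL_GU[OF z] GU_sym[OF z] by simp_all
  then show ?thesis
    unfolding dd_J0[OF z] dGL[OF z] dd_GU_frame[OF z]
    by (simp add: J0_def \<omega>_def prod_eq_iff AB_lin op_lin z GL_GU GU_GL inner_diff_right
        inner_add_right algebra_simps)
qed

lemma nabla_J:
  assumes z: "z \<in> W" and X: "smooth_on W X"
  shows "nabla V (\<lambda>q. Jm q (X q)) z = Jm z (nabla V X z)"
proof -
  define s where "s q = Fi q (X q)" for q
  have s: "smooth_on W s" unfolding s_def by (rule smooth_Fi[OF X])
  have Js: "smooth_on W (\<lambda>q. J0 q (s q))" by (rule smooth_family_apply[OF W_open J0_family s])
  have "nabla V (\<lambda>q. Jm q (X q)) z = nabla V (\<lambda>q. Fr q (J0 q (s q))) z"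
    by (simp add: Jm_def s_def)
  also have "\<dots> = Fr z (J0 z (dd s z (V z)) + (dd (\<lambda>q. J0 q (s z)) z (Fr z (Fi z (V z)))
      + \<omega> z (Fi z (V z)) (J0 z (s z))))"
    unfolding nabla_section[OF z Js] dd_family(1)[OF W_open J0_family smooth_on_differentiable[OF s z] z]
    by (simp add: algebra_simps)
  also have "\<dots> = Fr z (J0 z (dd s z (V z) + \<omega> z (Fi z (V z)) (s z)))"
    unfolding J0_parallel[OF z] by (simp add: linear_add[OF smooth_family_linear[OF J0_family z]])
  also have "\<dots> = Jm z (nabla V (\<lambda>q. Fr q (s q)) z)"
    unfolding nabla_section[OF z s] Jm_Fr ..
  finally show ?thesis by (simp add: s_def)
qed

section \<open>The reflection in the horizontal distribution\<close>

definition S0 :: "'a \<times> 'a \<Rightarrow> 'a \<times> 'a" where "S0 x = (fst x, - snd x)"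

definition Sm :: "'a \<times> 'a \<Rightarrow> 'a \<times> 'a \<Rightarrow> 'a \<times> 'a" where "Sm z X = Fr z (S0 (Fi z X))"

lemma bounded_linear_S0: "bounded_linear S0"
  unfolding S0_def
  by (intro bounded_linear_Pair bounded_linear_minus bounded_linear_fst bounded_linear_snd)

lemma smooth_Sm: "smooth_on W X \<Longrightarrow> smooth_on W (\<lambda>z. Sm z (X z))"
  unfolding Sm_def
  by (intro smooth_Fr smooth_on_bounded_linear[OF W_open bounded_linear_S0] smooth_Fi)

lemma Sm_Fr [simp]: "Sm z (Fr z x) = Fr z (S0 x)"
  by (simp add: Sm_def)

text \<open>\<open>\<omega> z x\<close> is block diagonal apart from the summand k \<theta>(x)
  \<open>J0 z\<close>. The blocks commute with \<open>S0\<close> whereas \<open>J0\<close>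
  anticommutes with it, so the commutator of \<open>\<omega> z x\<close> with \<open>S0\<close> is 2
  k \<theta>(x) \<open>J0 z\<close> composed with \<open>S0\<close>.\<close>

lemma nabla_S:
  assumes z: "z \<in> W" and X: "smooth_on W X"
  shows "nabla V (\<lambda>q. Sm q (X q)) z =
    Sm z (nabla V X z) + (2 * k * (snd z \<bullet> fst (V z))) *\<^sub>R Jm z (Sm z (X z))"
proof -
  define s where "s q = Fi q (X q)" for q
  define v where "v = Fi z (V z)"
  have s: "smooth_on W s" unfolding s_def by (rule smooth_Fi[OF X])
  have Ss: "smooth_on W (\<lambda>q. S0 (s q))"
    by (rule smooth_on_bounded_linear[OF W_open bounded_linear_S0 s])
  have *: "\<omega> z v (S0 t) = S0 (\<omega> z v t) + (2 * k * (snd z \<bullet> fst v)) *\<^sub>R J0 z (S0 t)" for t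
  proof -
    have "(2 * k * c) *\<^sub>R b = (k * c) *\<^sub>R b + (k * c) *\<^sub>R b" for c and b :: 'a
      by (simp add: scaleR_left_distrib[symmetric])
    then show ?thesis
      by (simp add: \<omega>_def S0_def J0_def prod_eq_iff op_lin AB_lin z)
  qed
  have "nabla V (\<lambda>q. Sm q (X q)) z = nabla V (\<lambda>q. Fr q (S0 (s q))) z"
    by (simp add: Sm_def s_def)
  also have "\<dots> = Fr z (S0 (dd s z (V z)) + \<omega> z v (S0 (s z)))"
    unfolding nabla_section[OF z Ss]
    by (simp add: dd_bounded_linear[OF bounded_linear_S0 smooth_on_differentiable[OF s z]] v_def)
  also have "\<dots> = Fr z (S0 (dd s z (V z) + \<omega> z v (s z)))
      + (2 * k * (snd z \<bullet> fst v)) *\<^sub>R Fr z (J0 z (S0 (s z)))"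
    unfolding * by (simp add: S0_def prod_eq_iff Fr_def op_lin z algebra_simps)
  also have "\<dots> = Sm z (nabla V (\<lambda>q. Fr q (s q)) z) + (2 * k * (snd z \<bullet> fst v)) *\<^sub>R Jm z (Sm z (Fr z (s z)))"
    unfolding nabla_section[OF z s] Jm_Fr Sm_Fr v_def ..
  finally show ?thesis by (simp add: s_def v_def)
qed

section \<open>The curvature in the adapted frame\<close>

lemma dd_\<omega>_horizontal:
  assumes z: "z \<in> W"
  shows "dd (\<lambda>q. \<omega> q y (w, 0)) z h =
    (dd (\<lambda>q. A q (fst y) w) z h - (k * (snd h \<bullet> w)) *\<^sub>R GU z (snd y)
       - (k * (snd z \<bullet> w)) *\<^sub>R dd (\<lambda>q. GU q (snd y)) z h,
     (k * (snd h \<bullet> fst y)) *\<^sub>R GL z w + (k * (snd z \<bullet> fst y)) *\<^sub>R dd (\<lambda>q. GL q w) z h)"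
proof -
  have GLd: "(\<lambda>q. GL q v) differentiable (at z)" and GUd: "(\<lambda>q. GU q v) differentiable (at z)" for v
    using smooth_on_differentiable[OF smooth_GL[OF smooth_on_const] z]
      smooth_on_differentiable[OF smooth_GU[OF smooth_on_const] z] by blast+
  have sd: "snd differentiable (at z)"
    by (simp add: bounded_linear_imp_differentiable bounded_linear_snd)
  have "bounded_linear (\<lambda>q. k * (snd q \<bullet> v))" for v :: 'a
    by (intro bounded_linear_const_mult bounded_linear_compose[OF bounded_linear_inner_left]
        bounded_linear_snd)
  note p = bounded_linear_imp_differentiable[OF this] dd_self[OF this]
  have "dd (\<lambda>q. \<omega> q y (w, 0)) z h = dd (\<lambda>q. (A q (fst y) w - (k * (snd q \<bullet> w)) *\<^sub>R GU q (snd y),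
      (k * (snd q \<bullet> fst y)) *\<^sub>R GL q w)) z h"
    by (rule fun_cong[OF dd_cong_open[OF W_open z]]) (simp add: \<omega>_def op_lin AB_lin)
  then show ?thesis
    by (simp add: dd_Pair dd_diff dd_scaleR p GLd GUd differentiable_A[OF z]
        differentiable_bilinear[OF bounded_bilinear_scaleR] algebra_simps)
qed

text \<open>A horizontal third argument is enough: every vertical vector is J of a horizontal one,
  and the curvature commutes with J because J is parallel.\<close>

lemma curvature_frame:
  assumes z: "z \<in> W"
  shows "curvature Gm (\<lambda>q. Fr q x) (\<lambda>q. Fr q y) (\<lambda>q. Fr q (w, 0)) z =
    Fr z (k *\<^sub>R ((GL z (fst y) \<bullet> w) *\<^sub>R fst x - (GL z (fst x) \<bullet> w) *\<^sub>R fst y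
            - (snd x \<bullet> w) *\<^sub>R GU z (snd y) + (snd y \<bullet> w) *\<^sub>R GU z (snd x)),
          (k * (snd x \<bullet> fst y - snd y \<bullet> fst x)) *\<^sub>R GL z w)"
proof -
  note sm = smooth_Fr[OF smooth_on_const]
  have sw: "smooth_on W (\<lambda>q. \<omega> q y (w, 0))" for y
  proof -
    have "smooth_on W (\<lambda>q. Fi q (nabla (\<lambda>q. Fr q y) (\<lambda>q. Fr q (w, 0)) q))"
      by (intro smooth_Fi nabla_smooth sm)
    then show ?thesis
      by (rule smooth_on_cong[OF W_open, rotated]) (simp add: nabla_frame)
  qed
  have nn: "nabla (\<lambda>q. Fr q x) (nabla (\<lambda>q. Fr q y) (\<lambda>q. Fr q (w, 0))) z =
    Fr z (dd (\<lambda>q. \<omega> q y (w, 0)) z (Fr z x) + \<omega> z x (\<omega> z y (w, 0)))" for x y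
  proof -
    have "nabla (\<lambda>q. Fr q x) (nabla (\<lambda>q. Fr q y) (\<lambda>q. Fr q (w, 0))) z =
      nabla (\<lambda>q. Fr q x) (\<lambda>q. Fr q (\<omega> q y (w, 0))) z"
      by (rule nabla_cong[OF z refl nabla_frame])
    then show ?thesis by (simp add: nabla_section[OF z sw])
  qed
  have nb: "nabla (lie_bracket (\<lambda>q. Fr q x) (\<lambda>q. Fr q y)) (\<lambda>q. Fr q (w, 0)) z =
    Fr z (\<omega> z (Fi z (lie_bracket (\<lambda>q. Fr q x) (\<lambda>q. Fr q y) z)) (w, 0))"
    unfolding nabla_section[OF z smooth_on_const] by simp
  have e: "snd y \<bullet> GU z (snd x) = snd x \<bullet> GU z (snd y)"
    using GU_sym[OF z, of "snd y" "snd x"] by (simp add: inner_commute)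
  have "\<And>c. GU z c \<bullet> GL z w = c \<bullet> w" by (simp add: inner_GL_GU z)
  \<comment> \<open>Its k^2 part cancels against the contribution of the bracket of the two frame
    fields, where \<open>GU\<close> undoes \<open>GL\<close>.\<close>
  moreover note base_curvature[OF z, of "fst y" w "fst x"]
  ultimately show ?thesis
    unfolding curvature_def nn nb dd_\<omega>_horizontal[OF z] dGL[OF z] dd_GU_frame[OF z]
      bracket_frame[OF z] dA_horizontal[OF z, of _ _ "Fr z _"] Fr_lin[OF z, symmetric]
    apply (intro arg_cong[where f = "Fr z"])
    apply (simp add: \<omega>_def prod_eq_iff Fi_def AB_lin op_lin z GL_GU GU_GL
        inner_diff_right inner_add_right inner_diff_left inner_add_left)
    apply (simp add: Fr_def op_lin AB_lin z N_inner inner_add_left A_sym[OF z, of "fst y" "fst x"] B_adj algebra_simps power2_eq_square)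
    by (simp add: e add.assoc[symmetric])
qed

definition wedge :: "'a \<times> 'a \<Rightarrow> 'a \<times> 'a \<Rightarrow> 'a \<times> 'a \<Rightarrow> 'a \<times> 'a \<Rightarrow> 'a \<times> 'a" where
  "wedge z X Y Z = Gm z Y Z *\<^sub>R X - Gm z X Z *\<^sub>R Y"

text \<open>The curvature tensor of a complex quadric or of its noncompact dual.\<close>

definition R0 :: "'a \<times> 'a \<Rightarrow> 'a \<times> 'a \<Rightarrow> 'a \<times> 'a \<Rightarrow> 'a \<times> 'a \<Rightarrow> 'a \<times> 'a" where
  "R0 z X Y Z = (k / 2) *\<^sub>R (wedge z X Y Z + wedge z (Jm z X) (Jm z Y) Z
     + wedge z (Sm z X) (Sm z Y) Z + wedge z (Jm z (Sm z X)) (Jm z (Sm z Y)) Z)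
     + (k * Gm z X (Jm z Y)) *\<^sub>R Jm z Z"

lemma R0_frame:
  assumes z: "z \<in> W"
  shows "R0 z (Fr z x) (Fr z y) (Fr z (w, 0)) =
    Fr z (k *\<^sub>R ((GL z (fst y) \<bullet> w) *\<^sub>R fst x - (GL z (fst x) \<bullet> w) *\<^sub>R fst y
            - (snd x \<bullet> w) *\<^sub>R GU z (snd y) + (snd y \<bullet> w) *\<^sub>R GU z (snd x)),
          (k * (snd x \<bullet> fst y - snd y \<bullet> fst x)) *\<^sub>R GL z w)"
proof -
  have h: "(k / 2) *\<^sub>R (c *\<^sub>R b + c *\<^sub>R b) = (k * c) *\<^sub>R b" for c and b :: 'a
    by (simp add: scaleR_left_distrib[symmetric])
  have e: "GL z (fst x) \<bullet> GU z (snd y) = snd y \<bullet> fst x" "GU z (snd x) \<bullet> GL z (fst y) = snd x \<bullet> fst y"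
    by (simp_all add: inner_GL_GU z inner_commute)
  show ?thesis
    unfolding R0_def wedge_def Jm_Fr Sm_Fr Gm_Fr Fr_lin[OF z, symmetric]
    by (intro arg_cong[where f = "Fr z"])
      (simp add: J0_def S0_def prod_eq_iff op_lin z GL_GU GU_GL e scaleR_diff_right scaleR_add_right
        scaleR_left_distrib[symmetric] h algebra_simps)
qed

lemma Jm_lin:
  assumes "z \<in> W"
  shows "Jm z (X + Y) = Jm z X + Jm z Y" "Jm z (X - Y) = Jm z X - Jm z Y" "Jm z (- X) = - Jm z X"
    "Jm z (c *\<^sub>R X) = c *\<^sub>R Jm z X"
  using smooth_family_linear[OF Jm_family assms]
  by (simp_all add: linear_add linear_diff linear_neg linear_cmul)

text \<open>The sum of the wedge of X, Y and the wedge of J X, J Y commutes with J, since J is skew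
  for the metric and squares to -1. The four wedges form two such pairs.\<close>

lemma R0_J: "z \<in> W \<Longrightarrow> R0 z X Y (Jm z Z) = Jm z (R0 z X Y Z)"
  by (simp add: R0_def wedge_def Jm_lin Gm_Jm_right Jm_Jm G_lin algebra_simps)

lemma wedge_lin:
  assumes "z \<in> W"
  shows "wedge z (X + X') Y Z = wedge z X Y Z + wedge z X' Y Z"
    "wedge z X (Y + Y') Z = wedge z X Y Z + wedge z X Y' Z"
    "wedge z X Y (Z + Z') = wedge z X Y Z + wedge z X Y Z'"
    "wedge z (c *\<^sub>R X) Y Z = c *\<^sub>R wedge z X Y Z"
    "wedge z X (c *\<^sub>R Y) Z = c *\<^sub>R wedge z X Y Z"
    "wedge z (X - X') Y Z = wedge z X Y Z - wedge z X' Y Z"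
    "wedge z X (Y - Y') Z = wedge z X Y Z - wedge z X Y' Z"
  using assms by (simp_all add: wedge_def G_lin algebra_simps)

lemma R0_add: "z \<in> W \<Longrightarrow> R0 z X Y (Z + Z') = R0 z X Y Z + R0 z X Y Z'"
  by (simp add: R0_def wedge_lin Jm_lin algebra_simps)

lemma Rm_J:
  assumes z: "z \<in> W"
  shows "Rm z X Y (Jm z Z) = Jm z (Rm z X Y Z)"
proof -
  let ?X = "\<lambda>_::'a \<times> 'a. X" and ?Y = "\<lambda>_::'a \<times> 'a. Y" and ?Z = "\<lambda>_::'a \<times> 'a. Z"
  note c = smooth_on_const
  note JZ = smooth_Jm[OF c, of Z]
  have n: "nabla V (nabla V' (\<lambda>q. Jm q Z)) z = Jm z (nabla V (nabla V' ?Z) z)"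
    if V': "smooth_on W V'" for V V'
  proof -
    have "nabla V (nabla V' (\<lambda>q. Jm q Z)) z = nabla V (\<lambda>q. Jm q (nabla V' ?Z q)) z"
      by (rule nabla_cong[OF z refl]) (simp add: nabla_J[OF _ c])
    then show ?thesis using nabla_J[OF z nabla_smooth[OF V' c]] by simp
  qed
  have "curvature Gm ?X ?Y (\<lambda>q. Jm q Z) z = Jm z (curvature Gm ?X ?Y ?Z z)"
    unfolding curvature_def n[OF c] nabla_J[OF z c] by (simp add: Jm_lin z)
  then show ?thesis
    using curvature_eq_Rm[OF z c c JZ, of X Y] curvature_eq_Rm[OF z c c c, of X Y Z] by simp
qed

lemma Rm_eq_R0:
  assumes z: "z \<in> W"
  shows "Rm z X Y Z = R0 z X Y Z"
proof -
  note sm = smooth_Fr[OF smooth_on_const]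
  have *: "Rm z X Y (Fr z (w, 0)) = R0 z X Y (Fr z (w, 0))" for w
    using curvature_frame[OF z, of "Fi z X" "Fi z Y" w] R0_frame[OF z, of "Fi z X" "Fi z Y" w]
      curvature_eq_Rm[OF z sm sm sm, of "Fi z X" "Fi z Y" "(w, 0)"] by simp
  obtain w a where Z: "Z = Fr z (w, a)" by (metis Fr_Fi surj_pair)
  have Z': "Z = Fr z (w, 0) + Jm z (Fr z (GU z a, 0))"
    unfolding Z Jm_Fr by (simp add: J0_def Fr_def op_lin GL_GU z)
  show ?thesis
    unfolding Z' R0_add[OF z] R0_J[OF z] linear_add[OF smooth_family_linear[OF Rm_family(3) z]]
      Rm_J[OF z] * ..
qed

section \<open>Parallelism of the curvature and integrability of J\<close>

lemma nabla_wedge: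
  assumes z: "z \<in> W" and s: "smooth_on W X" "smooth_on W Y" "smooth_on W Z"
  shows "nabla V (\<lambda>q. wedge q (X q) (Y q) (Z q)) z =
    wedge z (nabla V X z) (Y z) (Z z) + wedge z (X z) (nabla V Y z) (Z z)
    + wedge z (X z) (Y z) (nabla V Z z)"
proof -
  have g: "smooth_on W (\<lambda>q. Gm q (Y q) (Z q))" "smooth_on W (\<lambda>q. Gm q (X q) (Z q))"
    using smooth_bifamily_apply[OF W_open G_bifamily] s by blast+
  have gs: "smooth_on W (\<lambda>q. Gm q (Y q) (Z q) *\<^sub>R X q)" "smooth_on W (\<lambda>q. Gm q (X q) (Z q) *\<^sub>R Y q)"
    using smooth_on_scaleR[OF W_open] g s by blast+
  show ?thesis
    unfolding wedge_def nabla_right(2)[OF z gs] nabla_scaleR[OF z s(1) g(1)] nabla_scaleR[OF z s(2) g(2)]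
      nabla_metric[OF z s(2,3)] nabla_metric[OF z s(1,3)]
    by (simp add: algebra_simps)
qed

lemma smooth_wedge:
  assumes "smooth_on W X" "smooth_on W Y" "smooth_on W Z"
  shows "smooth_on W (\<lambda>q. wedge q (X q) (Y q) (Z q))"
  unfolding wedge_def
  using assms smooth_bifamily_apply[OF W_open G_bifamily]
  by (intro smooth_on_diff smooth_on_scaleR W_open) blast+

text \<open>Only the wedges with S need care. The extra term of S is 2 k \<theta>(V) J S and that of
  J S is -2 k \<theta>(V) S, so the mixed wedges produced by \<open>w3\<close> and \<open>w4\<close>
  are opposite: the sum over the circle of reflections is rotation invariant.\<close>

lemma nabla_R0:
  assumes z: "z \<in> W" and s: "smooth_on W X" "smooth_on W Y" "smooth_on W Z"
  shows "nabla V (\<lambda>q. R0 q (X q) (Y q) (Z q)) z =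
    R0 z (nabla V X z) (Y z) (Z z) + R0 z (X z) (nabla V Y z) (Z z) + R0 z (X z) (Y z) (nabla V Z z)"
proof -
  note S = smooth_Sm[OF s(1)] smooth_Sm[OF s(2)]
  note J = smooth_Jm[OF s(1)] smooth_Jm[OF s(2)]
  note JS = smooth_Jm[OF S(1)] smooth_Jm[OF S(2)]
  define w1 where "w1 q = wedge q (X q) (Y q) (Z q)" for q
  define w2 where "w2 q = wedge q (Jm q (X q)) (Jm q (Y q)) (Z q)" for q
  define w3 where "w3 q = wedge q (Sm q (X q)) (Sm q (Y q)) (Z q)" for q
  define w4 where "w4 q = wedge q (Jm q (Sm q (X q))) (Jm q (Sm q (Y q))) (Z q)" for q
  have w: "smooth_on W w1" "smooth_on W w2" "smooth_on W w3" "smooth_on W w4"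
    unfolding w1_def w2_def w3_def w4_def using smooth_wedge s J S JS by blast+
  have g: "smooth_on W (\<lambda>q. Gm q (X q) (Jm q (Y q)))"
    by (rule smooth_bifamily_apply[OF W_open G_bifamily s(1) J(2)])
  note c = smooth_on_const[of W]
  have w12: "smooth_on W (\<lambda>q. w1 q + w2 q)" and w123: "smooth_on W (\<lambda>q. w1 q + w2 q + w3 q)"
    and w1234: "smooth_on W (\<lambda>q. w1 q + w2 q + w3 q + w4 q)"
    using w by (auto intro!: smooth_on_add W_open)
  note kw = smooth_on_scaleR[OF W_open c w1234, of "k/2"]
  note kg = smooth_on_mult[OF W_open c g, of k]
  note kgJ = smooth_on_scaleR[OF W_open kg smooth_Jm[OF s(3)]]
  have "nabla V (\<lambda>q. R0 q (X q) (Y q) (Z q)) z =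
    (k / 2) *\<^sub>R (nabla V w1 z + nabla V w2 z + nabla V w3 z + nabla V w4 z)
    + (k * (Gm z (nabla V X z) (Jm z (Y z)) + Gm z (X z) (Jm z (nabla V Y z)))) *\<^sub>R Jm z (Z z)
    + (k * Gm z (X z) (Jm z (Y z))) *\<^sub>R Jm z (nabla V Z z)"
    unfolding R0_def w1_def[symmetric] w2_def[symmetric] w3_def[symmetric] w4_def[symmetric]
      nabla_right(1)[OF z kw kgJ] nabla_scaleR[OF z w1234 c] nabla_scaleR[OF z smooth_Jm[OF s(3)] kg]
      nabla_right(1)[OF z w123 w(4)] nabla_right(1)[OF z w12 w(3)] nabla_right(1)[OF z w(1,2)]
      nabla_J[OF z s(3)]
    using dd_mult[of "\<lambda>_. k", OF _ smooth_on_differentiable[OF g z]] nabla_metric[OF z s(1) J(2), of V]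
      nabla_J[OF z s(2), of V]
    by simp
  also have "nabla V w1 z + nabla V w2 z + nabla V w3 z + nabla V w4 z =
    wedge z (nabla V X z) (Y z) (Z z) + wedge z (Jm z (nabla V X z)) (Jm z (Y z)) (Z z)
     + wedge z (Sm z (nabla V X z)) (Sm z (Y z)) (Z z)
     + wedge z (Jm z (Sm z (nabla V X z))) (Jm z (Sm z (Y z))) (Z z)
     + (wedge z (X z) (nabla V Y z) (Z z) + wedge z (Jm z (X z)) (Jm z (nabla V Y z)) (Z z)
     + wedge z (Sm z (X z)) (Sm z (nabla V Y z)) (Z z)
     + wedge z (Jm z (Sm z (X z))) (Jm z (Sm z (nabla V Y z))) (Z z))
     + (wedge z (X z) (Y z) (nabla V Z z) + wedge z (Jm z (X z)) (Jm z (Y z)) (nabla V Z z)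
     + wedge z (Sm z (X z)) (Sm z (Y z)) (nabla V Z z)
     + wedge z (Jm z (Sm z (X z))) (Jm z (Sm z (Y z))) (nabla V Z z))"
    unfolding w1_def w2_def w3_def w4_def nabla_wedge[OF z s] nabla_wedge[OF z J s(3)]
      nabla_wedge[OF z S s(3)] nabla_wedge[OF z JS s(3)] nabla_J[OF z s(1)] nabla_J[OF z s(2)]
      nabla_J[OF z S(1)] nabla_J[OF z S(2)] nabla_S[OF z s(1)] nabla_S[OF z s(2)]
    by (simp add: wedge_lin Jm_lin Jm_Jm z algebra_simps)
  finally show ?thesis
    by (simp add: R0_def algebra_simps)
qed

lemma locally_symmetric: "locally_symmetric_on W Gm"
  unfolding locally_symmetric_on_def
proof (intro allI impI ballI, elim conjE)
  fix V X Y Z :: "'a \<times> 'a \<Rightarrow> 'a \<times> 'a" and z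
  assume s: "smooth_on W V" "smooth_on W X" "smooth_on W Y" "smooth_on W Z" and z: "z \<in> W"
  have R: "curvature Gm X Y Z q = R0 q (X q) (Y q) (Z q)"
    if "smooth_on W X" "smooth_on W Y" "smooth_on W Z" "q \<in> W" for X Y Z q
    using curvature_eq_Rm[OF that(4,1-3)] Rm_eq_R0[OF that(4)] by simp
  have "nabla V (curvature Gm X Y Z) z = nabla V (\<lambda>q. R0 q (X q) (Y q) (Z q)) z"
    by (rule nabla_cong[OF z refl R[OF s(2-4)]])
  then show "nabla_curvature Gm V X Y Z z = 0"
    unfolding nabla_curvature_def R[OF nabla_smooth[OF s(1,2)] s(3,4) z]
      R[OF s(2) nabla_smooth[OF s(1,3)] s(4) z] R[OF s(2,3) nabla_smooth[OF s(1,4)] z]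
    by (simp add: nabla_R0[OF z s(2-4)])
qed

text \<open>For a torsion free connection that makes J parallel, all terms of the Nijenhuis tensor
  cancel once brackets are written as differences of covariant derivatives.\<close>

lemma integrable_J: "integrable_structure_on W Jm"
  unfolding integrable_structure_on_def
proof (intro allI impI ballI, elim conjE)
  fix X Y :: "'a \<times> 'a \<Rightarrow> 'a \<times> 'a" and z
  assume s: "smooth_on W X" "smooth_on W Y" and z: "z \<in> W"
  let ?JX = "\<lambda>y. Jm y (X y)" and ?JY = "\<lambda>y. Jm y (Y y)"
  show "nijenhuis Jm X Y z = 0"
    unfolding nijenhuis_def nabla_torsion[OF z, symmetric] nabla_J[OF z s(1)] nabla_J[OF z s(2)]
    by (simp add: Jm_lin Jm_Jm z algebra_simps)
qed

lemma kaehler: "kaehler_on W Gm Jm"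
  unfolding kaehler_on_def almost_complex_on_def
  using Gm_riemannian integrable_J Gm_Jm closed_fundamental_form Jm_Jm
    smooth_family_linear[OF Jm_family] smooth_family_smooth[OF Jm_family]
  by blast

end

section \<open>The Liouville field and the curvature\<close>

text \<open>Serves for a function of which only the gradient is known to be smooth.\<close>

lemma smooth_on_potential:
  assumes "\<And>x. x \<in> S \<Longrightarrow> f differentiable (at x)" "\<And>v. smooth_on S (\<lambda>x. dd f x v)"
  shows "smooth_on S f"
proof -
  have "Ck_on (Suc k) S f" for k
    using assms by (simp add: smooth_on_def)
  then show ?thesis unfolding smooth_on_def using Ck_on_Suc_imp by blast
qed

text \<open>Agreement along one ray suffices for equal radial derivatives. This weak form matters:
  the curvature identity needs a vertical vector orthogonal to p, a condition that is transported
  along the ray but fails in general at other nearby points.\<close>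

lemma dd_ray_cong:
  fixes E F :: "'a::euclidean_space \<times> 'a \<Rightarrow> 'b::real_normed_vector"
  assumes "open W" "z \<in> W" "E differentiable (at z)" "F differentiable (at z)"
    and eq: "\<And>t. t > 0 \<Longrightarrow> (fst z, t *\<^sub>R snd z) \<in> W \<Longrightarrow> E (fst z, t *\<^sub>R snd z) = F (fst z, t *\<^sub>R snd z)"
  shows "dd E z (0, snd z) = dd F z (0, snd z)"
proof -
  define r where "r t = (fst z, t *\<^sub>R snd z)" for t :: real
  have r1: "r 1 = z" by (simp add: r_def)
  have r': "(r has_derivative (\<lambda>s. (0, s *\<^sub>R snd z))) (at 1)"
    unfolding r_def by (auto intro!: derivative_eq_intros)
  have d: "((\<lambda>t. H (r t)) has_derivative (\<lambda>s. dd H z (0, s *\<^sub>R snd z))) (at 1)"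
    if "H differentiable (at z)" for H :: "'a \<times> 'a \<Rightarrow> 'b"
    by (rule has_derivative_compose[OF r']) (simp add: r1 dd_works that)
  have "continuous_on UNIV r" unfolding r_def by (intro continuous_intros)
  then have "open (r -` W \<inter> {0<..})"
    using assms(1) by (intro open_Int open_vimage) auto
  moreover have "1 \<in> r -` W \<inter> {0<..}" using assms(2) by (simp add: r1)
  moreover have "E (r t) = F (r t)" if "t \<in> r -` W \<inter> {0<..}" for t
    using eq[of t] that by (simp add: r_def)
  ultimately have "((\<lambda>t. F (r t)) has_derivative (\<lambda>s. dd E z (0, s *\<^sub>R snd z))) (at 1)"
    by (rule has_derivative_transform_within_open[OF d[OF assms(3)]])
  from fun_cong[OF has_derivative_unique[OF this d[OF assms(4)]], of 1]
  show ?thesis by simp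
qed

text \<open>The traits of a Cartan metric behind the converse: \<open>N\<close> has degree 1 in p,
  \<open>GL\<close> has degree 0 up to the term -k p p of degree 2, the Liouville field is a
  gradient, and horizontal lifts of vectors killed by p commute at the point. The quantity in
  \<open>radial_pos\<close> is the factor in \<nabla>_\<xi> \<xi>.\<close>

locale radial_domain = lagrangian_domain +
  fixes k :: real and \<Psi> :: "'a \<times> 'a \<Rightarrow> real"
  assumes N_radial: "z \<in> W \<Longrightarrow> dd (\<lambda>q. N q u) z (0, snd z) = N z u"
    and GL_radial: "z \<in> W \<Longrightarrow> dd (\<lambda>q. GL q u) z (0, snd z) = - (2 * k * (snd z \<bullet> u)) *\<^sub>R snd z"
    and potential: "z \<in> W \<Longrightarrow> (\<Psi> has_derivative Gm z (0, snd z)) (at z)"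
    and N_bracket: "z \<in> W \<Longrightarrow> snd z \<bullet> u = 0 \<Longrightarrow> snd z \<bullet> w = 0 \<Longrightarrow>
      dd (\<lambda>q. N q w) z (Fr z (u, 0)) = dd (\<lambda>q. N q u) z (Fr z (w, 0))"
    and ray: "z \<in> W \<Longrightarrow> (fst z, t *\<^sub>R snd z) \<in> W \<Longrightarrow> t > 0 \<Longrightarrow> GU z (snd z) \<bullet> b = 0 \<Longrightarrow>
      GU (fst z, t *\<^sub>R snd z) (snd z) \<bullet> b = 0"
    and radial_pos: "z \<in> W \<Longrightarrow> 1 + k * (GU z (snd z) \<bullet> snd z) > 0"
begin

definition \<xi> :: "'a \<times> 'a \<Rightarrow> 'a \<times> 'a" where "\<xi> q = (0, snd q)"

lemma bounded_linear_\<xi>: "bounded_linear \<xi>"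
  unfolding \<xi>_def by (intro bounded_linear_Pair bounded_linear_zero bounded_linear_snd)

lemma smooth_\<xi>: "smooth_on W \<xi>"
  using smooth_on_bounded_linear[OF W_open bounded_linear_\<xi> smooth_on_ident] .

lemma \<xi>_Fr: "z \<in> W \<Longrightarrow> \<xi> z = Fr z (0, snd z)"
  by (simp add: \<xi>_def Fr_def op_lin)

lemma dd_potential: "z \<in> W \<Longrightarrow> dd \<Psi> z h = Gm z (\<xi> z) h"
  using dd_eqI[OF potential] by (simp add: \<xi>_def)

lemma smooth_potential: "smooth_on W \<Psi>"
proof (rule smooth_on_potential)
  show "\<Psi> differentiable (at z)" if "z \<in> W" for z
    using potential[OF that] by (rule differentiableI)
  show "smooth_on W (\<lambda>z. dd \<Psi> z v)" for v
    by (rule smooth_on_cong[OF W_open _ smooth_bifamily_apply[OF W_open G_bifamily smooth_\<xi> smooth_on_const]])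
      (rule dd_potential[symmetric])
qed

text \<open>\<open>\<xi>\<close> is the gradient of \<open>\<Psi>\<close>, so its covariant derivative is the Hessian.\<close>

lemma nabla_\<xi>_sym:
  assumes z: "z \<in> W"
  shows "Gm z (nabla X \<xi> z) (Y z) = Gm z (nabla Y \<xi> z) (X z)"
proof -
  note c = smooth_on_const
  have *: "Gm z (nabla (\<lambda>_. u) \<xi> z) v =
      dd (\<lambda>q. dd \<Psi> q v) z u - Gm z (\<xi> z) (nabla (\<lambda>_. u) (\<lambda>_. v) z)" for u v
  proof -
    have "dd (\<lambda>q. dd \<Psi> q v) z u = dd (\<lambda>q. Gm q (\<xi> q) v) z u"
      by (rule fun_cong[OF dd_cong_open[OF W_open z dd_potential]])
    then show ?thesis using nabla_metric[OF z smooth_\<xi> c[of W v], of "\<lambda>_. u"] by simp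
  qed
  have "nabla X \<xi> z = nabla (\<lambda>_. X z) \<xi> z" "nabla Y \<xi> z = nabla (\<lambda>_. Y z) \<xi> z"
    by (rule nabla_cong[OF z]; simp)+
  moreover have "nabla (\<lambda>_. X z) (\<lambda>_. Y z) z = nabla (\<lambda>_. Y z) (\<lambda>_. X z) z"
    using nabla_torsion[OF z, of "\<lambda>_. X z" "\<lambda>_. Y z"] by (simp add: lie_bracket_def)
  ultimately show ?thesis
    using dd_commute[OF W_open smooth_potential z, of "X z" "Y z"] by (simp add: *)
qed

lemma nabla_\<xi>_lie:
  assumes z: "z \<in> W" and s: "smooth_on W X" "smooth_on W Y"
  shows "2 * Gm z (nabla X \<xi> z) (Y z) = dd (\<lambda>q. Gm q (X q) (Y q)) z (\<xi> z)
    - Gm z (lie_bracket \<xi> X z) (Y z) - Gm z (X z) (lie_bracket \<xi> Y z)"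
  using nabla_metric[OF z s, of \<xi>] nabla_\<xi>_sym[OF z, of X Y]
  by (simp add: nabla_torsion[OF z, symmetric] G_lin z G_sym[OF z, of "X z"])

lemma bracket_\<xi>:
  assumes z: "z \<in> W"
  shows "lie_bracket \<xi> (\<lambda>q. Fr q x) z = Fr z (0, - snd x)"
proof -
  have "(\<lambda>q. N q (fst x)) differentiable (at z)"
    by (rule smooth_on_differentiable[OF smooth_N[OF smooth_on_const] z])
  then have "dd (\<lambda>q. Fr q x) z h = (0, dd (\<lambda>q. N q (fst x)) z h)" for h
    unfolding Fr_def by (simp add: dd_Pair dd_add)
  then show ?thesis
    by (simp add: lie_bracket_def dd_self[OF bounded_linear_\<xi>] \<xi>_def N_radial z Fr_def op_lin)
qed

lemma nabla_\<xi>: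
  assumes z: "z \<in> W"
  shows "nabla (\<lambda>q. Fr q x) \<xi> z =
    Fr z (- (k * (snd z \<bullet> fst x)) *\<^sub>R GU z (snd z), snd x + (k * (GU z (snd z) \<bullet> snd x)) *\<^sub>R snd z)"
proof (rule eq_Fr_I[OF z])
  fix y
  note sm = smooth_Fr[OF smooth_on_const]
  have "2 * Gm z (nabla (\<lambda>q. Fr q x) \<xi> z) (Fr z y) =
    - (2 * k * (snd z \<bullet> fst x)) * (snd z \<bullet> fst y)
    + 2 * k * (snd z \<bullet> GU z (snd x)) * (GU z (snd z) \<bullet> snd y) + 2 * (GU z (snd x) \<bullet> snd y)"
    unfolding nabla_\<xi>_lie[OF z sm sm] dd_Gm_Fr[OF z] bracket_\<xi>[OF z]
    unfolding Gm_Fr dd_GU[OF z] \<xi>_def GL_radial[OF z]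
    by (simp add: op_lin z)
  then show "Gm z (nabla (\<lambda>q. Fr q x) \<xi> z) (Fr z y) =
      Gm z (Fr z (- (k * (snd z \<bullet> fst x)) *\<^sub>R GU z (snd z),
        snd x + (k * (GU z (snd z) \<bullet> snd x)) *\<^sub>R snd z)) (Fr z y)"
    unfolding Gm_Fr
    by (simp add: op_lin z GL_GU GU_sym[OF z, of "snd z" "snd x"] inner_add_left algebra_simps)
qed

lemma smooth_\<eta>: "smooth_on W (\<lambda>q. GU q (snd q))"
  by (intro smooth_GU smooth_on_snd smooth_on_ident W_open)

text \<open>By \<open>nabla_\<xi>\<close> the first iterated derivative reduces to that of the frame
  field \<open>?Y\<close>, because \<open>\<xi>\<close> is orthogonal to \<open>?Z\<close> and its
  coefficient vanishes at z. The second is a multiple of the lift of \<open>GU z (snd z)\<close>,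
  which is orthogonal to \<open>w\<close>; the bracket term is vertical. In the Koszul formula for
  the remaining term only the vertical derivative of \<open>GL\<close> survives.\<close>

lemma curvature_\<xi>:
  assumes z: "z \<in> W" and u: "snd z \<bullet> u = 0" and w: "snd z \<bullet> w = 0" and b: "GU z (snd z) \<bullet> b = 0"
  shows "Gm z (curvature Gm (\<lambda>q. Fr q (u, 0)) (\<lambda>q. Fr q (0, b)) \<xi> z) (Fr z (w, 0)) =
    1/2 * (dd (\<lambda>q. GL q u) z (0, b) \<bullet> w)"
proof -
  let ?X = "\<lambda>q. Fr q (u, 0)" and ?Y = "\<lambda>q. Fr q (0, b)" and ?Z = "\<lambda>q. Fr q (w, 0)"
  note c = smooth_on_const
  note sm = smooth_Fr[OF c]
  have s1: "smooth_on W (\<lambda>q. k * (GU q (snd q) \<bullet> b))"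
    by (intro smooth_on_mult smooth_on_inner smooth_\<eta> c W_open)
  have s2: "smooth_on W (\<lambda>q. - (k * (snd q \<bullet> u)))"
    by (intro smooth_on_minus smooth_on_mult smooth_on_inner smooth_on_snd smooth_on_ident c W_open)
  have s3: "smooth_on W (\<lambda>q. Fr q (GU q (snd q), 0))"
    by (intro smooth_Fr smooth_on_Pair smooth_\<eta> c W_open)
  have xw: "Gm z (\<xi> z) (?Z z) = 0"
    unfolding \<xi>_Fr[OF z] Gm_Fr by (simp add: op_lin z)
  have vert: "Gm z (0, e) (?Z z) = 0" for e
    by (simp add: Gm_def Fr_def op_lin z)
  have "nabla ?X (nabla ?Y \<xi>) z = nabla ?X (\<lambda>q. ?Y q + (k * (GU q (snd q) \<bullet> b)) *\<^sub>R \<xi> q) z"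
    by (rule nabla_cong[OF z refl]) (simp add: nabla_\<xi> \<xi>_Fr Fr_lin(1,4)[symmetric])
  then have 1: "Gm z (nabla ?X (nabla ?Y \<xi>) z) (?Z z) = Gm z (nabla ?X ?Y z) (?Z z)"
    by (simp add: nabla_right(1)[OF z sm smooth_on_scaleR[OF W_open s1 smooth_\<xi>]]
        nabla_scaleR[OF z smooth_\<xi> s1] G_lin z xw b)
  have "nabla ?Y (nabla ?X \<xi>) z = nabla ?Y (\<lambda>q. (- (k * (snd q \<bullet> u))) *\<^sub>R Fr q (GU q (snd q), 0)) z"
    by (rule nabla_cong[OF z refl]) (simp add: nabla_\<xi> Fr_lin(3,4)[symmetric])
  then have "nabla ?Y (nabla ?X \<xi>) z = dd (\<lambda>q. - (k * (snd q \<bullet> u))) z (?Y z) *\<^sub>R Fr z (GU z (snd z), 0)"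
    unfolding nabla_scaleR[OF z s3 s2] by (simp add: u)
  then have 2: "Gm z (nabla ?Y (nabla ?X \<xi>) z) (?Z z) = 0"
    by (simp add: G_lin z Gm_Fr GL_GU w op_lin)
  obtain e where e: "lie_bracket ?X ?Y z = (0, e)"
    unfolding bracket_Fr[OF z] by blast
  have Fe: "Fr z (0, e) = (0, e)" by (simp add: Fr_def op_lin z)
  have "nabla (lie_bracket ?X ?Y) \<xi> z = nabla (\<lambda>q. Fr q (0, e)) \<xi> z"
    by (rule nabla_cong[OF z]) (simp_all add: e Fe)
  then have 3: "Gm z (nabla (lie_bracket ?X ?Y) \<xi> z) (?Z z) = 0"
    by (simp add: nabla_\<xi>[OF z] Gm_Fr op_lin z)
  have "Gm q (?Y q) (?Z q) = 0" "Gm q (?X q) (?Y q) = 0" if "q \<in> W" for q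
    by (simp_all add: Gm_Fr op_lin that)
  then have 4: "dd (\<lambda>q. Gm q (?Y q) (?Z q)) z h = 0" "dd (\<lambda>q. Gm q (?X q) (?Y q)) z h = 0" for h
    using fun_cong[OF dd_cong_open[OF W_open z, of _ "\<lambda>_. 0::real"]] by simp_all
  have XZ: "lie_bracket ?X ?Z z = 0"
    using N_bracket[OF z u w] by (simp add: bracket_Fr[OF z] zero_prod_def)
  have "Gm z (lie_bracket ?Y ?Z z) (?X z) = 0"
    unfolding bracket_Fr[OF z] by (simp add: Gm_def Fr_def op_lin z)
  then have "2 * Gm z (nabla ?X ?Y z) (?Z z) = dd (\<lambda>q. Gm q (?X q) (?Z q)) z (?Y z)"
    unfolding nabla_koszul[OF z sm sm sm] 4 XZ e by (simp add: vert G_lin z)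
  also have "\<dots> = dd (\<lambda>q. GL q u) z (0, b) \<bullet> w"
    unfolding dd_Gm_Fr[OF z] by (simp add: Fr_def op_lin z)
  finally show ?thesis
    unfolding curvature_def by (simp add: G_lin z 1 2 3)
qed

text \<open>Euler's relation in degree -1. Differentiate \<open>GL_radial\<close> in the direction
  \<open>b\<close> and exchange the derivatives; the right-hand side contributes only multiples of
  products with p, which \<open>u\<close> and \<open>w\<close> do not see.\<close>

lemma dd_GL_radial:
  assumes z: "z \<in> W" and u: "snd z \<bullet> u = 0" and w: "snd z \<bullet> w = 0"
  shows "dd (\<lambda>q. dd (\<lambda>q. GL q u) q (0, b) \<bullet> w) z (0, snd z) = - (dd (\<lambda>q. GL q u) z (0, b) \<bullet> w)"
proof -
  note sm = smooth_GL[OF smooth_on_const[of W u]]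
  have bls: "bounded_linear (\<lambda>q::'a \<times> 'a. (0::'a, snd q))"
    by (intro bounded_linear_Pair bounded_linear_zero bounded_linear_snd)
  have "dd (\<lambda>q. dd (\<lambda>q. GL q u) q (0, snd q)) z (0, b) =
    dd (\<lambda>q. dd (\<lambda>q. GL q u) q (0, snd z)) z (0, b) + dd (\<lambda>q. GL q u) z (0, b)"
    using dd_family(1)[OF W_open smooth_family_dd[OF sm] bounded_linear_imp_differentiable[OF bls] z, of "(0, b)"]
    by (simp add: dd_self[OF bls])
  moreover have "dd (\<lambda>q. dd (\<lambda>q. GL q u) q (0, snd q)) z (0, b) =
    dd (\<lambda>q. - (2 * k * (snd q \<bullet> u)) *\<^sub>R snd q) z (0, b)"
    by (rule fun_cong[OF dd_cong_open[OF W_open z GL_radial]])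
  moreover have "dd (\<lambda>q. - (2 * k * (snd q \<bullet> u)) *\<^sub>R snd q) z (0, b) \<bullet> w = 0"
  proof -
    have bl: "bounded_linear (\<lambda>q::'a \<times> 'a. - (2 * k * (snd q \<bullet> u)))"
      by (intro bounded_linear_minus bounded_linear_const_mult
          bounded_linear_compose[OF bounded_linear_inner_left] bounded_linear_snd)
    have "dd (\<lambda>q. - (2 * k * (snd q \<bullet> u)) *\<^sub>R snd q) z (0, b) =
      (- (2 * k * (snd z \<bullet> u))) *\<^sub>R b + (- (2 * k * (b \<bullet> u))) *\<^sub>R snd z"
      using dd_scaleR[OF bounded_linear_imp_differentiable[OF bl]
          bounded_linear_imp_differentiable[OF bounded_linear_snd], of z "(0, b)"]
      by (simp add: dd_self[OF bl] dd_self[OF bounded_linear_snd])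
    then show ?thesis by (simp add: u w inner_add_left)
  qed
  ultimately have "dd (\<lambda>q. dd (\<lambda>q. GL q u) q (0, snd z)) z (0, b) \<bullet> w = - (dd (\<lambda>q. GL q u) z (0, b) \<bullet> w)"
    by (simp add: eq_neg_iff_add_eq_0 inner_add_left)
  moreover have "dd (\<lambda>q. dd (\<lambda>q. GL q u) q (0, b) \<bullet> w) z h = dd (\<lambda>q. dd (\<lambda>q. GL q u) q (0, b)) z h \<bullet> w" for h
    by (rule dd_bounded_linear[OF bounded_linear_inner_left smooth_on_differentiable[OF smooth_on_deriv[OF sm] z]])
  ultimately show ?thesis
    using dd_commute[OF W_open sm z, of "(0, b)" "(0, snd z)"] by simp
qed

lemma locally_symmetric_imp:
  assumes sym: "locally_symmetric_on W Gm" and z: "z \<in> W"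
    and u: "snd z \<bullet> u = 0" and w: "snd z \<bullet> w = 0" and b: "GU z (snd z) \<bullet> b = 0"
  shows "dd (\<lambda>q. GL q u) z (0, b) \<bullet> w = 0"
proof -
  let ?X = "\<lambda>q. Fr q (u, 0)" and ?Y = "\<lambda>q. Fr q (0, b)" and ?Z = "\<lambda>q. Fr q (w, 0)"
  note c = smooth_on_const
  note sm = smooth_Fr[OF c]
  define C where "C = curvature Gm ?X ?Y \<xi>"
  define E where "E q = Gm q (C q) (?Z q)" for q
  define F where "F q = 1/2 * (dd (\<lambda>q. GL q u) q (0, b) \<bullet> w)" for q
  have C: "smooth_on W C" unfolding C_def by (rule curvature_smooth[OF sm sm smooth_\<xi>])
  have E: "smooth_on W E" unfolding E_def by (rule smooth_bifamily_apply[OF W_open G_bifamily C sm])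
  have Fs: "smooth_on W (\<lambda>q. dd (\<lambda>q. GL q u) q (0, b) \<bullet> w)"
    by (intro smooth_on_inner smooth_on_deriv smooth_GL c W_open)
  have F: "smooth_on W F" unfolding F_def by (intro smooth_on_mult Fs c W_open)
  have EF: "E q = F q" if "q = (fst z, t *\<^sub>R snd z)" "t > 0" "q \<in> W" for q t
  proof -
    have "GU q (snd q) \<bullet> b = t * (GU (fst z, t *\<^sub>R snd z) (snd z) \<bullet> b)"
      using that op_lin(14)[OF that(3)] by simp
    also have "\<dots> = 0" using ray[OF z _ that(2) b] that by simp
    finally have "GU q (snd q) \<bullet> b = 0" .
    then show ?thesis
      unfolding E_def F_def C_def using curvature_\<xi>[OF that(3)] that(1) u w by simp
  qed
  have Ez: "E z = F z" using EF[of z 1] z by simp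
  have "dd E z (0, snd z) = dd F z (0, snd z)"
    by (rule dd_ray_cong[OF W_open z smooth_on_differentiable[OF E z] smooth_on_differentiable[OF F z]])
      (use EF in blast)
  also have "\<dots> = - F z"
    unfolding F_def using dd_mult[of "\<lambda>_. 1/2::real", OF _ smooth_on_differentiable[OF Fs z], of "(0, snd z)"]
    by (simp add: dd_GL_radial[OF z u w])
  finally have dE: "dd E z (\<xi> z) = - E z" by (simp add: \<xi>_def Ez)
  \<comment> \<open>Torsion freeness expresses the derivative along \<open>\<xi>\<close> by the
    known \<open>nabla_\<xi>\<close> and \<open>bracket_\<xi>\<close>. For coefficients orthogonal
    to p the two contributions cancel, so the three frame fields are parallel along
    \<open>\<xi>\<close> at z.\<close>
  have nx: "nabla \<xi> (\<lambda>q. Fr q x) z = nabla (\<lambda>q. Fr q x) \<xi> z + lie_bracket \<xi> (\<lambda>q. Fr q x) z" for x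
    using nabla_torsion[OF z, of \<xi> "\<lambda>q. Fr q x"] by (simp add: algebra_simps)
  have nX: "nabla \<xi> ?X z = 0" and nY: "nabla \<xi> ?Y z = 0" and nZ: "nabla \<xi> ?Z z = 0"
    unfolding nx nabla_\<xi>[OF z] bracket_\<xi>[OF z] by (simp_all add: u w b Fr_def op_lin z zero_prod_def)
  have "nabla \<xi> \<xi> z = nabla (\<lambda>q. Fr q (0, snd z)) \<xi> z"
    by (rule nabla_cong[OF z]) (simp_all add: \<xi>_Fr[OF z])
  then have nxi: "nabla \<xi> \<xi> z = (1 + k * (GU z (snd z) \<bullet> snd z)) *\<^sub>R \<xi> z"
    unfolding nabla_\<xi>[OF z] by (simp add: \<xi>_def Fr_def op_lin z algebra_simps)
  have R0: "Rm z 0 v v' = 0" "Rm z v 0 v' = 0" for v v'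
    using linear_0[OF smooth_family_linear[OF Rm_family(1) z]]
      linear_0[OF smooth_family_linear[OF Rm_family(2) z]] by simp_all
  note ns = nabla_smooth[OF smooth_\<xi> sm] nabla_smooth[OF smooth_\<xi> smooth_\<xi>]
  \<comment> \<open>Of the correction terms of \<nabla>R only the one that differentiates the
    argument \<open>\<xi>\<close> is nonzero.\<close>
  have "0 = nabla_curvature Gm \<xi> ?X ?Y \<xi> z"
    using sym z smooth_\<xi> sm unfolding locally_symmetric_on_def by simp
  also have "\<dots> = nabla \<xi> C z - (1 + k * (GU z (snd z) \<bullet> snd z)) *\<^sub>R C z"
    unfolding nabla_curvature_def C_def
    by (simp add: curvature_eq_Rm[OF z] ns sm smooth_\<xi> nX nY R0 nxi
        linear_cmul[OF smooth_family_linear[OF Rm_family(3) z]])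
  finally have "nabla \<xi> C z = (1 + k * (GU z (snd z) \<bullet> snd z)) *\<^sub>R C z" by simp
  moreover have "dd E z (\<xi> z) = Gm z (nabla \<xi> C z) (?Z z)"
    unfolding E_def nabla_metric[OF z C sm] nZ by (simp add: G_lin z)
  ultimately have "- E z = (1 + k * (GU z (snd z) \<bullet> snd z)) * E z"
    using dE by (simp add: G_lin z E_def)
  then have "(1 + k * (GU z (snd z) \<bullet> snd z)) * E z + E z = 0" by simp
  then have "(1 + (1 + k * (GU z (snd z) \<bullet> snd z))) * E z = 0" by (simp only: distrib_right)
  then have "E z = 0"
    using radial_pos[OF z] by simp
  then show ?thesis using Ez by (simp add: F_def)
qed

end

section \<open>Cartan geometry in an induced chart\<close>

lemma vec_expansion: "(u::real^'n) = (\<Sum>i\<in>UNIV. (u $ i) *\<^sub>R axis i 1)"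
  using basis_expansion[of u] by (simp add: scalar_mult_eq_scaleR)

lemma vec_linear_sum:
  fixes f :: "real^'n::finite \<Rightarrow> 'b::real_vector"
  assumes "linear f"
  shows "f u = (\<Sum>i\<in>UNIV. (u $ i) *\<^sub>R f (axis i 1))"
  by (subst vec_expansion[of u]) (simp add: linear_sum[OF assms] linear_cmul[OF assms])

lemma vec_linear_ext:
  fixes f g :: "real^'n::finite \<Rightarrow> 'b::real_vector"
  assumes "linear f" "linear g" "\<And>i. f (axis i 1) = g (axis i 1)"
  shows "f u = g u"
  unfolding vec_linear_sum[OF assms(1), of u] vec_linear_sum[OF assms(2), of u] by (simp add: assms(3))

text \<open>Passes from an index identity, the form in which Christoffel symbols and the curvature
  hypothesis are given, to an identity for arbitrary vectors.\<close>

lemma vec_trilinear_ext: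
  fixes f g :: "real^'n::finite \<Rightarrow> real^'n \<Rightarrow> real^'n \<Rightarrow> real"
  assumes "\<And>u v. linear (f u v)" "\<And>u w. linear (\<lambda>v. f u v w)" "\<And>v w. linear (\<lambda>u. f u v w)"
    and "\<And>u v. linear (g u v)" "\<And>u w. linear (\<lambda>v. g u v w)" "\<And>v w. linear (\<lambda>u. g u v w)"
    and eq: "\<And>i j k. f (axis i 1) (axis j 1) (axis k 1) = g (axis i 1) (axis j 1) (axis k 1)"
  shows "f u v w = g u v w"
proof -
  have 1: "f (axis i 1) (axis j 1) w = g (axis i 1) (axis j 1) w" for i j w
    by (rule vec_linear_ext[OF assms(1,4)]) (rule eq)
  have 2: "f (axis i 1) v w = g (axis i 1) v w" for i v w
    by (rule vec_linear_ext[OF assms(2,5)]) (rule 1)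
  show ?thesis
    by (rule vec_linear_ext[OF assms(3,6)]) (rule 2)
qed

text \<open>
  \<open>matop\<close> contracts the first index, as \<open>delta_p\<close>, \<open>GG\<close> and \<open>JJ\<close> do, so that these agree with their operator
  forms even at points where the matrices are not known to be symmetric.
\<close>

definition matop :: "('n \<Rightarrow> 'n \<Rightarrow> 'z \<Rightarrow> real) \<Rightarrow> 'z \<Rightarrow> real^'n::finite \<Rightarrow> real^'n" where
  "matop M z u = (\<chi> j. \<Sum>i\<in>UNIV. M i j z * u $ i)"

lemma matop_linear: "linear (matop M z)"
  by (rule linearI) (simp_all add: matop_def vec_eq_iff algebra_simps sum.distrib sum_distrib_left)

lemma matop_axis: "matop M z (axis i 1) \<bullet> axis j 1 = M i j z"
  by (simp add: matop_def inner_axis) (simp add: axis_def if_distrib cong: if_cong)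

lemma matop_inner: "matop M z u \<bullet> v = (\<Sum>i\<in>UNIV. \<Sum>j\<in>UNIV. M i j z * u $ i * v $ j)"
  by (subst sum.swap) (simp add: matop_def inner_vec_def sum_distrib_right)

lemma matop_family:
  assumes "open S" "\<And>i j. smooth_on S (M i j)"
  shows "smooth_family S (matop M)"
  unfolding smooth_family_def
proof (intro conjI ballI allI matop_linear)
  show "smooth_on S (\<lambda>z. matop M z v)" for v
    unfolding matop_def using assms
    by (intro smooth_on_vec smooth_on_sum smooth_on_mult smooth_on_const) auto
qed

text \<open>Both blocks of the metric are rank one perturbations of the fundamental tensor or its
  inverse.\<close>

lemma matop_rank_one:
  assumes "\<And>i j. M i j z = r * M' i j z + s * p $ i * q $ j"
  shows "matop M z u = r *\<^sub>R matop M' z u + (s * (p \<bullet> u)) *\<^sub>R q"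
proof (subst vec_eq_iff, intro allI)
  fix j
  have "matop M z u $ j = (\<Sum>i\<in>UNIV. r * (M' i j z * u $ i) + s * (p $ i * u $ i) * q $ j)"
    unfolding matop_def assms by (simp add: algebra_simps)
  also have "\<dots> = r * (\<Sum>i\<in>UNIV. M' i j z * u $ i) + s * (\<Sum>i\<in>UNIV. p $ i * u $ i) * q $ j"
    by (simp only: sum.distrib sum_distrib_left sum_distrib_right)
  finally show "matop M z u $ j = (r *\<^sub>R matop M' z u + (s * (p \<bullet> u)) *\<^sub>R q) $ j"
    by (simp add: matop_def inner_vec_def)
qed

lemma smooth_on_det:
  fixes M :: "'a::euclidean_space \<Rightarrow> real^'n^'n"
  assumes "open S" "\<And>i j. smooth_on S (\<lambda>z. M z $ i $ j)"
  shows "smooth_on S (\<lambda>z. det (M z))"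
  unfolding det_def using assms
  by (intro smooth_on_sum smooth_on_mult smooth_on_prod smooth_on_const) auto

lemma matrix_inv_left: "invertible (M::real^'n^'n) \<Longrightarrow> matrix_inv M ** M = mat 1"
  and matrix_inv_right: "invertible (M::real^'n^'n) \<Longrightarrow> M ** matrix_inv M = mat 1"
  unfolding invertible_def matrix_inv_def by (metis (mono_tags, lifting) someI_ex)+

text \<open>Cramer's rule: each entry of the inverse is a quotient of two determinants, and these
  are polynomials in the entries. \<open>C\<close> is the matrix with column \<open>i\<close>
  replaced by the unit vector \<open>j\<close>.\<close>

lemma smooth_on_matrix_inv:
  fixes M :: "'a::euclidean_space \<Rightarrow> real^'n^'n"
  assumes "open S" "\<And>i j. smooth_on S (\<lambda>z. M z $ i $ j)" "\<And>z. z \<in> S \<Longrightarrow> invertible (M z)"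
  shows "smooth_on S (\<lambda>z. matrix_inv (M z) $ i $ j)"
proof -
  define C where "C z = (\<chi> k l. if l = i then axis j 1 $ k else M z $ k $ l)" for z
  have "smooth_on S (\<lambda>z. det (C z) / det (M z))"
  proof (intro smooth_on_divide smooth_on_det assms)
    show "smooth_on S (\<lambda>z. C z $ k $ l)" for k l
      using assms(2)[of k l] smooth_on_const by (cases "l = i") (auto simp: C_def)
    show "det (M z) \<noteq> 0" if "z \<in> S" for z
      using assms(3)[OF that] by (simp add: invertible_det_nz)
  qed
  then show ?thesis
  proof (rule smooth_on_cong[OF assms(1), rotated])
    fix z assume z: "z \<in> S"
    have "M z *v (matrix_inv (M z) *v axis j 1) = axis j 1"
      using assms(3)[OF z] by (simp add: matrix_vector_mul_assoc matrix_inv_right)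
    then have "matrix_inv (M z) *v axis j 1 =
        (\<chi> l. det (\<chi> k l'. if l' = l then axis j 1 $ k else M z $ k $ l') / det (M z))"
      using cramer[of "M z"] assms(3)[OF z] by (simp add: invertible_det_nz)
    then have "(matrix_inv (M z) *v axis j 1) $ i = det (C z) / det (M z)"
      by (simp add: C_def)
    moreover have "(matrix_inv (M z) *v axis j 1) $ i = matrix_inv (M z) $ i $ j"
      by (simp add: matrix_vector_mult_basis column_def)
    ultimately show "det (C z) / det (M z) = matrix_inv (M z) $ i $ j" by simp
  qed
qed

section \<open>The fundamental tensor in an induced chart\<close>

locale cartan_chart =
  fixes U :: "(real^'n::finite) set" and L :: "'n phase \<Rightarrow> real" and c :: real
  assumes open_U: "open U"
    and smooth_L: "smooth_on (U \<times> - {0}) L"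
    and hom_L: "z \<in> U \<times> - {0} \<Longrightarrow> t > 0 \<Longrightarrow> L (fst z, t *\<^sub>R snd z) = t * L z"
    and pos_g: "z \<in> U \<times> - {0} \<Longrightarrow> \<zeta> \<noteq> 0 \<Longrightarrow>
      (\<Sum>i\<in>UNIV. \<Sum>j\<in>UNIV. g_up L z $ i $ j * \<zeta> $ i * \<zeta> $ j) > 0"
    and curv: "z \<in> U \<times> - {0} \<Longrightarrow>
      R_curv L k i j z = c * (g_low L z $ j $ k * snd z $ i - g_low L z $ i $ k * snd z $ j)"
begin

definition S :: "'n phase set" where "S = U \<times> - {0}"

definition h :: "'n phase \<Rightarrow> real" where "h w = (L w)\<^sup>2"

definition gU :: "'n phase \<Rightarrow> real^'n \<Rightarrow> real^'n" where "gU = matop (\<lambda>i j z. g_up L z $ i $ j)"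

definition gL :: "'n phase \<Rightarrow> real^'n \<Rightarrow> real^'n" where "gL = matop (\<lambda>i j z. g_low L z $ i $ j)"

definition NN :: "'n phase \<Rightarrow> real^'n \<Rightarrow> real^'n" where "NN = matop (nonlin L)"

text \<open>The formal Christoffel symbols of g(x,p), with p held fixed in the differentiation, as a
  bilinear map.\<close>

definition AA :: "'n phase \<Rightarrow> real^'n \<Rightarrow> real^'n \<Rightarrow> real^'n" where
  "AA z u v = (\<chi> i. \<Sum>j\<in>UNIV. \<Sum>k\<in>UNIV. gam L i j k z * u $ j * v $ k)"

lemma open_S: "open S"
  unfolding S_def by (intro open_Times open_U) auto

lemma scale_S: "z \<in> S \<Longrightarrow> t > 0 \<Longrightarrow> (fst z, t *\<^sub>R snd z) \<in> S"
  by (auto simp: S_def)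

lemma smooth_h: "smooth_on S h"
  unfolding h_def by (rule smooth_on_power[OF open_S]) (unfold S_def, rule smooth_L)

lemma dd_vert_sum:
  assumes "F differentiable (at z)"
  shows "dd F z (0, a) = (\<Sum>i\<in>UNIV. a $ i * dp i F z)"
proof -
  have "linear (\<lambda>a. dd F z (0, a))"
  proof (rule linearI)
    show "dd F z (0, a + b) = dd F z (0, a) + dd F z (0, b)" for a b
      using linear_add[OF dd_linear[OF assms], of "(0, a)" "(0, b)"] by simp
    show "dd F z (0, r *\<^sub>R a) = r *\<^sub>R dd F z (0, a)" for r a
      using linear_cmul[OF dd_linear[OF assms], of r "(0, a)"] by simp
  qed
  then show ?thesis using vec_linear_sum[of "\<lambda>a. dd F z (0, a)" a] by (simp add: dp_def)
qed

lemma smooth_dp: "smooth_on S F \<Longrightarrow> smooth_on S (dp i F)"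
  and smooth_dx: "smooth_on S F \<Longrightarrow> smooth_on S (dx i F)"
  unfolding dp_def[abs_def] dx_def[abs_def] by (rule smooth_on_deriv, assumption)+

lemma smooth_g_up: "smooth_on S (\<lambda>z. g_up L z $ i $ j)"
proof -
  have "smooth_on S (\<lambda>z. 1/2 * dp i (dp j h) z)"
    by (intro smooth_on_mult smooth_on_const open_S smooth_dp smooth_h)
  then show ?thesis unfolding g_up_def h_def[abs_def] by simp
qed

lemma gU_hessian:
  assumes z: "z \<in> S"
  shows "gU z a \<bullet> b = 1/2 * dd (\<lambda>q. dd h q (0, b)) z (0, a)"
proof -
  note dif = smooth_on_differentiable[OF smooth_on_deriv[OF smooth_h] z]
  have "dd (\<lambda>q. dd h q (0, b)) z (0, a) = dd (\<lambda>q. \<Sum>j\<in>UNIV. b $ j * dp j h q) z (0, a)"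
    by (rule fun_cong[OF dd_cong_open[OF open_S z]])
      (rule dd_vert_sum[OF smooth_on_differentiable[OF smooth_h]])
  also have "\<dots> = (\<Sum>j\<in>UNIV. b $ j * dd (dp j h) z (0, a))"
    using smooth_on_differentiable[OF smooth_dp[OF smooth_h] z]
    by (simp add: dd_sum dd_mult differentiable_bilinear[OF bounded_bilinear_mult])
  also have "\<dots> = (\<Sum>j\<in>UNIV. \<Sum>i\<in>UNIV. b $ j * (a $ i * dp i (dp j h) z))"
    using smooth_on_differentiable[OF smooth_dp[OF smooth_h] z]
    by (simp add: dd_vert_sum sum_distrib_left)
  finally show ?thesis
    unfolding gU_def matop_inner
    by (subst sum.swap) (simp add: g_up_def h_def[abs_def] sum_distrib_left mult.commute mult.left_commute)
qed

lemma gU_sym: "z \<in> S \<Longrightarrow> gU z a \<bullet> b = a \<bullet> gU z b"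
  using dd_commute[OF open_S smooth_h, of z "(0, b)" "(0, a)"] gU_hessian[of z a b] gU_hessian[of z b a]
  by (simp add: inner_commute)

lemma g_up_sym: "z \<in> S \<Longrightarrow> g_up L z $ i $ j = g_up L z $ j $ i"
  using gU_sym[of z "axis i 1" "axis j 1"]
    matop_axis[of "\<lambda>i j z. g_up L z $ i $ j" z i j] matop_axis[of "\<lambda>i j z. g_up L z $ i $ j" z j i]
  by (simp add: gU_def inner_commute)

lemma gU_mult: "z \<in> S \<Longrightarrow> gU z a = g_up L z *v a"
  by (simp add: gU_def matop_def matrix_vector_mult_def vec_eq_iff g_up_sym[of z])

lemma gU_pos: "z \<in> S \<Longrightarrow> a \<noteq> 0 \<Longrightarrow> gU z a \<bullet> a > 0"
  using pos_g[of z a] by (simp add: gU_def matop_inner S_def)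

lemma g_up_invertible:
  assumes z: "z \<in> S"
  shows "invertible (g_up L z)"
proof -
  have "inj ((*v) (g_up L z))"
  proof (rule injI)
    fix a b assume "g_up L z *v a = g_up L z *v b"
    then have "gU z (a - b) = 0" by (simp add: gU_mult[OF z] matrix_vector_mult_diff_distrib)
    then show "a = b" using gU_pos[OF z, of "a - b"] by force
  qed
  then show ?thesis
    by (simp add: invertible_left_inverse matrix_left_invertible_injective)
qed

lemma g_low_sym:
  assumes z: "z \<in> S"
  shows "g_low L z $ i $ j = g_low L z $ j $ i"
proof -
  have t: "transpose (g_up L z) = g_up L z"
    by (simp add: transpose_def vec_eq_iff g_up_sym[OF z])
  note inv = g_up_invertible[OF z]
  have "g_up L z ** transpose (g_low L z) = transpose (g_low L z ** g_up L z)"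
    by (simp add: matrix_transpose_mul t)
  also have "\<dots> = mat 1" by (simp add: g_low_def matrix_inv_left[OF inv] transpose_mat)
  finally have "g_low L z ** (g_up L z ** transpose (g_low L z)) = g_low L z" by simp
  then have "transpose (g_low L z) = g_low L z"
    by (simp add: matrix_mul_assoc g_low_def matrix_inv_left[OF inv])
  then have "transpose (g_low L z) $ j $ i = g_low L z $ j $ i" by simp
  then show ?thesis by (simp add: transpose_def)
qed

lemma gL_mult: "z \<in> S \<Longrightarrow> gL z a = g_low L z *v a"
  by (simp add: gL_def matop_def matrix_vector_mult_def vec_eq_iff g_low_sym[of z])

lemma gL_gU: "z \<in> S \<Longrightarrow> gL z (gU z a) = a" and gU_gL: "z \<in> S \<Longrightarrow> gU z (gL z a) = a"
  by (simp_all add: gL_mult gU_mult matrix_vector_mul_assoc g_low_def matrix_inv_left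
      matrix_inv_right g_up_invertible)

lemma gL_sym: "z \<in> S \<Longrightarrow> gL z u \<bullet> v = u \<bullet> gL z v"
  using gU_sym[of z "gL z u" "gL z v"] by (simp add: gU_gL)

lemma smooth_g_low: "smooth_on S (\<lambda>z. g_low L z $ i $ j)"
  unfolding g_low_def by (intro smooth_on_matrix_inv open_S smooth_g_up g_up_invertible)

lemma gU_family: "smooth_family S gU" and gL_family: "smooth_family S gL"
  unfolding gU_def gL_def by (intro matop_family open_S smooth_g_up smooth_g_low)+

lemma smooth_gam: "smooth_on S (gam L i j k)"
proof -
  have "smooth_on S (\<lambda>z. 1/2 * (\<Sum>s\<in>UNIV. g_up L z $ i $ s *
     (dx k (\<lambda>w. g_low L w $ j $ s) z + dx j (\<lambda>w. g_low L w $ s $ k) z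
      - dx s (\<lambda>w. g_low L w $ j $ k) z)))"
    by (intro smooth_on_mult smooth_on_sum smooth_on_add smooth_on_diff smooth_on_const smooth_g_up
        smooth_dx smooth_g_low open_S)
  then show ?thesis by (simp add: gam_def[abs_def])
qed

lemma smooth_gam_o: "smooth_on S (gam_o L j k)"
proof -
  have "smooth_on S (\<lambda>z. \<Sum>i\<in>UNIV. gam L i j k z * snd z $ i)"
    by (intro smooth_on_mult smooth_on_sum smooth_gam smooth_on_nth smooth_on_snd smooth_on_ident open_S)
  then show ?thesis by (simp add: gam_o_def[abs_def])
qed

lemma smooth_p_up: "smooth_on S (p_up L i)"
proof -
  have "smooth_on S (\<lambda>z. \<Sum>j\<in>UNIV. g_up L z $ i $ j * snd z $ j)"
    by (intro smooth_on_mult smooth_on_sum smooth_g_up smooth_on_nth smooth_on_snd smooth_on_ident open_S)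
  then show ?thesis by (simp add: p_up_def[abs_def])
qed

lemma smooth_gam_oo: "smooth_on S (gam_oo L j)"
proof -
  have "smooth_on S (\<lambda>z. \<Sum>k\<in>UNIV. gam_o L j k z * p_up L k z)"
    by (intro smooth_on_mult smooth_on_sum smooth_gam_o smooth_p_up open_S)
  then show ?thesis by (simp add: gam_oo_def[abs_def])
qed

lemma smooth_nonlin: "smooth_on S (nonlin L i j)"
proof -
  have "smooth_on S (\<lambda>z. gam_o L i j z
     - 1/2 * (\<Sum>h\<in>UNIV. gam_oo L h z * dp h (\<lambda>w. g_low L w $ i $ j) z))"
    by (intro smooth_on_mult smooth_on_sum smooth_on_diff smooth_on_const smooth_gam_o smooth_gam_oo
        smooth_dp smooth_g_low open_S)
  then show ?thesis by (simp add: nonlin_def[abs_def])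
qed

lemma NN_family: "smooth_family S NN"
  unfolding NN_def by (intro matop_family open_S smooth_nonlin)

section \<open>Homogeneity in the fibre coordinate\<close>

definition scale :: "real \<Rightarrow> 'n phase \<Rightarrow> 'n phase" where "scale t z = (fst z, t *\<^sub>R snd z)"

definition hom :: "nat \<Rightarrow> ('n phase \<Rightarrow> 'b::real_normed_vector) \<Rightarrow> bool" where
  "hom m F \<longleftrightarrow> (\<forall>z\<in>S. \<forall>t>0. F (scale t z) = t ^ m *\<^sub>R F z)"

lemma bounded_linear_scale: "bounded_linear (scale t)"
  unfolding scale_def
  by (intro bounded_linear_Pair bounded_linear_fst bounded_linear_scaleR_right[THEN bounded_linear_compose]
      bounded_linear_snd)

lemma scale_in_S: "z \<in> S \<Longrightarrow> t > 0 \<Longrightarrow> scale t z \<in> S"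
  unfolding scale_def by (rule scale_S)

text \<open>The direction \<open>v\<close> is scaled in its fibre part too, so one formula covers
  both cases: vertical derivatives lose one degree, those along the base keep it.\<close>

lemma hom_dd:
  assumes F: "smooth_on S F" "hom m F" and z: "z \<in> S" and t: "t > 0"
  shows "dd F (scale t z) (scale t v) = t ^ m *\<^sub>R dd F z v"
proof -
  have "((\<lambda>q. F (scale t q)) has_derivative (\<lambda>v. dd F (scale t z) (scale t v))) (at z)"
    by (rule has_derivative_compose[OF bounded_linear_imp_has_derivative[OF bounded_linear_scale]
          dd_works[OF smooth_on_differentiable[OF F(1) scale_in_S[OF z t]]]])
  then have "dd (\<lambda>q. F (scale t q)) z v = dd F (scale t z) (scale t v)"
    by (simp add: dd_eqI)
  moreover have "dd (\<lambda>q. F (scale t q)) z v = dd (\<lambda>q. t ^ m *\<^sub>R F q) z v"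
    by (rule fun_cong[OF dd_cong_open[OF open_S z]]) (use F(2) t in \<open>simp add: hom_def\<close>)
  ultimately show ?thesis
    using dd_bounded_linear[OF bounded_linear_scaleR_right smooth_on_differentiable[OF F(1) z]]
    by metis
qed

lemma hom_euler:
  assumes F: "smooth_on S F" "hom m F" and z: "z \<in> S"
  shows "dd F z (0, snd z) = real m *\<^sub>R F z"
proof -
  have s1: "scale 1 z = z" by (simp add: scale_def)
  have "((\<lambda>t. scale t z) has_derivative (\<lambda>s. (0, s *\<^sub>R snd z))) (at 1)"
    unfolding scale_def by (auto intro!: derivative_eq_intros)
  then have 1: "((\<lambda>t. F (scale t z)) has_derivative (\<lambda>s. dd F z (0, s *\<^sub>R snd z))) (at 1)"
    by (rule has_derivative_compose) (simp add: s1 dd_works smooth_on_differentiable[OF F(1) z])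
  have "((\<lambda>t. t ^ m *\<^sub>R F z) has_derivative (\<lambda>s. (real m * s) *\<^sub>R F z)) (at 1)"
    by (auto intro!: derivative_eq_intros)
  then have "((\<lambda>t. F (scale t z)) has_derivative (\<lambda>s. (real m * s) *\<^sub>R F z)) (at 1)"
    by (rule has_derivative_transform_within_open[of _ _ _ _ "{0<..}"])
      (use F(2) z in \<open>auto simp: hom_def\<close>)
  from fun_cong[OF has_derivative_unique[OF 1 this], of 1] show ?thesis by simp
qed

lemma hom_h: "hom 2 h"
  by (auto simp: hom_def h_def scale_def S_def hom_L power_mult_distrib)

lemma hom_dh: "hom 1 (\<lambda>q. dd h q (0, b))"
  unfolding hom_def
proof (intro ballI allI impI)
  fix z and t :: real assume z: "z \<in> S" and t: "t > 0"
  have "(0, t *\<^sub>R b) = t *\<^sub>R (0::real^'n, b)" by simp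
  then have "dd h (scale t z) (scale t (0, b)) = t * dd h (scale t z) (0, b)"
    using linear_cmul[OF dd_linear[OF smooth_on_differentiable[OF smooth_h scale_in_S[OF z t]]]]
    by (simp add: scale_def del: scaleR_Pair)
  then show "dd h (scale t z) (0, b) = t ^ 1 *\<^sub>R dd h z (0, b)"
    using hom_dd[OF smooth_h hom_h z t, of "(0, b)"] t by (simp add: power2_eq_square)
qed

lemma gU_snd: "z \<in> S \<Longrightarrow> gU z (snd z) \<bullet> b = 1/2 * dd h z (0, b)"
  unfolding gU_hessian by (simp add: hom_euler[OF smooth_on_deriv[OF smooth_h] hom_dh])

lemma gU_snd_snd: "z \<in> S \<Longrightarrow> gU z (snd z) \<bullet> snd z = h z"
  by (simp add: gU_snd hom_euler[OF smooth_h hom_h])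

lemma hom_gU: "z \<in> S \<Longrightarrow> t > 0 \<Longrightarrow> gU (scale t z) a = gU z a"
proof (rule vector_eq_rdot[THEN iffD1], rule allI)
  fix b assume z: "z \<in> S" and t: "t > 0"
  let ?F = "\<lambda>q. dd h q (0, b)"
  have "dd ?F (scale t z) (0, t *\<^sub>R a) = t * dd ?F (scale t z) (0, a)"
    using linear_cmul[OF dd_linear[OF smooth_on_differentiable[OF smooth_on_deriv[OF smooth_h, of "(0, b)"]
            scale_in_S[OF z t]]], of t "(0, a)"] by simp
  then have "dd ?F (scale t z) (0, a) = dd ?F z (0, a)"
    using hom_dd[OF smooth_on_deriv[OF smooth_h, of "(0, b)"] hom_dh z t, of "(0, a)"] t
    by (simp add: scale_def)
  then show "gU (scale t z) a \<bullet> b = gU z a \<bullet> b"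
    using gU_hessian[OF z, of a b] gU_hessian[OF scale_in_S[OF z t], of a b] by simp
qed

lemma hom_gL: "z \<in> S \<Longrightarrow> t > 0 \<Longrightarrow> gL (scale t z) u = gL z u"
  using gL_gU[OF scale_in_S, of z t "gL z u"] hom_gU[of z t "gL z u"] gU_gL[of z u] by simp

lemma smooth_gU: "smooth_on S X \<Longrightarrow> smooth_on S (\<lambda>z. gU z (X z))"
  and smooth_gL: "smooth_on S X \<Longrightarrow> smooth_on S (\<lambda>z. gL z (X z))"
  using smooth_family_apply[OF open_S gU_family] smooth_family_apply[OF open_S gL_family] by blast+

lemmas smooth_gU_const = smooth_gU[OF smooth_on_const]
lemmas smooth_gL_const = smooth_gL[OF smooth_on_const]
lemmas gU_differentiable = smooth_on_differentiable[OF smooth_gU_const]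
lemmas gL_differentiable = smooth_on_differentiable[OF smooth_gL_const]

lemma dd_gU_radial: "z \<in> S \<Longrightarrow> dd (\<lambda>q. gU q a) z (0, snd z) = 0"
  and dd_gL_radial: "z \<in> S \<Longrightarrow> dd (\<lambda>q. gL q a) z (0, snd z) = 0"
  using hom_euler[of "\<lambda>q. gU q a" 0 z] hom_euler[of "\<lambda>q. gL q a" 0 z]
  by (simp_all add: smooth_gU_const smooth_gL_const hom_def hom_gU hom_gL)

lemma g_lin:
  "gU z (a + b) = gU z a + gU z b" "gU z (a - b) = gU z a - gU z b" "gU z (- a) = - gU z a"
  "gU z (r *\<^sub>R a) = r *\<^sub>R gU z a" "gU z 0 = 0"
  "gL z (a + b) = gL z a + gL z b" "gL z (a - b) = gL z a - gL z b" "gL z (- a) = - gL z a"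
  "gL z (r *\<^sub>R a) = r *\<^sub>R gL z a" "gL z 0 = 0"
  unfolding gU_def gL_def
  by (simp_all add: linear_add[OF matop_linear] linear_diff[OF matop_linear]
      linear_neg[OF matop_linear] linear_cmul[OF matop_linear] linear_0[OF matop_linear])

lemma dd_gL:
  assumes z: "z \<in> S"
  shows "dd (\<lambda>q. gL q u) z v = - gL z (dd (\<lambda>q. gU q (gL z u)) z v)"
proof -
  have "dd (\<lambda>q. gU q (gL q u)) z v = dd (\<lambda>q. u) z v"
    by (rule fun_cong[OF dd_cong_open[OF open_S z]]) (rule gU_gL)
  then have "gU z (dd (\<lambda>q. gL q u) z v) = - dd (\<lambda>q. gU q (gL z u)) z v"
    using dd_family(1)[OF open_S gU_family gL_differentiable[OF z] z, of u v]
    by (simp add: eq_neg_iff_add_eq_0 add.commute)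
  then show ?thesis using gL_gU[OF z] gU_gL[OF z] by (metis g_lin(8) gL_gU z)
qed

text \<open>This is -2 times the Cartan tensor (\<open>cartan_tensor_T\<close>), taken as vertical
  derivative of the fundamental tensor. As half a third derivative of K^2 it is totally symmetric;
  \<open>T_sym1\<close> and \<open>T_sym2\<close> generate all permutations.\<close>

definition T :: "'n phase \<Rightarrow> real^'n \<Rightarrow> real^'n \<Rightarrow> real^'n \<Rightarrow> real" where
  "T z a b d = dd (\<lambda>q. gU q a) z (0, d) \<bullet> b"

lemma T_hessian:
  assumes z: "z \<in> S"
  shows "T z a b d = 1/2 * dd (\<lambda>q. dd (\<lambda>r. dd h r (0, b)) q (0, a)) z (0, d)"
proof -
  have "T z a b d = dd (\<lambda>q. gU q a \<bullet> b) z (0, d)"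
    unfolding T_def using dd_bounded_linear[OF bounded_linear_inner_left gU_differentiable[OF z]]
    by metis
  also have "\<dots> = dd (\<lambda>q. 1/2 * dd (\<lambda>r. dd h r (0, b)) q (0, a)) z (0, d)"
    by (rule fun_cong[OF dd_cong_open[OF open_S z]]) (rule gU_hessian)
  also have "\<dots> = 1/2 * dd (\<lambda>q. dd (\<lambda>r. dd h r (0, b)) q (0, a)) z (0, d)"
    using dd_mult[of "\<lambda>_. 1/2::real", OF _ smooth_on_differentiable[OF smooth_on_deriv[OF smooth_on_deriv[OF smooth_h]] z]]
    by simp
  finally show ?thesis .
qed

lemma T_sym1: "z \<in> S \<Longrightarrow> T z a b d = T z d b a"
  unfolding T_hessian using dd_commute[OF open_S smooth_on_deriv[OF smooth_h]] by simp

lemma T_sym2: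
  assumes z: "z \<in> S"
  shows "T z a b d = T z b a d"
proof -
  have *: "T z a b d = dd (\<lambda>q. gU q a \<bullet> b) z (0, d)" for a b
    unfolding T_def using dd_bounded_linear[OF bounded_linear_inner_left gU_differentiable[OF z]]
    by metis
  show ?thesis
    unfolding * by (rule fun_cong[OF dd_cong_open[OF open_S z]]) (metis gU_sym inner_commute)
qed

lemma T_lin:
  assumes z: "z \<in> S"
  shows "T z a b (d + e) = T z a b d + T z a b e" "T z a b (r *\<^sub>R d) = r * T z a b d"
    "T z a (b + e) d = T z a b d + T z a e d" "T z a (r *\<^sub>R b) d = r * T z a b d"
    "T z (a + e) b d = T z a b d + T z e b d" "T z (r *\<^sub>R a) b d = r * T z a b d"
proof -
  note l = dd_linear[OF gU_differentiable[OF z, of a]]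
  show d: "T z a b (d + e) = T z a b d + T z a b e" "T z a b (r *\<^sub>R d) = r * T z a b d" for a b d e
    unfolding T_def using linear_add[OF dd_linear[OF gU_differentiable[OF z, of a]], of "(0, d)" "(0, e)"]
      linear_cmul[OF dd_linear[OF gU_differentiable[OF z, of a]], of r "(0, d)"]
    by (simp_all add: inner_add_left)
  show "T z a (b + e) d = T z a b d + T z a e d" "T z a (r *\<^sub>R b) d = r * T z a b d"
    by (simp_all add: T_def inner_add_right)
  show "T z (a + e) b d = T z a b d + T z e b d" "T z (r *\<^sub>R a) b d = r * T z a b d"
    unfolding T_sym1[OF z, of _ b d] by (simp_all add: d)
qed

text \<open>The fundamental tensor has degree 0 in p, which kills the last slot; symmetry moves p to
  the others.\<close>

lemma T_snd:
  assumes z: "z \<in> S"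
  shows "T z (snd z) b d = 0" "T z a (snd z) d = 0" "T z a b (snd z) = 0"
proof -
  show 3: "T z a b (snd z) = 0" for a b by (simp add: T_def dd_gU_radial z)
  show 1: "T z (snd z) b d = 0" for b d using T_sym1[OF z, of "snd z" b d] 3 by simp
  show "T z a (snd z) d = 0" using T_sym2[OF z, of a "snd z" d] 1 by simp
qed

lemma cartan_tensor_T:
  assumes z: "z \<in> S"
  shows "cartan_tensor L i j k z = - (1/2) * T z (axis j 1) (axis k 1) (axis i 1)"
  unfolding T_hessian[OF z] by (simp add: cartan_tensor_def dp_def[abs_def] h_def[abs_def])

lemma cartan_tensor_eq_0:
  assumes z: "z \<in> S"
  shows "(\<forall>i j k. cartan_tensor L i j k z = 0) \<longleftrightarrow> (\<forall>a b d. T z a b d = 0)"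
proof
  assume *: "\<forall>i j k. cartan_tensor L i j k z = 0"
  then have 0: "T z (axis j 1) (axis k 1) (axis i 1) = 0" for i j k
    by (simp add: cartan_tensor_T[OF z])
  have lin: "linear (\<lambda>d. T z a b d)" "linear (\<lambda>b. T z a b d)" "linear (\<lambda>a. T z a b d)" for a b d
    by (rule linearI; simp add: T_lin z)+
  have z0: "linear (\<lambda>_::real^'n. 0::real)" by (rule linearI) simp_all
  have "T z a b d = 0" for a b d
    by (rule vec_trilinear_ext[OF lin z0 z0 z0 0])
  then show "\<forall>a b d. T z a b d = 0" by blast
qed (simp add: cartan_tensor_T z)

section \<open>The nonlinear connection\<close>

definition dg :: "'n phase \<Rightarrow> real^'n \<Rightarrow> real^'n \<Rightarrow> 'n phase \<Rightarrow> real" where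
  "dg z u v x = dd (\<lambda>q. gL q u) z x \<bullet> v"

lemma dg_eq: "z \<in> S \<Longrightarrow> dg z u v x = dd (\<lambda>q. gL q u \<bullet> v) z x"
  unfolding dg_def using dd_bounded_linear[OF bounded_linear_inner_left gL_differentiable] by metis

lemma dg_sym: "z \<in> S \<Longrightarrow> dg z u v x = dg z v u x"
  unfolding dg_eq
  by (rule fun_cong[OF dd_cong_open[OF open_S]], assumption) (metis gL_sym inner_commute)

lemma dg_lin:
  assumes z: "z \<in> S"
  shows "linear (\<lambda>u. dg z u v x)" "linear (\<lambda>v. dg z u v x)" "linear (\<lambda>a. dg z u v (a, 0))"
    "linear (\<lambda>a. dg z u v (0, a))"
proof -
  show 2: "linear (\<lambda>v. dg z u v x)" for u by (rule linearI) (simp_all add: dg_def inner_add_right)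
  have "(\<lambda>u. dg z u v x) = (\<lambda>u. dg z v u x)" by (rule ext) (rule dg_sym[OF z])
  then show "linear (\<lambda>u. dg z u v x)" using 2 by simp
  note l = dd_linear[OF gL_differentiable[OF z, of u]]
  have lx: "linear (dg z u v)"
    by (rule linearI) (simp_all add: dg_def linear_add[OF l] linear_cmul[OF l] inner_add_left)
  show "linear (\<lambda>a. dg z u v (a, 0))"
  proof (rule linearI)
    show "dg z u v (a + b, 0) = dg z u v (a, 0) + dg z u v (b, 0)" for a b
      using linear_add[OF lx, of "(a, 0)" "(b, 0)"] by simp
    show "dg z u v (r *\<^sub>R a, 0) = r *\<^sub>R dg z u v (a, 0)" for r a
      using linear_cmul[OF lx, of r "(a, 0)"] by simp
  qed
  show "linear (\<lambda>a. dg z u v (0, a))"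
  proof (rule linearI)
    show "dg z u v (0, a + b) = dg z u v (0, a) + dg z u v (0, b)" for a b
      using linear_add[OF lx, of "(0, a)" "(0, b)"] by simp
    show "dg z u v (0, r *\<^sub>R a) = r *\<^sub>R dg z u v (0, a)" for r a
      using linear_cmul[OF lx, of r "(0, a)"] by simp
  qed
qed

lemma dg_axis: "z \<in> S \<Longrightarrow> dg z (axis i 1) (axis j 1) x = dd (\<lambda>q. g_low L q $ i $ j) z x"
  by (simp add: dg_eq gL_def matop_axis)

lemma AA_lin: "linear (AA z u)" "linear (\<lambda>u. AA z u v)"
  by (rule linearI; simp add: AA_def vec_eq_iff algebra_simps sum.distrib sum_distrib_left)+

lemma AA_axis: "AA z (axis j 1) (axis k 1) $ i = gam L i j k z"
proof -
  have *: "(\<Sum>i\<in>UNIV. f i * axis j 1 $ i) = f j" for f :: "'n \<Rightarrow> real" and j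
    by (simp add: axis_def if_distrib cong: if_cong)
  show ?thesis by (simp only: AA_def vec_lambda_beta *)
qed

text \<open>Lowering the upper index of \<open>gam\<close> cancels the factor \<open>g_up\<close>,
  and both sides are trilinear.\<close>

lemma AA_koszul:
  assumes z: "z \<in> S"
  shows "2 * (gL z (AA z u v) \<bullet> w) = dg z u w (v, 0) + dg z w v (u, 0) - dg z u v (w, 0)"
proof -
  define K where "K u v w = dg z u w (v, 0) + dg z w v (u, 0) - dg z u v (w, 0)" for u v w
  have Kl: "linear (K u v)" "linear (\<lambda>v. K u v w)" "linear (\<lambda>u. K u v w)" for u v w
    unfolding K_def by (intro linear_compose_sub linear_compose_add dg_lin z)+
  have gl: "linear (gL z)" by (simp add: gL_def matop_linear)
  define A where "A u v w = 2 * (gL z (AA z u v) \<bullet> w)" for u v w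
  have Al: "linear (A u v)" "linear (\<lambda>v. A u v w)" "linear (\<lambda>u. A u v w)" for u v w
    unfolding A_def
    by (rule linearI; simp add: linear_add[OF AA_lin(1)] linear_add[OF AA_lin(2)]
        linear_cmul[OF AA_lin(1)] linear_cmul[OF AA_lin(2)] g_lin inner_add_left inner_add_right
        algebra_simps)+
  have 0: "A (axis j 1) (axis k 1) (axis s 1) = K (axis j 1) (axis k 1) (axis s 1)" for j k s
  proof -
    define \<kappa> :: "real^'n" where "\<kappa> = (\<chi> s. K (axis j 1) (axis k 1) (axis s 1))"
    have "AA z (axis j 1) (axis k 1) $ i = ((1/2) *\<^sub>R gU z \<kappa>) $ i" for i
      unfolding AA_axis gam_def gU_mult[OF z]
      by (simp add: \<kappa>_def K_def dg_axis z dx_def matrix_vector_mult_def)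
    then have "AA z (axis j 1) (axis k 1) = (1/2) *\<^sub>R gU z \<kappa>" by (simp add: vec_eq_iff)
    then have "A (axis j 1) (axis k 1) (axis s 1) = \<kappa> \<bullet> axis s 1"
      by (simp add: A_def g_lin gL_gU z)
    then show ?thesis by (simp add: \<kappa>_def inner_axis)
  qed
  have "A u v w = K u v w"
    by (rule vec_trilinear_ext[OF Al Kl 0])
  then show ?thesis by (simp add: A_def K_def)
qed

lemma gL_inject: "z \<in> S \<Longrightarrow> (\<And>w. gL z u \<bullet> w = gL z v \<bullet> w) \<Longrightarrow> u = v"
  using vector_eq_rdot[of "gL z u" "gL z v"] gU_gL by metis

lemma AA_sym: "z \<in> S \<Longrightarrow> AA z u v = AA z v u"
proof -
  assume z: "z \<in> S"
  show ?thesis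
  proof (rule gL_inject[OF z])
    show "gL z (AA z u v) \<bullet> w = gL z (AA z v u) \<bullet> w" for w
      using AA_koszul[OF z, of u v w] AA_koszul[OF z, of v u w]
        dg_sym[OF z, of u v] dg_sym[OF z, of u w] dg_sym[OF z, of v w] by simp
  qed
qed

lemma AA_scale:
  assumes z: "z \<in> S" and t: "t > 0"
  shows "AA (scale t z) u v = AA z u v"
proof (rule gL_inject[OF z])
  fix w
  have "dg (scale t z) u v (w, 0) = dg z u v (w, 0)" for u v w
    using hom_dd[OF smooth_gL_const[of u] _ z t, of 0 "(w, 0)"]
    by (simp add: dg_def scale_def hom_def hom_gL[unfolded scale_def])
  then show "gL z (AA (scale t z) u v) \<bullet> w = gL z (AA z u v) \<bullet> w"
    using AA_koszul[OF z, of u v w] AA_koszul[OF scale_in_S[OF z t], of u v w]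
    by (simp add: hom_gL z t)
qed

definition gvec :: "'n phase \<Rightarrow> real^'n" where "gvec z = (\<chi> h. gam_oo L h z)"

lemma p_up_gU: "z \<in> S \<Longrightarrow> p_up L i z = gU z (snd z) $ i"
  by (simp add: p_up_def gU_mult matrix_vector_mult_def)

lemma gam_o_AA: "gam_o L j k z = snd z \<bullet> AA z (axis j 1) (axis k 1)"
  by (simp add: gam_o_def AA_axis[symmetric] inner_vec_def mult.commute)

lemma gvec_inner:
  assumes z: "z \<in> S"
  shows "gvec z \<bullet> w = snd z \<bullet> AA z w (gU z (snd z))"
proof -
  have l: "linear (\<lambda>v. snd z \<bullet> AA z u v)" "linear (\<lambda>u. snd z \<bullet> AA z u v)" for u v
    by (rule linearI; simp add: linear_add[OF AA_lin(1)] linear_add[OF AA_lin(2)]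
        linear_cmul[OF AA_lin(1)] linear_cmul[OF AA_lin(2)] inner_add_right)+
  have ol: "linear (\<lambda>w. gvec z \<bullet> w)" by (rule linearI) (simp_all add: inner_add_right)
  show ?thesis
  proof (rule vec_linear_ext[OF ol l(2)])
    fix h
    have "gvec z \<bullet> axis h 1 = (\<Sum>k\<in>UNIV. (gU z (snd z) $ k) *\<^sub>R (snd z \<bullet> AA z (axis h 1) (axis k 1)))"
      by (simp add: gvec_def inner_axis gam_oo_def gam_o_AA p_up_gU z mult.commute)
    also have "\<dots> = snd z \<bullet> AA z (axis h 1) (gU z (snd z))"
      by (rule vec_linear_sum[OF l(1), symmetric])
    finally show "gvec z \<bullet> axis h 1 = snd z \<bullet> AA z (axis h 1) (gU z (snd z))" .
  qed
qed

lemma NN_inner: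
  assumes z: "z \<in> S"
  shows "NN z u \<bullet> v = snd z \<bullet> AA z u v - 1/2 * dg z u v (0, gvec z)"
proof -
  define K where "K u v = snd z \<bullet> AA z u v - 1/2 * dg z u v (0, gvec z)" for u v
  note d = dg_lin(1,2)[OF z]
  have Kl: "linear (K u)" "linear (\<lambda>u. K u v)" for u v
    unfolding K_def
    by (rule linearI; simp add: linear_add[OF AA_lin(1)] linear_add[OF AA_lin(2)]
        linear_cmul[OF AA_lin(1)] linear_cmul[OF AA_lin(2)] inner_add_right
        linear_add[OF d(1)] linear_add[OF d(2)] linear_cmul[OF d(1)] linear_cmul[OF d(2)]
        algebra_simps)+
  have Nl: "linear (\<lambda>v. NN z u \<bullet> v)" "linear (\<lambda>u. NN z u \<bullet> v)" for u v
    by (rule linearI; simp add: NN_def linear_add[OF matop_linear] linear_cmul[OF matop_linear]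
        inner_add_right inner_add_left)+
  have 0: "NN z (axis i 1) \<bullet> axis j 1 = K (axis i 1) (axis j 1)" for i j
  proof -
    have "dg z (axis i 1) (axis j 1) (0, gvec z) =
        (\<Sum>h\<in>UNIV. gam_oo L h z * dp h (\<lambda>w. g_low L w $ i $ j) z)"
      unfolding dg_axis[OF z] dd_vert_sum[OF smooth_on_differentiable[OF smooth_g_low z]]
      by (simp add: gvec_def)
    then show ?thesis
      unfolding NN_def matop_axis K_def nonlin_def gam_o_AA by simp
  qed
  have 1: "NN z (axis i 1) \<bullet> v = K (axis i 1) v" for i v
    by (rule vec_linear_ext[OF Nl(1) Kl(1)]) (rule 0)
  have "NN z u \<bullet> v = K u v"
    by (rule vec_linear_ext[OF Nl(2) Kl(2)]) (rule 1)
  then show ?thesis by (simp add: K_def)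
qed

lemma NN_sym: "z \<in> S \<Longrightarrow> NN z u \<bullet> v = u \<bullet> NN z v"
  using NN_inner[of z u v] NN_inner[of z v u] AA_sym[of z u v] dg_sym[of z u v]
  by (simp add: inner_commute)

lemma gvec_scale:
  assumes z: "z \<in> S" and t: "t > 0"
  shows "gvec (scale t z) = (t * t) *\<^sub>R gvec z"
proof (rule vector_eq_rdot[THEN iffD1], rule allI)
  fix w
  have "gvec (scale t z) \<bullet> w = snd (scale t z) \<bullet> AA z w (gU z (snd (scale t z)))"
    unfolding gvec_inner[OF scale_in_S[OF z t]] AA_scale[OF z t] hom_gU[OF z t] ..
  then show "gvec (scale t z) \<bullet> w = (t * t) *\<^sub>R gvec z \<bullet> w"
    by (simp add: scale_def g_lin linear_cmul[OF AA_lin(1)] gvec_inner[OF z])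
qed

lemma smooth_NN: "smooth_on S (\<lambda>z. NN z u)"
  using NN_family by (rule smooth_family_smooth)

text \<open>Euler's relation for degree 1: \<open>AA\<close> has degree 0 and is contracted with p,
  while the vertical derivative of the metric has degree -1 and is contracted with
  \<open>gvec\<close>, of degree 2.\<close>

lemma NN_radial:
  assumes z: "z \<in> S"
  shows "dd (\<lambda>q. NN q u) z (0, snd z) = NN z u"
proof -
  have "hom 1 (\<lambda>q. NN q u)"
    unfolding hom_def
  proof (intro ballI allI impI)
    fix z and t :: real assume z: "z \<in> S" and t: "t > 0"
    show "NN (scale t z) u = t ^ 1 *\<^sub>R NN z u"
    proof (rule vector_eq_rdot[THEN iffD1], rule allI)
      fix v
      note l = dd_linear[OF gL_differentiable[OF scale_in_S[OF z t], of u]]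
      have "dg (scale t z) u v (0, gvec (scale t z)) = t * dg (scale t z) u v (scale t (0, gvec z))"
        using linear_cmul[OF l, of t "(0, t *\<^sub>R gvec z)"]
        by (simp add: dg_def gvec_scale[OF z t]) (simp add: scale_def)
      also have "\<dots> = t * dg z u v (0, gvec z)"
        using hom_dd[OF smooth_gL_const[of u] _ z t, of 0 "(0, gvec z)"]
        by (simp add: dg_def hom_def hom_gL)
      finally show "NN (scale t z) u \<bullet> v = t ^ 1 *\<^sub>R NN z u \<bullet> v"
        unfolding NN_inner[OF scale_in_S[OF z t]]
        by (simp add: AA_scale[OF z t] NN_inner[OF z] algebra_simps) (simp add: scale_def)
    qed
  qed
  from hom_euler[OF smooth_NN this z] show ?thesis by simp
qed

text \<open>K is constant along horizontal curves. With P = \<open>gU z (snd z)\<close>, the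
  correction term in \<open>N\<close> contracted with P is a Cartan tensor with p in one slot and
  vanishes; the Christoffel part gives half the base derivative of g at (P, P), which is minus half
  that of K^2. This is what makes the Liouville field a gradient.\<close>

lemma dh_horizontal:
  assumes z: "z \<in> S"
  shows "dd h z (u, NN z u) = 0"
proof -
  let ?p = "snd z" and ?P = "gU z (snd z)"
  have "dg z u ?P (0, gvec z) = - T z (gL z u) ?p (gvec z)"
    unfolding dg_def dd_gL[OF z] T_def by (simp add: gL_sym[OF z] gL_gU z)
  then have "NN z u \<bullet> ?P = ?p \<bullet> AA z u ?P"
    unfolding NN_inner[OF z] by (simp add: T_snd z)
  also have "\<dots> = gL z (AA z u ?P) \<bullet> ?P"
    unfolding gL_sym[OF z] gL_gU[OF z] by (rule inner_commute)
  also have "\<dots> = 1/2 * dg z ?P ?P (u, 0)"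
    using AA_koszul[OF z, of u ?P ?P] by simp
  also have "dg z ?P ?P (u, 0) = - (dd (\<lambda>q. gU q ?p) z (u, 0) \<bullet> ?p)"
    unfolding dg_def dd_gL[OF z] by (simp add: gL_sym[OF z] gL_gU z)
  also have "dd (\<lambda>q. gU q ?p) z (u, 0) \<bullet> ?p = dd h z (u, 0)"
  proof -
    have bs: "bounded_linear (snd :: 'n phase \<Rightarrow> _)" by (rule bounded_linear_snd)
    have ds: "snd differentiable (at z)" by (rule bounded_linear_imp_differentiable[OF bs])
    have "dd h z (u, 0) = dd (\<lambda>q. gU q (snd q) \<bullet> snd q) z (u, 0)"
      by (rule fun_cong[OF dd_cong_open[OF open_S z gU_snd_snd[symmetric]]])
    also have "\<dots> = dd (\<lambda>q. gU q (snd q)) z (u, 0) \<bullet> ?p"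
      using dd_inner[OF dd_family(2)[OF open_S gU_family ds z] ds, of "(u, 0)"]
      by (simp add: dd_self[OF bs])
    also have "dd (\<lambda>q. gU q (snd q)) z (u, 0) = dd (\<lambda>q. gU q ?p) z (u, 0)"
      using dd_family(1)[OF open_S gU_family ds z, of "(u, 0)"] by (simp add: dd_self[OF bs] g_lin)
    finally show ?thesis by simp
  qed
  finally have N: "2 * (NN z u \<bullet> ?P) = - dd h z (u, 0)" by simp
  have "dd h z (u, NN z u) = dd h z (u, 0) + dd h z (0, NN z u)"
    using linear_add[OF dd_linear[OF smooth_on_differentiable[OF smooth_h z]], of "(u, 0)" "(0, NN z u)"]
    by simp
  also have "dd h z (0, NN z u) = 2 * (NN z u \<bullet> ?P)"
    using gU_snd[OF z, of "NN z u"] by (simp add: inner_commute)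
  finally show ?thesis using N by simp
qed

lemma NN_curvature:
  assumes z: "z \<in> S"
  shows "dd (\<lambda>q. NN q v) z (u, NN z u) - dd (\<lambda>q. NN q u) z (v, NN z v) =
    c *\<^sub>R ((snd z \<bullet> u) *\<^sub>R gL z v - (snd z \<bullet> v) *\<^sub>R gL z u)"
proof -
  define D where "D u v w = dd (\<lambda>q. NN q v) z (u, NN z u) \<bullet> w" for u v w
  define K where "K u v w = c * ((snd z \<bullet> u) * (gL z v \<bullet> w) - (snd z \<bullet> v) * (gL z u \<bullet> w))" for u v w
  have Kl: "linear (K u v)" "linear (\<lambda>v. K u v w)" "linear (\<lambda>u. K u v w)" for u v w
    unfolding K_def
    by (rule linearI; simp add: g_lin inner_add_left inner_add_right algebra_simps)+
  have Nl: "NN z (u + v) = NN z u + NN z v" "NN z (r *\<^sub>R u) = r *\<^sub>R NN z u" for u v r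
    unfolding NN_def by (simp_all add: linear_add[OF matop_linear] linear_cmul[OF matop_linear])
  note dl = dd_linear[OF smooth_on_differentiable[OF smooth_NN z]]
  note fl = smooth_family_linear[OF smooth_family_deriv[OF open_S NN_family] z]
  have Dl: "linear (D u v)" "linear (\<lambda>v. D u v w)" "linear (\<lambda>u. D u v w)" for u v w
  proof -
    show "linear (D u v)" unfolding D_def by (rule linearI) (simp_all add: inner_add_right)
    show "linear (\<lambda>v. D u v w)"
      unfolding D_def by (rule linearI) (simp_all add: linear_add[OF fl] linear_cmul[OF fl] inner_add_left)
    show "linear (\<lambda>u. D u v w)"
    proof (rule linearI)
      show "D (a + b) v w = D a v w + D b v w" for a b
        using linear_add[OF dl, of v "(a, NN z a)" "(b, NN z b)"] by (simp add: D_def Nl inner_add_left)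
      show "D (r *\<^sub>R a) v w = r *\<^sub>R D a v w" for r a
        using linear_cmul[OF dl, of v r "(a, NN z a)"] by (simp add: D_def Nl)
    qed
  qed
  define E where "E u v w = D u v w - D v u w" for u v w
  have El: "linear (E u v)" "linear (\<lambda>v. E u v w)" "linear (\<lambda>u. E u v w)" for u v w
    unfolding E_def by (intro linear_compose_sub Dl)+
  have Dax: "D (axis i 1) (axis j 1) (axis k 1) = delta L i (nonlin L j k) z" for i j k
  proof -
    note dif = smooth_on_differentiable[OF smooth_nonlin z, of j k]
    have "D (axis i 1) (axis j 1) (axis k 1) = dd (\<lambda>q. NN q (axis j 1) \<bullet> axis k 1) z (axis i 1, NN z (axis i 1))"
      unfolding D_def
      by (rule dd_bounded_linear[OF bounded_linear_inner_left smooth_on_differentiable[OF smooth_NN z], symmetric])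
    also have "\<dots> = dd (nonlin L j k) z (axis i 1, 0) + dd (nonlin L j k) z (0, NN z (axis i 1))"
      unfolding NN_def matop_axis
      using linear_add[OF dd_linear[OF dif], of "(axis i 1, 0)" "(0, matop (nonlin L) z (axis i 1))"] by simp
    also have "\<dots> = delta L i (nonlin L j k) z"
      unfolding delta_def dx_def dd_vert_sum[OF dif] NN_def
      by (simp add: matop_axis[unfolded inner_axis, simplified])
    finally show ?thesis .
  qed
  have 0: "E (axis i 1) (axis j 1) (axis k 1) = K (axis i 1) (axis j 1) (axis k 1)" for i j k
  proof -
    have "K (axis i 1) (axis j 1) (axis k 1) =
        c * (g_low L z $ j $ k * snd z $ i - g_low L z $ i $ k * snd z $ j)"
      unfolding K_def gL_def matop_axis by (simp add: inner_axis mult.commute)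
    then show ?thesis
      unfolding E_def Dax using curv[of z k i j] z by (simp add: R_curv_def S_def)
  qed
  have 3: "E u v w = K u v w" for u v w
    by (rule vec_trilinear_ext[OF El Kl 0])
  show ?thesis
  proof (rule vector_eq_rdot[THEN iffD1], rule allI)
    fix w show "(dd (\<lambda>q. NN q v) z (u, NN z u) - dd (\<lambda>q. NN q u) z (v, NN z v)) \<bullet> w =
      c *\<^sub>R ((snd z \<bullet> u) *\<^sub>R gL z v - (snd z \<bullet> v) *\<^sub>R gL z u) \<bullet> w"
      using 3[of u v w] by (simp add: E_def D_def K_def inner_diff_left)
  qed
qed

end

section \<open>The metric of a Cartan space of constant curvature\<close>

locale cartan_metric = cartan_chart U L c
  for U :: "(real^'n::finite) set" and L :: "'n phase \<Rightarrow> real" and c :: real +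
  fixes \<beta> :: real
  assumes beta: "\<beta> > 0" and c0: "c \<noteq> 0"
begin

text \<open>The quantity 1 - 2 c \<beta>^2 \<tau> in the denominator of G^{ij}; its positivity set
  treats both signs of c together.\<close>

definition disc :: "'n phase \<Rightarrow> real" where "disc z = 1 - c * \<beta>\<^sup>2 * h z"

definition W :: "'n phase set" where "W = {z \<in> S. disc z > 0}"

definition GLo :: "'n phase \<Rightarrow> real^'n \<Rightarrow> real^'n" where "GLo = matop (\<lambda>i j. GG_low c \<beta> L i j)"

definition GUo :: "'n phase \<Rightarrow> real^'n \<Rightarrow> real^'n" where "GUo = matop (\<lambda>i j. GG_up c \<beta> L i j)"

lemma smooth_disc: "smooth_on S disc"
  unfolding disc_def by (intro smooth_on_diff smooth_on_mult smooth_h smooth_on_const open_S)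

lemma W_S: "z \<in> W \<Longrightarrow> z \<in> S" and disc_pos: "z \<in> W \<Longrightarrow> disc z > 0"
  by (simp_all add: W_def)

lemma open_W: "open W"
proof -
  have "open (S \<inter> disc -` {0<..})"
    by (rule continuous_open_preimage[OF smooth_on_continuous[OF smooth_disc] open_S open_greaterThan])
  moreover have "S \<inter> disc -` {0<..} = W" by (auto simp: W_def)
  ultimately show ?thesis by simp
qed

lemma smooth_S_W: "smooth_on S f \<Longrightarrow> smooth_on W f"
  by (rule smooth_on_subset) (auto simp: W_def)

lemma family_S_W: "smooth_family S B \<Longrightarrow> smooth_family W B"
  unfolding smooth_family_def by (auto intro: smooth_S_W W_S)

lemma GLo_eq: "GLo z u = (1/\<beta>) *\<^sub>R gL z u - (c * \<beta> * (snd z \<bullet> u)) *\<^sub>R snd z"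
proof -
  have "GLo z u = (1/\<beta>) *\<^sub>R gL z u + (- (c * \<beta>) * (snd z \<bullet> u)) *\<^sub>R snd z"
    unfolding GLo_def gL_def by (rule matop_rank_one) (simp add: GG_low_def)
  then show ?thesis by simp
qed

lemma GUo_eq:
  assumes z: "z \<in> S"
  shows "GUo z a = \<beta> *\<^sub>R gU z a + (c * \<beta> ^ 3 / disc z * (gU z (snd z) \<bullet> a)) *\<^sub>R gU z (snd z)"
proof -
  have "2 * c * \<beta>\<^sup>2 * tau L z = c * \<beta>\<^sup>2 * h z" by (simp add: tau_def h_def)
  then have *: "GG_up c \<beta> L i j z = \<beta> * g_up L z $ i $ j
      + c * \<beta> ^ 3 / disc z * gU z (snd z) $ i * gU z (snd z) $ j" for i j
    by (simp add: GG_up_def p_up_gU[OF z] disc_def)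
  have "GUo z a = \<beta> *\<^sub>R matop (\<lambda>i j z. g_up L z $ i $ j) z a
      + (c * \<beta> ^ 3 / disc z * (gU z (snd z) \<bullet> a)) *\<^sub>R gU z (snd z)"
    unfolding GUo_def by (rule matop_rank_one) (rule *)
  then show ?thesis by (simp only: gU_def)
qed

lemma gU_p_inner: "z \<in> S \<Longrightarrow> snd z \<bullet> gU z a = gU z (snd z) \<bullet> a"
  by (simp add: gU_sym)

text \<open>The Sherman-Morrison formula: the coefficient c \<beta>^3 / \<open>disc\<close> of the
  upper block is the one that inverts the rank one perturbation in the lower block, \<open>H\<close>
  being the squared length of p.\<close>

lemma GLo_GUo:
  assumes z: "z \<in> W"
  shows "GLo z (GUo z a) = a"
proof -
  note S = W_S[OF z] and d = disc_pos[OF z]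
  define s where "s = gU z (snd z) \<bullet> a"
  define H where "H = h z"
  have D: "disc z = 1 - c * \<beta>\<^sup>2 * H" by (simp add: disc_def H_def)
  have pp: "gU z (snd z) \<bullet> snd z = H" using gU_snd_snd[OF S] by (simp add: H_def)
  have "GLo z (GUo z a) = a + (1/\<beta> * (c * \<beta> ^ 3 / disc z * s)) *\<^sub>R snd z
      - (c * \<beta> * (\<beta> * s + c * \<beta> ^ 3 / disc z * s * H)) *\<^sub>R snd z"
    unfolding GLo_eq GUo_eq[OF S]
    using beta by (simp add: g_lin gL_gU[OF S] gU_p_inner[OF S] inner_add_right pp s_def scaleR_add_right)
  also have "1/\<beta> * (c * \<beta> ^ 3 / disc z * s) = c * \<beta> * (\<beta> * s + c * \<beta> ^ 3 / disc z * s * H)"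
    using beta d unfolding D by (simp add: field_simps power2_eq_square power3_eq_cube)
  finally show ?thesis by simp
qed

lemma GLo_sym: "z \<in> S \<Longrightarrow> GLo z u \<bullet> v = u \<bullet> GLo z v"
  by (simp add: GLo_eq inner_diff_left inner_diff_right gL_sym[of z u] inner_commute[of u "snd z"])

lemma GUo_sym: "z \<in> S \<Longrightarrow> GUo z u \<bullet> v = u \<bullet> GUo z v"
  by (simp add: GUo_eq inner_add_left inner_add_right gU_sym[of z u] inner_commute[of u "gU z (snd z)"])

lemma GUo_GLo:
  assumes z: "z \<in> W"
  shows "GUo z (GLo z u) = u"
proof (rule vector_eq_rdot[THEN iffD1], rule allI)
  fix v
  have "GUo z (GLo z u) \<bullet> v = u \<bullet> GLo z (GUo z v)"
    by (simp add: GUo_sym GLo_sym W_S[OF z])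
  then show "GUo z (GLo z u) \<bullet> v = u \<bullet> v" by (simp add: GLo_GUo[OF z])
qed

lemma gL_pos: "z \<in> S \<Longrightarrow> u \<noteq> 0 \<Longrightarrow> gL z u \<bullet> u > 0"
  using gU_pos[of z "gL z u"] gU_gL[of z u] g_lin(5)[of z] by (metis inner_commute)

text \<open>For c > 0 the lower block subtracts a square, so positivity is read off the inverse
  block, which adds one; for c < 0 the lower block adds a square itself.\<close>

lemma GLo_pos:
  assumes z: "z \<in> W" and u: "u \<noteq> 0"
  shows "GLo z u \<bullet> u > 0"
proof (cases "c > 0")
  case True
  define a where "a = GLo z u"
  have a: "GUo z a = u" by (simp add: a_def GUo_GLo[OF z])
  have "GUo z 0 = 0" by (simp add: GUo_eq[OF W_S[OF z]] g_lin)
  then have "a \<noteq> 0" using a u by auto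
  have "GUo z a \<bullet> a = \<beta> * (gU z a \<bullet> a) + c * \<beta> ^ 3 / disc z * (gU z (snd z) \<bullet> a)\<^sup>2"
    by (simp add: GUo_eq[OF W_S[OF z]] inner_add_left power2_eq_square)
  moreover have "\<beta> * (gU z a \<bullet> a) > 0"
    using gU_pos[OF W_S[OF z] \<open>a \<noteq> 0\<close>] beta by simp
  moreover have "c * \<beta> ^ 3 / disc z * (gU z (snd z) \<bullet> a)\<^sup>2 \<ge> 0"
    using True beta disc_pos[OF z] by simp
  ultimately have "GUo z a \<bullet> a > 0" by simp
  then show ?thesis unfolding a by (simp add: a_def inner_commute)
next
  case False
  have "GLo z u \<bullet> u = 1/\<beta> * (gL z u \<bullet> u) + (- c) * \<beta> * (snd z \<bullet> u)\<^sup>2"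
    by (simp add: GLo_eq inner_diff_left power2_eq_square)
  moreover have "1/\<beta> * (gL z u \<bullet> u) > 0"
    using gL_pos[OF W_S[OF z] u] beta by simp
  moreover have "(- c) * \<beta> * (snd z \<bullet> u)\<^sup>2 \<ge> 0"
    by (intro mult_nonneg_nonneg) (use False beta in auto)
  ultimately show ?thesis by simp
qed

lemma GLo_family: "smooth_family W GLo"
  unfolding GLo_def
proof (rule matop_family[OF open_W], rule smooth_S_W)
  show "smooth_on S (GG_low c \<beta> L i j)" for i j
    unfolding GG_low_def[abs_def]
    by (intro smooth_on_diff smooth_on_mult smooth_g_low smooth_on_const smooth_on_nth smooth_on_snd
        smooth_on_ident open_S)
qed

lemma GUo_family: "smooth_family W GUo"
  unfolding GUo_def
proof (rule matop_family[OF open_W])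
  have "2 * c * \<beta>\<^sup>2 * tau L z = c * \<beta>\<^sup>2 * h z" for z by (simp add: tau_def h_def)
  then have *: "GG_up c \<beta> L i j z = \<beta> * g_up L z $ i $ j + c * \<beta> ^ 3 / disc z * p_up L i z * p_up L j z"
    for i j z by (simp add: GG_up_def disc_def)
  show "smooth_on W (GG_up c \<beta> L i j)" for i j
    unfolding *[abs_def]
    by (intro smooth_on_add smooth_on_mult smooth_on_divide smooth_on_const open_W smooth_S_W
        smooth_g_up smooth_p_up smooth_disc) (use disc_pos in force)
qed

sublocale lagrangian_domain W NN GLo GUo
  by unfold_locales
    (use open_W family_S_W[OF NN_family] GLo_family GUo_family GLo_GUo GUo_GLo GLo_pos
      NN_sym GLo_sym GUo_sym W_S in auto)

lemma GG_eq: "GG c \<beta> L = Gm"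
proof (intro ext)
  fix z u v
  have d: "delta_p L i z v = (snd v - NN z (fst v)) $ i" for i v
    by (simp add: delta_p_def NN_def matop_def)
  show "GG c \<beta> L z u v = Gm z u v"
    unfolding GG_def Gm_def d
    unfolding GLo_def GUo_def matop_inner ..
qed

lemma JJ_eq: "JJ c \<beta> L = Jm"
proof (intro ext)
  fix z v
  have d: "delta_p L i z v = (snd v - NN z (fst v)) $ i" for i v
    by (simp add: delta_p_def NN_def matop_def)
  define a where "a = snd v - NN z (fst v)"
  have 1: "(\<Sum>i\<in>UNIV. fst v $ i *\<^sub>R (\<Sum>k\<in>UNIV. GG_low c \<beta> L i k z *\<^sub>R (0::real^'n, axis k 1)))
    = (0, GLo z (fst v))"
  proof -
    define P where "P b = (0::real^'n, b)" for b :: "real^'n"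
    have P: "linear P" unfolding P_def by (rule linearI) simp_all
    have "(\<Sum>k\<in>UNIV. GG_low c \<beta> L i k z *\<^sub>R P (axis k 1)) = P (GLo z (axis i 1))" for i
      using vec_linear_sum[OF P, of "GLo z (axis i 1)"]
      by (simp add: GLo_def matop_axis[unfolded inner_axis, simplified])
    moreover have "linear (\<lambda>a. P (GLo z a))"
      using linear_compose[OF matop_linear P] by (simp add: GLo_def o_def)
    ultimately have "(\<Sum>i\<in>UNIV. fst v $ i *\<^sub>R (\<Sum>k\<in>UNIV. GG_low c \<beta> L i k z *\<^sub>R P (axis k 1)))
        = P (GLo z (fst v))"
      using vec_linear_sum[of "\<lambda>a. P (GLo z a)" "fst v"] by simp
    then show ?thesis unfolding P_def .
  qed
  have 2: "(\<Sum>i\<in>UNIV. a $ i *\<^sub>R (\<Sum>k\<in>UNIV. GG_up c \<beta> L i k z *\<^sub>R delta_vec L k z))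
    = (GUo z a, NN z (GUo z a))"
  proof -
    have dv: "delta_vec L k z = (axis k 1, NN z (axis k 1))" for k
    proof -
      have "NN z (axis k 1) $ j = nonlin L k j z" for j
        using matop_axis[of "nonlin L" z k j] by (simp add: NN_def inner_axis)
      then show ?thesis by (simp add: delta_vec_def vec_eq_iff)
    qed
    define P where "P b = (b, NN z b)" for b
    have P: "linear P" unfolding P_def NN_def
      by (rule linearI) (simp_all add: linear_add[OF matop_linear] linear_cmul[OF matop_linear])
    have "(\<Sum>k\<in>UNIV. GG_up c \<beta> L i k z *\<^sub>R P (axis k 1)) = P (GUo z (axis i 1))" for i
      using vec_linear_sum[OF P, of "GUo z (axis i 1)"]
      by (simp add: GUo_def matop_axis[unfolded inner_axis, simplified])
    moreover have "linear (\<lambda>a. P (GUo z a))"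
      using linear_compose[OF matop_linear P] by (simp add: GUo_def o_def)
    ultimately show ?thesis
      using vec_linear_sum[of "\<lambda>a. P (GUo z a)" a] by (simp add: dv P_def)
  qed
  have "JJ c \<beta> L z v = (0, GLo z (fst v)) - (GUo z a, NN z (GUo z a))"
    unfolding JJ_def d a_def[symmetric] 1 2 ..
  moreover have "NN z (- b) = - NN z b" for b
    by (simp add: NN_def linear_neg[OF matop_linear])
  ultimately show "JJ c \<beta> L z v = Jm z v"
    by (simp add: Jm_def J0_def Fr_def Fi_def a_def)
qed

lemma dd_GLo:
  assumes z: "z \<in> S"
  shows "dd (\<lambda>q. GLo q u) z x = (1/\<beta>) *\<^sub>R dd (\<lambda>q. gL q u) z x
    - (c * \<beta>) *\<^sub>R ((snd x \<bullet> u) *\<^sub>R snd z + (snd z \<bullet> u) *\<^sub>R snd x)"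
proof -
  have bl: "bounded_linear (\<lambda>q::'n phase. c * \<beta> * (snd q \<bullet> u))"
    by (intro bounded_linear_const_mult bounded_linear_compose[OF bounded_linear_inner_left] bounded_linear_snd)
  note bs = bounded_linear_snd
  note d = bounded_linear_imp_differentiable[OF bl] bounded_linear_imp_differentiable[OF bs]
  have 1: "dd (\<lambda>q. (1/\<beta>) *\<^sub>R gL q u) z x = (1/\<beta>) *\<^sub>R dd (\<lambda>q. gL q u) z x"
    by (rule dd_bounded_linear[OF bounded_linear_scaleR_right gL_differentiable[OF z]])
  have 2: "dd (\<lambda>q. (c * \<beta> * (snd q \<bullet> u)) *\<^sub>R snd q) z x =
      (c * \<beta> * (snd z \<bullet> u)) *\<^sub>R snd x + (c * \<beta> * (snd x \<bullet> u)) *\<^sub>R snd z"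
    using dd_scaleR[OF d, of z x] by (simp only: dd_self[OF bl] dd_self[OF bs])
  have "dd (\<lambda>q. GLo q u) z x = dd (\<lambda>q. (1/\<beta>) *\<^sub>R gL q u) z x
      - dd (\<lambda>q. (c * \<beta> * (snd q \<bullet> u)) *\<^sub>R snd q) z x"
    unfolding GLo_eq
    by (intro dd_diff differentiable_bilinear[OF bounded_bilinear_scaleR] d gL_differentiable[OF z]) simp
  then show ?thesis unfolding 1 2 by (simp add: algebra_simps)
qed

lemma GUo_p: "z \<in> W \<Longrightarrow> GUo z (snd z) = (\<beta> / disc z) *\<^sub>R gU z (snd z)"
proof -
  assume z: "z \<in> W"
  have "\<beta> + c * \<beta> ^ 3 / disc z * h z = \<beta> / disc z"
    using disc_pos[OF z] by (simp add: disc_def field_simps power2_eq_square power3_eq_cube)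
  then show ?thesis
    by (simp add: GUo_eq[OF W_S[OF z]] gU_snd_snd[OF W_S[OF z]] scaleR_left_distrib[symmetric])
qed

text \<open>A primitive of \<beta> / \<open>disc\<close> as a function of \<tau>. By
  \<open>GUo_p\<close> and \<open>dh_horizontal\<close> the metric dual of the Liouville field is
  (\<beta> / disc) d\<tau>.\<close>

definition \<Psi> :: "'n phase \<Rightarrow> real" where "\<Psi> z = - 1 / (2 * c * \<beta>) * ln (disc z)"

lemma potential_gradient:
  assumes z: "z \<in> W"
  shows "(\<Psi> has_derivative Gm z (0, snd z)) (at z)"
proof -
  note S = W_S[OF z] and d = disc_pos[OF z]
  have hd: "(h has_derivative dd h z) (at z)"
    by (rule dd_works[OF smooth_on_differentiable[OF smooth_h S]])
  have "(disc has_derivative (\<lambda>x. 0 - c * \<beta>\<^sup>2 * dd h z x)) (at z)"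
    unfolding disc_def by (intro has_derivative_diff has_derivative_const has_derivative_mult_right hd)
  from has_derivative_mult_right[OF has_derivative_ln[OF d this]]
  have "(\<Psi> has_derivative (\<lambda>x. - 1 / (2 * c * \<beta>) * ((0 - c * \<beta>\<^sup>2 * dd h z x) * inverse (disc z)))) (at z)"
    unfolding \<Psi>_def .
  moreover have "- 1 / (2 * c * \<beta>) * ((0 - c * \<beta>\<^sup>2 * dd h z x) * inverse (disc z)) = Gm z (0, snd z) x" for x
  proof -
    obtain y where x: "x = Fr z y" by (metis Fr_Fi)
    have "dd h z (Fr z y) = dd h z (fst y, NN z (fst y)) + dd h z (0, snd y)"
      using linear_add[OF dd_linear[OF smooth_on_differentiable[OF smooth_h S]],
          of "(fst y, NN z (fst y))" "(0, snd y)"] by (simp add: Fr_def)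
    also have "\<dots> = 2 * (gU z (snd z) \<bullet> snd y)"
      by (simp add: dh_horizontal[OF S] gU_snd[OF S])
    finally have "dd h z x = 2 * (gU z (snd z) \<bullet> snd y)" unfolding x .
    moreover have "Gm z (0, snd z) x = \<beta> / disc z * (gU z (snd z) \<bullet> snd y)"
    proof -
      have "(0, snd z) = Fr z (0, snd z)" by (simp add: Fr_def op_lin z)
      then have "Gm z (0, snd z) x = Gm z (Fr z (0, snd z)) (Fr z y)" by (simp only: x)
      then show ?thesis unfolding Gm_Fr by (simp add: GUo_p[OF z] op_lin z)
    qed
    ultimately show ?thesis
      using c0 beta d by (simp add: field_simps power2_eq_square)
  qed
  ultimately show ?thesis by (simp only:)
qed

sublocale radial_domain W NN GLo GUo "c * \<beta>" \<Psi>
proof unfold_locales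
  fix z u w b and t :: real
  assume z: "z \<in> W"
  note S = W_S[OF z]
  show "dd (\<lambda>q. NN q u) z (0, snd z) = NN z u" by (rule NN_radial[OF S])
  show "dd (\<lambda>q. GLo q u) z (0, snd z) = - (2 * (c * \<beta>) * (snd z \<bullet> u)) *\<^sub>R snd z"
  proof -
    have "- (2 * (c * \<beta>) * (snd z \<bullet> u)) *\<^sub>R snd z
      = - (c * \<beta>) *\<^sub>R ((snd z \<bullet> u) *\<^sub>R snd z + (snd z \<bullet> u) *\<^sub>R snd z)"
      by (simp add: scaleR_left_distrib[symmetric])
    then show ?thesis unfolding dd_GLo[OF S] by (simp add: dd_gL_radial[OF S])
  qed
  show "(\<Psi> has_derivative Gm z (0, snd z)) (at z)" by (rule potential_gradient[OF z])
  show "dd (\<lambda>q. NN q w) z (Fr z (u, 0)) = dd (\<lambda>q. NN q u) z (Fr z (w, 0))"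
    if "snd z \<bullet> u = 0" "snd z \<bullet> w = 0"
    using NN_curvature[OF S, of w u] that by (simp add: Fr_def)
  show "GUo (fst z, t *\<^sub>R snd z) (snd z) \<bullet> b = 0"
    if zt: "(fst z, t *\<^sub>R snd z) \<in> W" and t: "t > 0" and b: "GUo z (snd z) \<bullet> b = 0"
  proof -
    have s: "scale t z = (fst z, t *\<^sub>R snd z)" by (simp add: scale_def)
    have "gU z (snd z) \<bullet> b = 0" using b disc_pos[OF z] beta by (simp add: GUo_p[OF z])
    moreover have "t *\<^sub>R GUo (fst z, t *\<^sub>R snd z) (snd z) = GUo (fst z, t *\<^sub>R snd z) (t *\<^sub>R snd z)"
      using op_lin(14)[OF zt] by simp
    moreover have "\<dots> \<bullet> b = \<beta> / disc (fst z, t *\<^sub>R snd z) * (t * (gU z (snd z) \<bullet> b))"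
      using GUo_p[OF zt] hom_gU[OF S t] by (simp add: s g_lin)
    ultimately have "t * (GUo (fst z, t *\<^sub>R snd z) (snd z) \<bullet> b) = 0"
      by (metis inner_scaleR_left mult_zero_right)
    then show ?thesis using t by simp
  qed
  show "1 + c * \<beta> * (GUo z (snd z) \<bullet> snd z) > 0"
  proof -
    have "1 + c * \<beta> * (GUo z (snd z) \<bullet> snd z) = 1 / disc z"
      using disc_pos[OF z] unfolding GUo_p[OF z]
      by (simp add: gU_snd_snd[OF S]) (simp add: disc_def field_simps power2_eq_square)
    then show ?thesis using disc_pos[OF z] by simp
  qed
qed

text \<open>The covectors split into the line of p, which the Cartan tensor ignores, and the kernel
  of P. On that kernel, raising the index gives vectors killed by p, and there the vertical
  derivatives of \<open>GLo\<close> and of the fundamental tensor agree up to the factor 1 /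
  \<beta>.\<close>

lemma locally_symmetric_cartan:
  assumes sym: "locally_symmetric_on W (GG c \<beta> L)" and z: "z \<in> W"
  shows "cartan_tensor L i j k z = 0"
proof -
  note S = W_S[OF z]
  have p: "snd z \<noteq> 0" using S by (auto simp: S_def mem_Times_iff)
  define P where "P = gU z (snd z)"
  have P0: "P \<bullet> snd z \<noteq> 0" using gU_pos[OF S p] by (simp add: P_def)
  have T0: "T z a b d = 0" if "P \<bullet> a = 0" "P \<bullet> b = 0" "P \<bullet> d = 0" for a b d
  proof -
    have "GUo z (snd z) \<bullet> d = 0" using that(3) by (simp add: GUo_p[OF z] P_def)
    moreover have pu: "snd z \<bullet> gU z a = 0" "snd z \<bullet> gU z b = 0"
      using that by (simp_all add: gU_p_inner[OF S] P_def)
    ultimately have "dd (\<lambda>q. GLo q (gU z a)) z (0, d) \<bullet> gU z b = 0"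
      using locally_symmetric_imp[OF sym[unfolded GG_eq] z] by blast
    then have "dd (\<lambda>q. gL q (gU z a)) z (0, d) \<bullet> gU z b = 0"
      using beta by (simp add: dd_GLo[OF S] inner_diff_left inner_add_left pu)
    then show ?thesis
      by (simp add: dd_gL[OF S] gL_gU[OF S] T_def gL_sym[OF S])
  qed
  have "T z a b d = 0" for a b d
  proof -
    \<comment> \<open>The coefficient for which \<open>P\<close> annihilates
      \<open>a - r a *\<^sub>R snd z\<close>.\<close>
    define r where "r a = (P \<bullet> a) / (P \<bullet> snd z)" for a
    have a: "a = (a - r a *\<^sub>R snd z) + r a *\<^sub>R snd z" "P \<bullet> (a - r a *\<^sub>R snd z) = 0" for a
      using P0 by (simp_all add: r_def inner_diff_right)
    have "T z a b d = T z (a - r a *\<^sub>R snd z) (b - r b *\<^sub>R snd z) (d - r d *\<^sub>R snd z)"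
      by (subst a(1)[of a], subst a(1)[of b], subst a(1)[of d])
        (simp only: T_lin[OF S] T_snd[OF S] mult_zero_right add_0_right)
    then show ?thesis using T0[OF a(2) a(2) a(2)] by simp
  qed
  then show ?thesis using cartan_tensor_eq_0[OF S] by blast
qed

section \<open>The Riemannian case\<close>

definition BB :: "'n phase \<Rightarrow> real^'n \<Rightarrow> real^'n \<Rightarrow> real^'n" where
  "BB z u b = (\<chi> k. b \<bullet> AA z u (axis k 1))"

lemma BB_adj: "BB z u b \<bullet> w = b \<bullet> AA z u w"
proof -
  have l: "linear (\<lambda>w. b \<bullet> AA z u w)"
    by (rule linearI) (simp_all add: linear_add[OF AA_lin(1)] linear_cmul[OF AA_lin(1)] inner_add_right)
  show ?thesis
    using vec_linear_sum[OF l, of w] by (simp add: BB_def inner_vec_def[of "vec_lambda _"] mult.commute)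
qed

lemma smooth_AA_const: "smooth_on S (\<lambda>z. AA z u v)"
  unfolding AA_def
  by (intro smooth_on_vec smooth_on_sum smooth_on_mult smooth_gam smooth_on_const open_S)

lemma AA_bifamily: "smooth_bifamily S AA"
  unfolding smooth_bifamily_def bilinear_def using AA_lin smooth_AA_const by blast

lemma BB_bifamily: "smooth_bifamily S BB"
  unfolding smooth_bifamily_def bilinear_def
proof (intro conjI ballI allI)
  show "linear (BB z u)" "linear (\<lambda>u. BB z u b)" for z u b
    by (rule linearI; simp add: BB_def vec_eq_iff linear_add[OF AA_lin(2)] linear_cmul[OF AA_lin(2)]
        inner_add_left inner_add_right)+
  show "smooth_on S (\<lambda>z. BB z u b)" for u b
    unfolding BB_def by (intro smooth_on_vec smooth_on_inner smooth_AA_const smooth_on_const open_S)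
qed

lemma bifamily_S_W: "smooth_bifamily S B \<Longrightarrow> smooth_bifamily W B"
  unfolding smooth_bifamily_def by (auto intro: smooth_S_W W_S)

lemmas AA_differentiable = smooth_on_differentiable[OF smooth_AA_const]

lemma AA_compatible:
  assumes z: "z \<in> S"
  shows "dd (\<lambda>q. gL q w) z (u, 0) = BB z u (gL z w) + gL z (AA z u w)"
proof (rule vector_eq_rdot[THEN iffD1], rule allI)
  fix v
  have "dg z w v (u, 0) = gL z (AA z u w) \<bullet> v + gL z (AA z u v) \<bullet> w"
    using AA_koszul[OF z, of u w v] AA_koszul[OF z, of u v w]
      dg_sym[OF z, of v w] dg_sym[OF z, of u v] dg_sym[OF z, of u w] by simp
  moreover have "gL z (AA z u v) \<bullet> w = gL z w \<bullet> AA z u v"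
    unfolding gL_sym[OF z, of w] by (rule inner_commute)
  ultimately show "dd (\<lambda>q. gL q w) z (u, 0) \<bullet> v = (BB z u (gL z w) + gL z (AA z u w)) \<bullet> v"
    by (simp add: dg_def BB_adj inner_add_left)
qed

context
  assumes riem: "\<And>z i j k. z \<in> S \<Longrightarrow> cartan_tensor L i j k z = 0"
begin

lemma gL_vertical:
  assumes z: "z \<in> S"
  shows "dd (\<lambda>q. gL q u) z (0, a) = 0"
proof -
  have "T z b d a = 0" for b d using cartan_tensor_eq_0[OF z] riem[OF z] by blast
  then have "dd (\<lambda>q. gU q b) z (0, a) = 0" for b
    by (intro vector_eq_rdot[THEN iffD1]) (simp add: T_def)
  then show ?thesis by (simp add: dd_gL[OF z] g_lin)
qed

lemma gL_horizontal:
  assumes z: "z \<in> S"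
  shows "dd (\<lambda>q. gL q w) z (u, b) = dd (\<lambda>q. gL q w) z (u, 0)"
  using linear_add[OF dd_linear[OF gL_differentiable[OF z]], of w "(u, 0)" "(0, b)"] gL_vertical[OF z]
  by simp

lemma NN_BB: "z \<in> S \<Longrightarrow> NN z u = BB z u (snd z)"
  by (rule vector_eq_rdot[THEN iffD1]) (simp add: NN_inner BB_adj dg_def gL_vertical)

text \<open>The base metric does not depend on p, and neither do its base derivatives since
  derivatives commute; differentiate the Koszul identity vertically and use nondegeneracy.\<close>

lemma AA_vertical:
  assumes z: "z \<in> S"
  shows "dd (\<lambda>q. AA q u v) z (0, a) = 0"
proof -
  have dg0: "dd (\<lambda>q. dg q u v (w, 0)) z (0, a) = 0" for u v w
  proof -
    note sm = smooth_gL_const[of u]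
    have "dd (\<lambda>q. dg q u v (w, 0)) z (0, a) = dd (\<lambda>q. dd (\<lambda>q. gL q u) q (w, 0)) z (0, a) \<bullet> v"
      unfolding dg_def
      by (rule dd_bounded_linear[OF bounded_linear_inner_left smooth_on_differentiable[OF smooth_on_deriv[OF sm] z]])
    also have "dd (\<lambda>q. dd (\<lambda>q. gL q u) q (w, 0)) z (0, a) = dd (\<lambda>q. dd (\<lambda>q. gL q u) q (0, a)) z (w, 0)"
      by (rule dd_commute[OF open_S sm z])
    also have "\<dots> = dd (\<lambda>q. 0 :: real^'n) z (w, 0)"
      by (rule fun_cong[OF dd_cong_open[OF open_S z]]) (rule gL_vertical)
    finally show ?thesis by simp
  qed
  have dgd: "(\<lambda>q. dg q u v (w, 0)) differentiable (at z)" for u v w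
    unfolding dg_def
    by (rule smooth_on_differentiable[OF smooth_on_inner[OF open_S smooth_on_deriv[OF smooth_gL_const] smooth_on_const] z])
  have "gL z (dd (\<lambda>q. AA q u v) z (0, a)) \<bullet> w = gL z 0 \<bullet> w" for w
  proof -
    have d: "(\<lambda>q. gL q (AA q u v)) differentiable (at z)"
      by (rule dd_family(2)[OF open_S gL_family AA_differentiable[OF z] z])
    have "dd (\<lambda>q. gL q (AA q u v) \<bullet> (2 *\<^sub>R w)) z (0, a)
        = dd (\<lambda>q. dg q u w (v, 0) + dg q w v (u, 0) - dg q u v (w, 0)) z (0, a)"
      by (rule fun_cong[OF dd_cong_open[OF open_S z]]) (simp add: AA_koszul)
    also have "\<dots> = 0" by (simp add: dd_add dd_diff dgd dg0)
    finally have "dd (\<lambda>q. gL q (AA q u v)) z (0, a) \<bullet> (2 *\<^sub>R w) = 0"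
      using dd_bounded_linear[OF bounded_linear_inner_left d] by metis
    moreover have "dd (\<lambda>q. gL q (AA q u v)) z (0, a) = gL z (dd (\<lambda>q. AA q u v) z (0, a))"
      by (simp add: dd_family(1)[OF open_S gL_family AA_differentiable[OF z] z] gL_vertical[OF z])
    ultimately show ?thesis by (simp add: g_lin)
  qed
  then show ?thesis using gL_inject[OF z] by blast
qed

lemma AA_horizontal:
  assumes z: "z \<in> S"
  shows "dd (\<lambda>q. AA q u v) z (w, b) = dd (\<lambda>q. AA q u v) z (w, 0)"
  using linear_add[OF dd_linear[OF AA_differentiable[OF z]], of u v "(w, 0)" "(0, b)"] AA_vertical[OF z]
  by simp

text \<open>
  The curvature hypothesis only gives the contraction of the Riemann tensor with \<open>p\<close>; as that tensor
  does not depend on \<open>p\<close>, differentiating in a fibre direction removes the contraction.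
\<close>

lemma AA_curvature:
  assumes z: "z \<in> S"
  shows "dd (\<lambda>q. AA q v w) z (u, 0) - dd (\<lambda>q. AA q u w) z (v, 0) + AA z u (AA z v w) - AA z v (AA z u w)
    = c *\<^sub>R ((gL z v \<bullet> w) *\<^sub>R u - (gL z u \<bullet> w) *\<^sub>R v)"
proof -
  define V where "V q = dd (\<lambda>q. AA q v w) q (u, 0) - dd (\<lambda>q. AA q u w) q (v, 0)
      + AA q u (AA q v w) - AA q v (AA q u w)" for q
  have sA: "smooth_on S (\<lambda>q. AA q a (AA q b w))" for a b
    by (rule smooth_bifamily_apply[OF open_S AA_bifamily smooth_on_const smooth_AA_const])
  note sd = smooth_on_deriv[OF smooth_AA_const]
  have sV: "smooth_on S V"
    unfolding V_def by (intro smooth_on_diff smooth_on_add sA sd open_S)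
  have dA: "dd (\<lambda>q. dd (\<lambda>q. AA q a w) q (b, 0)) z (0, d) = 0" for a b d
  proof -
    have "dd (\<lambda>q. dd (\<lambda>q. AA q a w) q (b, 0)) z (0, d) = dd (\<lambda>q. dd (\<lambda>q. AA q a w) q (0, d)) z (b, 0)"
      by (rule dd_commute[OF open_S smooth_AA_const z])
    also have "\<dots> = dd (\<lambda>q. 0 :: real^'n) z (b, 0)"
      by (rule fun_cong[OF dd_cong_open[OF open_S z]]) (rule AA_vertical)
    finally show ?thesis by simp
  qed
  have dAA: "dd (\<lambda>q. AA q a (AA q b w)) z (0, d) = 0" for a b d
    using dd_bifamily[OF open_S AA_bifamily smooth_on_const smooth_AA_const z, of a b w "(0, d)"]
    by (simp add: AA_vertical[OF z] linear_0[OF AA_lin(1)] linear_0[OF AA_lin(2)])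
  have dV: "dd V z (0, d) = 0" for d
    unfolding V_def
    using smooth_on_differentiable[OF sA z] smooth_on_differentiable[OF sd z]
    by (simp add: dd_add dd_diff dA dAA)
  have pV: "snd q \<bullet> V q = c * ((snd q \<bullet> u) * (gL q v \<bullet> w) - (snd q \<bullet> v) * (gL q u \<bullet> w))" if q: "q \<in> S" for q
  proof -
    have *: "dd (\<lambda>q. NN q a) q (b, NN q b) \<bullet> w = snd q \<bullet> AA q b (AA q a w) + snd q \<bullet> dd (\<lambda>q. AA q a w) q (b, 0)"
      for a b
    proof -
      have "dd (\<lambda>q. NN q a) q (b, NN q b) \<bullet> w = dd (\<lambda>q. NN q a \<bullet> w) q (b, NN q b)"
        by (rule dd_bounded_linear[OF bounded_linear_inner_left smooth_on_differentiable[OF smooth_NN q], symmetric])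
      also have "\<dots> = dd (\<lambda>q. snd q \<bullet> AA q a w) q (b, NN q b)"
        by (rule fun_cong[OF dd_cong_open[OF open_S q]]) (simp add: NN_BB BB_adj)
      also have "\<dots> = snd q \<bullet> dd (\<lambda>q. AA q a w) q (b, NN q b) + NN q b \<bullet> AA q a w"
        using dd_inner[OF bounded_linear_imp_differentiable[OF bounded_linear_snd] AA_differentiable[OF q]]
        by (simp add: dd_self[OF bounded_linear_snd])
      finally show ?thesis
        unfolding AA_horizontal[OF q, of a w b "NN q b"] by (simp add: NN_BB[OF q] BB_adj)
    qed
    have "snd q \<bullet> V q = (dd (\<lambda>q. NN q v) q (u, NN q u) - dd (\<lambda>q. NN q u) q (v, NN q v)) \<bullet> w"
      by (simp add: V_def * inner_diff_left inner_diff_right inner_add_right)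
    then show ?thesis unfolding NN_curvature[OF q] by (simp add: inner_diff_left)
  qed
  have bd: "b \<bullet> V z = c * ((b \<bullet> u) * (gL z v \<bullet> w) - (b \<bullet> v) * (gL z u \<bullet> w))" for b
  proof -
    note sn = bounded_linear_imp_differentiable[OF bounded_linear_snd]
    have bi: "bounded_linear (\<lambda>q::'n phase. snd q \<bullet> a)" for a
      by (rule bounded_linear_compose[OF bounded_linear_inner_left bounded_linear_snd])
    note bid = bounded_linear_imp_differentiable[OF bi]
    have gi: "(\<lambda>q. gL q a \<bullet> w) differentiable (at z)" for a
      by (intro differentiable_bounded_linear[OF bounded_linear_inner_left] gL_differentiable[OF z])
    have gi0: "dd (\<lambda>q. gL q a \<bullet> w) z (0, b) = 0" for a
      using dd_bounded_linear[OF bounded_linear_inner_left gL_differentiable[OF z], of a w "(0, b)"]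
      by (simp add: gL_vertical[OF z])
    have m: "dd (\<lambda>q. (snd q \<bullet> a) * (gL q d \<bullet> w)) z (0, b) = (b \<bullet> a) * (gL z d \<bullet> w)"
      "(\<lambda>q. (snd q \<bullet> a) * (gL q d \<bullet> w)) differentiable (at z)" for a d
      using dd_mult[OF bid gi] differentiable_bilinear[OF bounded_bilinear_mult bid gi]
      by (simp_all add: gi0 dd_self[OF bi])
    have "b \<bullet> V z = dd (\<lambda>q. snd q \<bullet> V q) z (0, b)"
      using dd_inner[OF sn smooth_on_differentiable[OF sV z], of "(0, b)"]
      by (simp add: dV dd_self[OF bounded_linear_snd])
    also have "\<dots> = dd (\<lambda>q. c *\<^sub>R ((snd q \<bullet> u) * (gL q v \<bullet> w) - (snd q \<bullet> v) * (gL q u \<bullet> w))) z (0, b)"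
      by (rule fun_cong[OF dd_cong_open[OF open_S z]]) (simp add: pV)
    also have "\<dots> = c *\<^sub>R dd (\<lambda>q. (snd q \<bullet> u) * (gL q v \<bullet> w) - (snd q \<bullet> v) * (gL q u \<bullet> w)) z (0, b)"
      by (rule dd_bounded_linear[OF bounded_linear_scaleR_right]) (intro differentiable_diff m)
    also have "\<dots> = c * ((b \<bullet> u) * (gL z v \<bullet> w) - (b \<bullet> v) * (gL z u \<bullet> w))"
      by (simp add: dd_diff m)
    finally show ?thesis .
  qed
  have "V z = c *\<^sub>R ((gL z v \<bullet> w) *\<^sub>R u - (gL z u \<bullet> w) *\<^sub>R v)"
  proof (rule vector_eq_ldot[THEN iffD1], rule allI)
    show "b \<bullet> V z = b \<bullet> c *\<^sub>R ((gL z v \<bullet> w) *\<^sub>R u - (gL z u \<bullet> w) *\<^sub>R v)" for b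
      unfolding bd by (simp add: inner_diff_right mult.commute)
  qed
  then show ?thesis by (simp add: V_def)
qed

lemma riemannian_kaehler:
  "kaehler_on W (GG c \<beta> L) (JJ c \<beta> L) \<and> locally_symmetric_on W (GG c \<beta> L)"
proof -
  interpret sd: symmetric_domain W NN GLo GUo AA BB "c * \<beta>"
  proof unfold_locales
    show "smooth_bifamily W AA" "smooth_bifamily W BB"
      by (rule bifamily_S_W[OF AA_bifamily] bifamily_S_W[OF BB_bifamily])+
    fix z u v w b a x
    assume z: "z \<in> W"
    note S = W_S[OF z]
    show "AA z u v = AA z v u" by (rule AA_sym[OF S])
    show "BB z u b \<bullet> w = b \<bullet> AA z u w" by (rule BB_adj)
    show "NN z u = BB z u (snd z)" by (rule NN_BB[OF S])
    show "dd (\<lambda>q. AA q u v) z (0, a) = 0" by (rule AA_vertical[OF S])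
    have Bl: "BB z u (b - b') = BB z u b - BB z u b'" "BB z u (r *\<^sub>R b) = r *\<^sub>R BB z u b" for u b b' r
      by (simp_all add: BB_def vec_eq_iff inner_diff_left)
    show "dd (\<lambda>q. GLo q w) z (Fr z x) = BB z (fst x) (GLo z w) + GLo z (AA z (fst x) w)
      - (c * \<beta>) *\<^sub>R ((snd x \<bullet> w) *\<^sub>R snd z + (snd z \<bullet> w) *\<^sub>R snd x)"
      unfolding dd_GLo[OF S] Fr_def gL_horizontal[OF S, of w "fst x" "NN z (fst x) + snd x"] AA_compatible[OF S]
      by (simp add: GLo_eq Bl NN_BB[OF S] BB_adj inner_add_left scaleR_add_right scaleR_diff_right
          scaleR_add_left algebra_simps)
    show "dd (\<lambda>q. AA q v w) z (u, 0) - dd (\<lambda>q. AA q u w) z (v, 0) + AA z u (AA z v w) - AA z v (AA z u w) =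
      (c * \<beta>) *\<^sub>R ((GLo z v \<bullet> w) *\<^sub>R u - (GLo z u \<bullet> w) *\<^sub>R v)
      + ((c * \<beta>)\<^sup>2 * (snd z \<bullet> w)) *\<^sub>R ((snd z \<bullet> v) *\<^sub>R u - (snd z \<bullet> u) *\<^sub>R v)"
    proof -
      \<comment> \<open>The identity c g = k \<open>GLo\<close> + k^2 p p with k = c \<beta>, which
        brings the base curvature into the form the locale asks for.\<close>
      have "c * \<beta> * (GLo z v \<bullet> w) + (c * \<beta>)\<^sup>2 * (snd z \<bullet> w) * (snd z \<bullet> v) = c * (gL z v \<bullet> w)" for v
        using beta by (simp add: GLo_eq inner_diff_left power2_eq_square field_simps)
      then have "c *\<^sub>R ((gL z v \<bullet> w) *\<^sub>R u - (gL z u \<bullet> w) *\<^sub>R v) =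
        (c * \<beta> * (GLo z v \<bullet> w) + (c * \<beta>)\<^sup>2 * (snd z \<bullet> w) * (snd z \<bullet> v)) *\<^sub>R u
        - (c * \<beta> * (GLo z u \<bullet> w) + (c * \<beta>)\<^sup>2 * (snd z \<bullet> w) * (snd z \<bullet> u)) *\<^sub>R v"
        by (simp add: scaleR_diff_right)
      then show ?thesis unfolding AA_curvature[OF S] by (simp add: algebra_simps)
    qed
  qed
  show ?thesis unfolding GG_eq JJ_eq using sd.kaehler sd.locally_symmetric by blast
qed

end

text \<open>Local symmetry is assumed on \<open>W\<close> only, but the Cartan tensor has to vanish
  on all of \<open>S\<close>: a point of \<open>S\<close> is scaled into \<open>W\<close>, and
  \<open>T\<close>, of degree -1 in p, carries the vanishing back.\<close>

lemma kaehler_iff_riemannian: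
  "kaehler_on W (GG c \<beta> L) (JJ c \<beta> L) \<and> locally_symmetric_on W (GG c \<beta> L) \<longleftrightarrow>
    (\<forall>z\<in>S. \<forall>i j k. cartan_tensor L i j k z = 0)"
proof
  assume ls: "kaehler_on W (GG c \<beta> L) (JJ c \<beta> L) \<and> locally_symmetric_on W (GG c \<beta> L)"
  show "\<forall>z\<in>S. \<forall>i j k. cartan_tensor L i j k z = 0"
  proof
    fix z assume z: "z \<in> S"
    \<comment> \<open>With m the absolute value in the denominator, t = 1 / (1 + m) gives t^2 m <= t
      m < 1, so \<open>disc\<close> is positive at \<open>scale t z\<close>.\<close>
    define t where "t = 1 / (1 + \<bar>c * \<beta>\<^sup>2 * h z\<bar>)"
    have t: "t > 0" "t \<le> 1" by (simp_all add: t_def)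
    have "t\<^sup>2 * (c * \<beta>\<^sup>2 * h z) \<le> t\<^sup>2 * \<bar>c * \<beta>\<^sup>2 * h z\<bar>"
      by (intro mult_left_mono) auto
    also have "\<dots> \<le> t * \<bar>c * \<beta>\<^sup>2 * h z\<bar>"
      using t by (intro mult_right_mono) (auto simp: power2_eq_square mult_left_le)
    also have "\<dots> < 1" by (simp add: t_def divide_simps)
    finally have "t\<^sup>2 * (c * \<beta>\<^sup>2 * h z) < 1" .
    moreover have "h (scale t z) = t\<^sup>2 * h z"
      using hom_h z t by (simp add: hom_def)
    ultimately have W: "scale t z \<in> W"
      using scale_in_S[OF z t(1)] by (simp add: W_def disc_def algebra_simps)
    have "T z a b d = 0" for a b d
    proof -
      have "T (scale t z) a b d = 0"
        using locally_symmetric_cartan[OF _ W] ls cartan_tensor_eq_0[OF W_S[OF W]] by blast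
      moreover have "dd (\<lambda>q. gU q a) (scale t z) (0, t *\<^sub>R d) = dd (\<lambda>q. gU q a) z (0, d)"
        using hom_dd[OF smooth_gU_const[of a] _ z t(1), of 0 "(0, d)"]
        by (simp add: hom_def hom_gU) (simp add: scale_def)
      then have "T z a b d = T (scale t z) a b (t *\<^sub>R d)" by (simp add: T_def)
      ultimately show ?thesis by (simp add: T_lin[OF W_S[OF W]])
    qed
    then show "\<forall>i j k. cartan_tensor L i j k z = 0" using cartan_tensor_eq_0[OF z] by blast
  qed
qed (rule riemannian_kaehler, blast)

end

section \<open>Induced charts of the cotangent bundle\<close>

locale manifold_chart =
  fixes M :: "'m topology" and A :: "('m, 'n::finite) chart set" and \<kappa> :: "('m, 'n) chart"
  assumes manifold: "smooth_manifold M A" and chart: "\<kappa> \<in> A"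
begin

lemma chart_facts:
  assumes "\<kappa>' \<in> A"
  shows "openin M (fst \<kappa>')" "open (snd \<kappa>' ` fst \<kappa>')" "inj_on (snd \<kappa>') (fst \<kappa>')"
    "\<And>V. openin M V \<Longrightarrow> V \<subseteq> fst \<kappa>' \<Longrightarrow> open (snd \<kappa>' ` V)"
proof -
  show o: "openin M (fst \<kappa>')" and oi: "open (snd \<kappa>' ` fst \<kappa>')"
    using manifold assms by (auto simp: smooth_manifold_def)
  have h: "homeomorphic_map (subtopology M (fst \<kappa>')) (top_of_set (snd \<kappa>' ` fst \<kappa>')) (snd \<kappa>')"
    using manifold assms by (auto simp: smooth_manifold_def)
  have ts: "topspace (subtopology M (fst \<kappa>')) = fst \<kappa>'"
    using openin_subset[OF o] by auto
  show "inj_on (snd \<kappa>') (fst \<kappa>')"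
    using homeomorphic_imp_injective_map[OF h] by (simp only: ts)
  fix V assume V: "openin M V" "V \<subseteq> fst \<kappa>'"
  have "openin (subtopology M (fst \<kappa>')) V"
    using V o by (metis openin_open_subtopology)
  then have "openin (top_of_set (snd \<kappa>' ` fst \<kappa>')) (snd \<kappa>' ` V)"
    using homeomorphic_imp_open_map[OF h] unfolding open_map_def by blast
  then show "open (snd \<kappa>' ` V)"
    using oi by (metis openin_open_eq)
qed

lemma chart_inv: "\<kappa>' \<in> A \<Longrightarrow> x \<in> fst \<kappa>' \<Longrightarrow> inv_into (fst \<kappa>') (snd \<kappa>') (snd \<kappa>' x) = x"
  by (simp add: inv_into_f_f chart_facts(3))

lemma transition_at: "\<kappa>1 \<in> A \<Longrightarrow> x \<in> fst \<kappa>1 \<Longrightarrow> transition \<kappa>1 \<kappa>2 (snd \<kappa>1 x) = snd \<kappa>2 x"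
  by (simp add: transition_def chart_inv)

lemma transition_differentiable:
  assumes "\<kappa>1 \<in> A" "\<kappa>2 \<in> A" "x \<in> fst \<kappa>1" "x \<in> fst \<kappa>2"
  shows "transition \<kappa>1 \<kappa>2 differentiable (at (snd \<kappa>1 x))"
proof -
  have "smooth_on (snd \<kappa>1 ` (fst \<kappa>1 \<inter> fst \<kappa>2)) (transition \<kappa>1 \<kappa>2)"
    using manifold assms by (simp add: smooth_manifold_def)
  then show ?thesis
    by (rule smooth_on_differentiable) (use assms in blast)
qed

lemma transition_chain:
  assumes "\<kappa>1 \<in> A" "\<kappa>2 \<in> A" "\<kappa>3 \<in> A" "x \<in> fst \<kappa>1" "x \<in> fst \<kappa>2" "x \<in> fst \<kappa>3"
  shows "dd (transition \<kappa>1 \<kappa>3) (snd \<kappa>1 x) v =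
    dd (transition \<kappa>2 \<kappa>3) (snd \<kappa>2 x) (dd (transition \<kappa>1 \<kappa>2) (snd \<kappa>1 x) v)"
proof -
  let ?V = "fst \<kappa>1 \<inter> fst \<kappa>2"
  have o: "open (snd \<kappa>1 ` ?V)"
    using chart_facts(1)[OF assms(1)] chart_facts(1)[OF assms(2)]
    by (intro chart_facts(4)[OF assms(1)]) auto
  have "dd (transition \<kappa>1 \<kappa>3) (snd \<kappa>1 x) v =
      dd (\<lambda>y. transition \<kappa>2 \<kappa>3 (transition \<kappa>1 \<kappa>2 y)) (snd \<kappa>1 x) v"
    by (rule fun_cong[OF dd_cong_open[OF o]]) (use assms in \<open>auto simp: transition_at\<close>)
  also have "((\<lambda>y. transition \<kappa>2 \<kappa>3 (transition \<kappa>1 \<kappa>2 y)) has_derivative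
      (\<lambda>v. dd (transition \<kappa>2 \<kappa>3) (snd \<kappa>2 x) (dd (transition \<kappa>1 \<kappa>2) (snd \<kappa>1 x) v))) (at (snd \<kappa>1 x))"
  proof (rule has_derivative_compose[OF dd_works[OF transition_differentiable]])
    show "(transition \<kappa>2 \<kappa>3 has_derivative dd (transition \<kappa>2 \<kappa>3) (snd \<kappa>2 x))
        (at (transition \<kappa>1 \<kappa>2 (snd \<kappa>1 x)))"
      unfolding transition_at[OF assms(1,4)]
      by (rule dd_works[OF transition_differentiable]) (use assms in auto)
  qed (use assms in auto)
  then have "dd (\<lambda>y. transition \<kappa>2 \<kappa>3 (transition \<kappa>1 \<kappa>2 y)) (snd \<kappa>1 x) v =
      dd (transition \<kappa>2 \<kappa>3) (snd \<kappa>2 x) (dd (transition \<kappa>1 \<kappa>2) (snd \<kappa>1 x) v)"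
    by (simp add: dd_eqI)
  finally show ?thesis .
qed

lemma transition_self:
  assumes "\<kappa>1 \<in> A" "x \<in> fst \<kappa>1"
  shows "dd (transition \<kappa>1 \<kappa>1) (snd \<kappa>1 x) v = v"
proof -
  have "dd (transition \<kappa>1 \<kappa>1) (snd \<kappa>1 x) v = dd (\<lambda>y. y) (snd \<kappa>1 x) v"
    by (rule fun_cong[OF dd_cong_open[OF chart_facts(2)[OF assms(1)]]])
      (use assms in \<open>auto simp: transition_at\<close>)
  then show ?thesis by simp
qed

text \<open>The covector at \<open>x\<close> whose components in the fixed chart
  \<open>\<kappa>\<close> are \<open>p\<close>; the transformation rule dictates the components in
  all other charts.\<close>

definition covec :: "'m \<Rightarrow> real^'n \<Rightarrow> ('m, 'n) covector" where
  "covec x p = (\<lambda>\<kappa>'. if \<kappa>' \<in> A \<and> x \<in> fst \<kappa>'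
     then \<chi> i. dd (transition \<kappa>' \<kappa>) (snd \<kappa>' x) (axis i 1) \<bullet> p else 0)"

text \<open>Compatibility between two further charts is the chain rule for transition maps, both
  being compared with \<open>\<kappa>\<close>.\<close>

lemma covec_in:
  assumes x: "x \<in> fst \<kappa>"
  shows "covec x p \<in> cotangent_space A x"
  unfolding cotangent_space_def
proof (intro CollectI conjI ballI allI impI; (elim conjE)?)
  fix \<kappa>1 \<kappa>2 i assume k: "\<kappa>1 \<in> A" "\<kappa>2 \<in> A" "x \<in> fst \<kappa>1" "x \<in> fst \<kappa>2"
  let ?v = "dd (transition \<kappa>1 \<kappa>2) (snd \<kappa>1 x) (axis i 1)"
  have lin: "linear (\<lambda>v. dd (transition \<kappa>2 \<kappa>) (snd \<kappa>2 x) v \<bullet> p)"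
    using dd_linear[OF transition_differentiable[OF k(2) chart k(4) x]]
    by (intro linearI) (simp_all add: linear_add linear_cmul inner_add_left)
  have "covec x p \<kappa>1 $ i = dd (transition \<kappa>2 \<kappa>) (snd \<kappa>2 x) ?v \<bullet> p"
    using k by (simp add: covec_def transition_chain[OF k(1,2) chart k(3,4) x])
  also have "\<dots> = (\<Sum>j\<in>UNIV. ?v $ j * covec x p \<kappa>2 $ j)"
    using vec_linear_sum[OF lin, of ?v] k by (simp add: covec_def)
  finally show "covec x p \<kappa>1 $ i = (\<Sum>j\<in>UNIV. ?v $ j * covec x p \<kappa>2 $ j)" .
qed (auto simp: covec_def)

lemma covec_eq:
  assumes x: "x \<in> fst \<kappa>" and w: "w \<in> cotangent_space A x"
  shows "w = covec x (w \<kappa>)"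
proof
  fix \<kappa>'
  show "w \<kappa>' = covec x (w \<kappa>) \<kappa>'"
  proof (cases "\<kappa>' \<in> A \<and> x \<in> fst \<kappa>'")
    case True
    then have "w \<kappa>' $ i = (\<Sum>j\<in>UNIV. dd (transition \<kappa>' \<kappa>) (snd \<kappa>' x) (axis i 1) $ j * w \<kappa> $ j)" for i
      using w x chart unfolding cotangent_space_def by blast
    then show ?thesis using True by (simp add: covec_def vec_eq_iff inner_vec_def)
  next
    case False
    moreover have "w \<kappa>' = 0" using w False unfolding cotangent_space_def by blast
    ultimately show ?thesis by (auto simp: covec_def)
  qed
qed

lemma covec_self: "x \<in> fst \<kappa> \<Longrightarrow> covec x p \<kappa> = p"
  by (simp add: covec_def chart transition_self vec_eq_iff inner_axis')

lemma covec_zero: "covec x 0 = (\<lambda>_. 0)"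
  by (auto simp: covec_def vec_eq_iff)

lemma covec_scale: "covec x (t *\<^sub>R p) = (\<lambda>\<kappa>'. t *\<^sub>R covec x p \<kappa>')"
  by (auto simp: covec_def vec_eq_iff)

lemma chart_topspace: "x \<in> fst \<kappa> \<Longrightarrow> x \<in> topspace M"
  using openin_subset[OF chart_facts(1)[OF chart]] by blast

lemma over_cotangent: "over_chart (cotangent_bundle M A) \<kappa> = {(x, covec x p) | x p. x \<in> fst \<kappa>}"
proof (intro subset_antisym subsetI)
  fix q assume "q \<in> over_chart (cotangent_bundle M A) \<kappa>"
  then obtain x w where "q = (x, w)" "x \<in> fst \<kappa>" "w \<in> cotangent_space A x"
    by (auto simp: over_chart_def cotangent_bundle_def)
  then show "q \<in> {(x, covec x p) | x p. x \<in> fst \<kappa>}" using covec_eq by blast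
next
  fix q assume "q \<in> {(x, covec x p) | x p. x \<in> fst \<kappa>}"
  then show "q \<in> over_chart (cotangent_bundle M A) \<kappa>"
    using chart_topspace covec_in by (auto simp: over_chart_def cotangent_bundle_def)
qed

lemma over_slit: "over_chart (slit_cotangent_bundle M A) \<kappa> = {(x, covec x p) | x p. x \<in> fst \<kappa> \<and> p \<noteq> 0}"
proof -
  have nz: "covec x p \<noteq> (\<lambda>_. 0) \<longleftrightarrow> p \<noteq> 0" if "x \<in> fst \<kappa>" for x p
    using covec_self[OF that, of p] covec_zero[of x] by (metis)
  have "over_chart (slit_cotangent_bundle M A) \<kappa> =
      {q \<in> over_chart (cotangent_bundle M A) \<kappa>. snd q \<noteq> (\<lambda>_. 0)}"
    by (auto simp: over_chart_def slit_cotangent_bundle_def)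
  then show ?thesis unfolding over_cotangent using nz by auto
qed

lemma induced_chart_covec: "x \<in> fst \<kappa> \<Longrightarrow> induced_chart \<kappa> (x, covec x p) = (snd \<kappa> x, p)"
  by (simp add: induced_chart_def covec_self)

lemma coord_domain_slit:
  "coord_domain (slit_cotangent_bundle M A) \<kappa> = (snd \<kappa> ` fst \<kappa>) \<times> - {0}"
  unfolding coord_domain_def over_slit
proof (intro subset_antisym subsetI)
  fix z :: "'n phase" assume "z \<in> (snd \<kappa> ` fst \<kappa>) \<times> - {0}"
  then obtain x p where "z = (snd \<kappa> x, p)" "x \<in> fst \<kappa>" "p \<noteq> 0" by auto
  then show "z \<in> induced_chart \<kappa> ` {(x, covec x p) |x p. x \<in> fst \<kappa> \<and> p \<noteq> 0}"
    using induced_chart_covec[of x p] by (metis (mono_tags, lifting) image_eqI mem_Collect_eq)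
qed (auto simp: induced_chart_covec)

lemma coord_fun_covec:
  assumes x: "x \<in> fst \<kappa>"
  shows "coord_fun M A K \<kappa> (snd \<kappa> x, p) = K (x, covec x p)"
proof -
  have "inj_on (induced_chart \<kappa>) (over_chart (cotangent_bundle M A) \<kappa>)"
  proof (rule inj_onI)
    fix q q' assume q: "q \<in> over_chart (cotangent_bundle M A) \<kappa>" "q' \<in> over_chart (cotangent_bundle M A) \<kappa>"
      and eq: "induced_chart \<kappa> q = induced_chart \<kappa> q'"
    obtain y r y' r' where y: "q = (y, covec y r)" "y \<in> fst \<kappa>" "q' = (y', covec y' r')" "y' \<in> fst \<kappa>"
      using q unfolding over_cotangent by blast
    then have "snd \<kappa> y = snd \<kappa> y'" "r = r'" using eq by (simp_all add: induced_chart_covec)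
    then show "q = q'" using y inj_onD[OF chart_facts(3)[OF chart]] by blast
  qed
  moreover have "(x, covec x p) \<in> over_chart (cotangent_bundle M A) \<kappa>"
    unfolding over_cotangent using x by blast
  ultimately have "inv_into (over_chart (cotangent_bundle M A) \<kappa>) (induced_chart \<kappa>)
      (induced_chart \<kappa> (x, covec x p)) = (x, covec x p)"
    by (rule inv_into_f_f)
  then show ?thesis by (simp add: coord_fun_def induced_chart_covec[OF x])
qed

lemma coord_domain_tube:
  "coord_domain (tube M A K c \<beta>) \<kappa> =
    {z \<in> (snd \<kappa> ` fst \<kappa>) \<times> - {0}. (coord_fun M A K \<kappa> z)\<^sup>2 < 1 / (c * \<beta>\<^sup>2)}"
proof -
  have tube: "over_chart (tube M A K c \<beta>) \<kappa> =
      {q \<in> over_chart (slit_cotangent_bundle M A) \<kappa>. (K q)\<^sup>2 < 1 / (c * \<beta>\<^sup>2)}"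
    by (auto simp: over_chart_def tube_def)
  have val: "coord_fun M A K \<kappa> (induced_chart \<kappa> q) = K q"
    if "q \<in> over_chart (slit_cotangent_bundle M A) \<kappa>" for q
  proof -
    obtain x p where q: "q = (x, covec x p)" "x \<in> fst \<kappa>"
      using \<open>q \<in> _\<close> unfolding over_slit by blast
    show ?thesis unfolding q(1) induced_chart_covec[OF q(2)] by (rule coord_fun_covec[OF q(2)])
  qed
  show ?thesis
    unfolding coord_domain_slit[symmetric] coord_domain_def tube
  proof (intro subset_antisym subsetI)
    fix z assume "z \<in> induced_chart \<kappa> `
      {q \<in> over_chart (slit_cotangent_bundle M A) \<kappa>. (K q)\<^sup>2 < 1 / (c * \<beta>\<^sup>2)}"
    then obtain q where q: "q \<in> over_chart (slit_cotangent_bundle M A) \<kappa>"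
      "(K q)\<^sup>2 < 1 / (c * \<beta>\<^sup>2)" "z = induced_chart \<kappa> q" by blast
    show "z \<in> {z \<in> induced_chart \<kappa> ` over_chart (slit_cotangent_bundle M A) \<kappa>.
        (coord_fun M A K \<kappa> z)\<^sup>2 < 1 / (c * \<beta>\<^sup>2)}"
      using q(1,2) val[OF q(1)] unfolding q(3) by (intro CollectI conjI imageI) simp_all
  next
    fix z assume "z \<in> {z \<in> induced_chart \<kappa> ` over_chart (slit_cotangent_bundle M A) \<kappa>.
        (coord_fun M A K \<kappa> z)\<^sup>2 < 1 / (c * \<beta>\<^sup>2)}"
    then obtain q where q: "q \<in> over_chart (slit_cotangent_bundle M A) \<kappa>" "z = induced_chart \<kappa> q"
      "(coord_fun M A K \<kappa> z)\<^sup>2 < 1 / (c * \<beta>\<^sup>2)" by blast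
    show "z \<in> induced_chart \<kappa> `
      {q \<in> over_chart (slit_cotangent_bundle M A) \<kappa>. (K q)\<^sup>2 < 1 / (c * \<beta>\<^sup>2)}"
      using q(1,3) val[OF q(1)] unfolding q(2) by (intro imageI CollectI conjI) simp_all
  qed
qed

lemma cartan_chartI:
  assumes K: "cartan_space M A K" "constant_curvature M A K c"
  shows "cartan_chart (snd \<kappa> ` fst \<kappa>) (coord_fun M A K \<kappa>) c"
proof
  show "open (snd \<kappa> ` fst \<kappa>)" by (rule chart_facts(2)[OF chart])
  show "smooth_on (snd \<kappa> ` fst \<kappa> \<times> - {0}) (coord_fun M A K \<kappa>)"
    using K(1) chart coord_domain_slit unfolding cartan_space_def by metis
  fix z :: "'n phase" assume z: "z \<in> snd \<kappa> ` fst \<kappa> \<times> - {0}"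
  then have zs: "z \<in> coord_domain (slit_cotangent_bundle M A) \<kappa>" by (simp add: coord_domain_slit)
  show "coord_fun M A K \<kappa> (fst z, t *\<^sub>R snd z) = t * coord_fun M A K \<kappa> z" if "t > 0" for t
  proof -
    obtain x p where zx: "z = (snd \<kappa> x, p)" "x \<in> fst \<kappa>" using z by auto
    have "(x, covec x p) \<in> cotangent_bundle M A"
      using zx(2) chart_topspace covec_in by (simp add: cotangent_bundle_def)
    then have "K (x, \<lambda>\<kappa>'. t *\<^sub>R covec x p \<kappa>') = t * K (x, covec x p)"
      using K(1) that unfolding cartan_space_def by blast
    then show ?thesis using coord_fun_covec[OF zx(2)] by (simp add: zx(1) covec_scale)
  qed
  show "(\<Sum>i\<in>UNIV. \<Sum>j\<in>UNIV. g_up (coord_fun M A K \<kappa>) z $ i $ j * \<zeta> $ i * \<zeta> $ j) > 0" if "\<zeta> \<noteq> 0" for \<zeta>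
    using K(1) chart zs that unfolding cartan_space_def by blast
  show "R_curv (coord_fun M A K \<kappa>) k i j z = c * (g_low (coord_fun M A K \<kappa>) z $ j $ k * snd z $ i
      - g_low (coord_fun M A K \<kappa>) z $ i $ k * snd z $ j)" for k i j
    using K(2) chart zs unfolding constant_curvature_def by blast
qed

end

text \<open>Both properties are imposed chart by chart, and the equivalence already holds in each
  chart separately. The assumption on \<open>D\<close> identifies its coordinate image with the set
  where \<open>disc\<close> is positive.\<close>

lemma locally_symmetric_kaehler_iff:
  fixes M :: "'m topology" and A :: "('m, 'n::finite) chart set"
    and K :: "'m \<times> ('m, 'n) covector \<Rightarrow> real" and c \<beta> :: real
  assumes K: "cartan_space M A K" "constant_curvature M A K c" and \<beta>: "\<beta> > 0" and c: "c \<noteq> 0"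
    and D: "\<And>\<kappa>. \<kappa> \<in> A \<Longrightarrow> coord_domain D \<kappa> =
      {z \<in> (snd \<kappa> ` fst \<kappa>) \<times> - {0}. 1 - c * \<beta>\<^sup>2 * (coord_fun M A K \<kappa> z)\<^sup>2 > 0}"
  shows "locally_symmetric_kaehler A D (\<lambda>\<kappa>. GG c \<beta> (coord_fun M A K \<kappa>))
      (\<lambda>\<kappa>. JJ c \<beta> (coord_fun M A K \<kappa>)) \<longleftrightarrow> riemannian_space M A K"
proof -
  have "kaehler_on (coord_domain D \<kappa>) (GG c \<beta> (coord_fun M A K \<kappa>)) (JJ c \<beta> (coord_fun M A K \<kappa>)) \<and>
      locally_symmetric_on (coord_domain D \<kappa>) (GG c \<beta> (coord_fun M A K \<kappa>)) \<longleftrightarrow>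
    (\<forall>z \<in> coord_domain (slit_cotangent_bundle M A) \<kappa>. \<forall>i j k.
      cartan_tensor (coord_fun M A K \<kappa>) i j k z = 0)" if k: "\<kappa> \<in> A" for \<kappa>
  proof -
    interpret mc: manifold_chart M A \<kappa>
      by unfold_locales (use K(1) k in \<open>auto simp: cartan_space_def\<close>)
    interpret cc: cartan_chart "snd \<kappa> ` fst \<kappa>" "coord_fun M A K \<kappa>" c
      by (rule mc.cartan_chartI[OF K])
    interpret cm: cartan_metric "snd \<kappa> ` fst \<kappa>" "coord_fun M A K \<kappa>" c \<beta>
      by unfold_locales (rule \<beta> c)+
    have "coord_domain D \<kappa> = cm.W"
      by (simp add: D[OF k] cm.W_def cm.disc_def cc.h_def cc.S_def)
    moreover have "coord_domain (slit_cotangent_bundle M A) \<kappa> = cc.S"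
      by (simp add: mc.coord_domain_slit cc.S_def)
    ultimately show ?thesis using cm.kaehler_iff_riemannian by simp
  qed
  then show ?thesis
    unfolding locally_symmetric_kaehler_def riemannian_space_def by blast
qed

theorem theorem4p3:
  fixes M :: "'m topology" and A :: "('m, 'n::finite) chart set"
    and K :: "'m \<times> ('m, 'n) covector \<Rightarrow> real" and c \<beta> :: real
  assumes "cartan_space M A K"
    and "constant_curvature M A K c"
    and "\<beta> > 0"
  shows "(c < 0 \<longrightarrow>
           (locally_symmetric_kaehler A (slit_cotangent_bundle M A)
              (\<lambda>\<kappa>. GG c \<beta> (coord_fun M A K \<kappa>)) (\<lambda>\<kappa>. JJ c \<beta> (coord_fun M A K \<kappa>))
            \<longleftrightarrow> riemannian_space M A K)) \<and>
         (c > 0 \<longrightarrow>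
           (locally_symmetric_kaehler A (tube M A K c \<beta>)
              (\<lambda>\<kappa>. GG c \<beta> (coord_fun M A K \<kappa>)) (\<lambda>\<kappa>. JJ c \<beta> (coord_fun M A K \<kappa>))
            \<longleftrightarrow> riemannian_space M A K))"
proof -
  have mc: "manifold_chart M A \<kappa>" if "\<kappa> \<in> A" for \<kappa>
    using assms(1) that unfolding cartan_space_def by (intro manifold_chart.intro) blast+
  have slit: "coord_domain (slit_cotangent_bundle M A) \<kappa> =
      {z \<in> (snd \<kappa> ` fst \<kappa>) \<times> - {0}. 1 - c * \<beta>\<^sup>2 * (coord_fun M A K \<kappa> z)\<^sup>2 > 0}"
    if "c < 0" "\<kappa> \<in> A" for \<kappa>
  proof -
    have "c * \<beta>\<^sup>2 * r\<^sup>2 \<le> 0" for r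
      using that(1) by (intro mult_nonpos_nonneg) auto
    then have "1 - c * \<beta>\<^sup>2 * r\<^sup>2 > 0" for r
      by (rule order.strict_trans1[of "c * \<beta>\<^sup>2 * r\<^sup>2" 0 1, THEN diff_gt_0_iff_gt[THEN iffD2]]) simp
    then show ?thesis unfolding manifold_chart.coord_domain_slit[OF mc[OF that(2)]] by blast
  qed
  have tube: "coord_domain (tube M A K c \<beta>) \<kappa> =
      {z \<in> (snd \<kappa> ` fst \<kappa>) \<times> - {0}. 1 - c * \<beta>\<^sup>2 * (coord_fun M A K \<kappa> z)\<^sup>2 > 0}"
    if "c > 0" "\<kappa> \<in> A" for \<kappa>
  proof -
    have "r < 1 / (c * \<beta>\<^sup>2) \<longleftrightarrow> 1 - c * \<beta>\<^sup>2 * r > 0" for r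
      using that(1) assms(3) by (simp add: pos_less_divide_eq mult.commute)
    then show ?thesis unfolding manifold_chart.coord_domain_tube[OF mc[OF that(2)]] by simp
  qed
  show ?thesis
  proof (intro conjI impI)
    assume c: "c < 0"
    show "locally_symmetric_kaehler A (slit_cotangent_bundle M A)
          (\<lambda>\<kappa>. GG c \<beta> (coord_fun M A K \<kappa>)) (\<lambda>\<kappa>. JJ c \<beta> (coord_fun M A K \<kappa>))
        \<longleftrightarrow> riemannian_space M A K"
      by (rule locally_symmetric_kaehler_iff[OF assms _ slit[OF c]]) (use c in simp)
  next
    assume c: "c > 0"
    show "locally_symmetric_kaehler A (tube M A K c \<beta>)
          (\<lambda>\<kappa>. GG c \<beta> (coord_fun M A K \<kappa>)) (\<lambda>\<kappa>. JJ c \<beta> (coord_fun M A K \<kappa>))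
        \<longleftrightarrow> riemannian_space M A K"
      by (rule locally_symmetric_kaehler_iff[OF assms _ tube[OF c]]) (use c in simp)
  qed
qed

end
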